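(* Assume $\mathsf M$ is $\Delta$-absorbing and atomless. Let $p\in\mathbb N^*$, let $g:\mathbf X\times\mathbf A\to\mathbb R^p$ be bounded measurable with $g(x,a)=0$ for $(x,a)\in\Delta\times\mathbf A$, and let $\alpha\in\mathbb R^p$. Then $\mathrm{ext}(\mathcal O(g,\alpha))=\mathcal O_{\mathbb D}(g,\alpha)$.
   Context: Model. $(\mathbf X,\mathfrak X)$ is a measurable space (state space), $\mathbf A$ is a Borel space (action space) with Borel $\sigma$-algebra $\mathfrak B(\mathbf A)$; for each $x\in\mathbf X$, $\mathbf A(x)\subseteq\mathbf A$ is a nonempty measurable set of admissible actions; $\mathbf K=\{(x,a)\in\mathbf X\times\mathbf A: a\in\mathbf A(x)\}$; $Q$ is a stochastic kernel on $\mathbf X$ given $(\mathbf X\times\mathbf A,\mathfrak X\otimes\mathfrak B(\mathbf A))$; $\eta$ is a probability measure on $\mathbf X$; $r:\mathbf X\times\mathbf A\to\mathbb R^d$ ($d\ge1$) is bounded measurable. The model $\mathsf M=(\mathbf X,\mathbf A,\{\mathbf A(x)\}_{x},Q,\eta,r)$ satisfies the measurability conditions: $\mathbf K\in\mathfrak X\otimes\mathfrak B(\mathbf A)$, and there is a measurable $\theta:\mathbf X\to\mathbf A$ with $\theta(x)\in\mathbf A(x)$ for all $x$. Policies. $\mathbf H_0=\mathbf X$, $\mathbf H_n=\mathbf H_{n-1}\times\mathbf A\times\mathbf X$. A policy $\pi=\{\pi_n\}_{n\ge0}$ is a sequence of stochastic kernels $\pi_n$ on $\mathbf A$ given $\mathbf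 H_n$ with $\pi_n(\mathbf A(x_n)|h_n)=1$ for all $h_n=(x_0,a_0,\dots,x_n)$; $\mathbf\Pi$ is the set of all policies. For $\pi\in\mathbf\Pi$, $\mathbb P_\pi$ is the unique probability on $\Omega=(\mathbf X\times\mathbf A)^\infty$ (product $\sigma$-algebra, coordinate processes $X_n,A_n$, histories $H_n$) with $X_0\sim\eta$, $\mathbb P_\pi(A_n\in\cdot\,|H_n)=\pi_n(\cdot|H_n)$ and $\mathbb P_\pi(X_{n+1}\in\cdot\,|H_n,A_n)=Q(\cdot|X_n,A_n)$; $\mathbb E_\pi$ is its expectation. $\mathbb D$ is the set of measurable $\phi:\mathbf X\to\mathbf A$ with $\phi(x)\in\mathbf A(x)$ for all $x$, identified with the deterministic stationary policies $\pi_n(\cdot|h_n)=\delta_{\phi(x_n)}$. Absorbing models. For $\Delta\in\mathfrak X$ let $T_\Delta=\min\{n\ge0:X_n\in\Delta\}$ ($\min\emptyset=\infty$). $\mathsf M$ is $\Delta$-absorbing if $Q(\Delta|x,a)=1$ and $r(x,a)=0$ for all $(x,a)\in\Delta\times\mathbf A$, and $\mathbb E_\pi[T_\Delta]<\infty$ for all $\pi\in\mathbf\Pi$. Atomless: $\mathsf M$ is atomless if the measure $B\mapsto\eta(B\cap\Delta^c)$ is atomless and there is a countably generated sub-$\sigma$-algebra $\mathfrak X_0\subseteq\mathfrak X$ such that for every $(x,a)\in\Delta^c\times\mathbf A$ the measure $B\mapsto Q(B\cap\Delta^c|x,a)$ restricted to $\mathfrak X_0$ is atomless. Occupation measures. For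 a $\Delta$-absorbing model and $\pi\in\mathbf\Pi$, $\mu_\pi(\Gamma)=\mathbb E_\pi\big[\sum_{t\ge0}\mathbf 1_{\{T_\Delta>t\}}\mathbf 1_{\{(X_t,A_t)\in\Gamma\}}\big]$ for $\Gamma\in\mathfrak X\otimes\mathfrak B(\mathbf A)$; $\mathcal O=\{\mu_\pi:\pi\in\mathbf\Pi\}$ and $\mathcal O_{\mathbb D}=\{\mu_\phi:\phi\in\mathbb D\}$. For a measure $\mu$ and vector function $f$, $\mu(f)=(\int f_1d\mu,\dots,\int f_pd\mu)$. Constraint sets: $\mathcal H(g,\alpha)=\{\mu\in\mathcal M(\mathbf X\times\mathbf A):\mu(g)=\alpha\}$ (with $\mathcal M$ the finite signed measures), $\mathcal O(g,\alpha)=\mathcal O\cap\mathcal H(g,\alpha)$, $\mathcal O_{\mathbb D}(g,\alpha)=\mathcal O_{\mathbb D}\cap\mathcal H(g,\alpha)$. $\mathrm{ext}(\cdot)$ denotes the set of extreme points. *)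

theory Defs
  imports "HOL-Probability.Probability"
begin

text \<open>A history h_n = (x_0,a_0,...,x_{n-1},a_{n-1},x_n) is represented as a pair (f, x_n)
  where f is an extensional function on {..<n} with f i = (x_i, a_i).\<close>

type_synonym ('x,'a) hist = "(nat \<Rightarrow> 'x \<times> 'a) \<times> 'x"

definition HS :: "'x measure \<Rightarrow> 'a measure \<Rightarrow> nat \<Rightarrow> ('x,'a) hist measure" where
  "HS MX MA n = (PiM {..<n} (\<lambda>_. MX \<Otimes>\<^sub>M MA)) \<Otimes>\<^sub>M MX"

definition borel_iso :: "'a measure \<Rightarrow> 'p::polish_space set \<Rightarrow> bool" where
  "borel_iso MA B \<longleftrightarrow> B \<in> sets borel \<and>
     (\<exists>f g. f \<in> measurable MA (restrict_space borel B) \<and> g \<in> measurable (restrict_space borel B) MA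
        \<and> (\<forall>x\<in>space MA. g (f x) = x) \<and> (\<forall>y\<in>B. f (g y) = y))"

definition Kset :: "'x measure \<Rightarrow> 'a measure \<Rightarrow> ('x \<Rightarrow> 'a set) \<Rightarrow> ('x \<times> 'a) set" where
  "Kset MX MA Aset = {(x,a). x \<in> space MX \<and> a \<in> space MA \<and> a \<in> Aset x}"

definition model :: "'x measure \<Rightarrow> 'a measure \<Rightarrow> ('x \<Rightarrow> 'a set) \<Rightarrow> ('x \<times> 'a \<Rightarrow> 'x measure)
    \<Rightarrow> 'x measure \<Rightarrow> nat \<Rightarrow> (nat \<Rightarrow> 'x \<times> 'a \<Rightarrow> real) \<Rightarrow> bool" where
  "model MX MA Aset Q \<eta> d r \<longleftrightarrow>
     (\<forall>x\<in>space MX. Aset x \<in> sets MA \<and> Aset x \<noteq> {}) \<and>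
     Q \<in> measurable (MX \<Otimes>\<^sub>M MA) (prob_algebra MX) \<and>
     prob_space \<eta> \<and> sets \<eta> = sets MX \<and>
     d \<ge> 1 \<and> (\<forall>i<d. r i \<in> borel_measurable (MX \<Otimes>\<^sub>M MA) \<and> bounded (r i ` space (MX \<Otimes>\<^sub>M MA))) \<and>
     Kset MX MA Aset \<in> sets (MX \<Otimes>\<^sub>M MA) \<and>
     (\<exists>\<theta>\<in>measurable MX MA. \<forall>x\<in>space MX. \<theta> x \<in> Aset x)"

definition is_policy :: "'x measure \<Rightarrow> 'a measure \<Rightarrow> ('x \<Rightarrow> 'a set)
    \<Rightarrow> (nat \<Rightarrow> ('x,'a) hist \<Rightarrow> 'a measure) \<Rightarrow> bool" where
  "is_policy MX MA Aset \<pi> \<longleftrightarrow>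
     (\<forall>n. \<pi> n \<in> measurable (HS MX MA n) (prob_algebra MA) \<and>
          (\<forall>h\<in>space (HS MX MA n). emeasure (\<pi> n h) (Aset (snd h)) = 1))"

text \<open>Law of the history H_n under P_pi (finite-dimensional distributions of the
  Ionescu-Tulcea measure).\<close>
primrec hlaw :: "'x measure \<Rightarrow> 'a measure \<Rightarrow> ('x \<times> 'a \<Rightarrow> 'x measure) \<Rightarrow> 'x measure
    \<Rightarrow> (nat \<Rightarrow> ('x,'a) hist \<Rightarrow> 'a measure) \<Rightarrow> nat \<Rightarrow> ('x,'a) hist measure" where
  "hlaw MX MA Q \<eta> \<pi> 0 = distr \<eta> (HS MX MA 0) (\<lambda>x. (\<lambda>_. undefined, x))"
| "hlaw MX MA Q \<eta> \<pi> (Suc n) =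
     bind (hlaw MX MA Q \<eta> \<pi> n) (\<lambda>h. bind (\<pi> n h) (\<lambda>a.
       distr (Q (snd h, a)) (HS MX MA (Suc n)) (\<lambda>y. ((fst h)(n := (snd h, a)), y))))"

definition halaw :: "'x measure \<Rightarrow> 'a measure \<Rightarrow> ('x \<times> 'a \<Rightarrow> 'x measure) \<Rightarrow> 'x measure
    \<Rightarrow> (nat \<Rightarrow> ('x,'a) hist \<Rightarrow> 'a measure) \<Rightarrow> nat \<Rightarrow> (('x,'a) hist \<times> 'a) measure" where
  "halaw MX MA Q \<eta> \<pi> n = bind (hlaw MX MA Q \<eta> \<pi> n)
      (\<lambda>h. distr (\<pi> n h) (HS MX MA n \<Otimes>\<^sub>M MA) (\<lambda>a. (h, a)))"

text \<open>The event {T_Delta > n} = {X_0,...,X_n all outside Delta}, expressed on H_n.\<close>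
definition alive :: "'x set \<Rightarrow> nat \<Rightarrow> ('x,'a) hist \<Rightarrow> bool" where
  "alive \<Delta> n h \<longleftrightarrow> (\<forall>i<n. fst (fst h i) \<notin> \<Delta>) \<and> snd h \<notin> \<Delta>"

text \<open>E_pi[T_Delta] = sum over t of P_pi(T_Delta > t).\<close>
definition expT :: "'x measure \<Rightarrow> 'a measure \<Rightarrow> ('x \<times> 'a \<Rightarrow> 'x measure) \<Rightarrow> 'x measure
    \<Rightarrow> 'x set \<Rightarrow> (nat \<Rightarrow> ('x,'a) hist \<Rightarrow> 'a measure) \<Rightarrow> ennreal" where
  "expT MX MA Q \<eta> \<Delta> \<pi> =
     (\<Sum>t. emeasure (hlaw MX MA Q \<eta> \<pi> t) {h \<in> space (HS MX MA t). alive \<Delta> t h})"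

definition absorbing :: "'x measure \<Rightarrow> 'a measure \<Rightarrow> ('x \<Rightarrow> 'a set) \<Rightarrow> ('x \<times> 'a \<Rightarrow> 'x measure)
    \<Rightarrow> 'x measure \<Rightarrow> nat \<Rightarrow> (nat \<Rightarrow> 'x \<times> 'a \<Rightarrow> real) \<Rightarrow> 'x set \<Rightarrow> bool" where
  "absorbing MX MA Aset Q \<eta> d r \<Delta> \<longleftrightarrow>
     \<Delta> \<in> sets MX \<and>
     (\<forall>x\<in>\<Delta>. \<forall>a\<in>space MA. emeasure (Q (x,a)) \<Delta> = 1 \<and> (\<forall>i<d. r i (x,a) = 0)) \<and>
     (\<forall>\<pi>. is_policy MX MA Aset \<pi> \<longrightarrow> expT MX MA Q \<eta> \<Delta> \<pi> < \<infinity>)"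

definition atomless_on :: "'x set set \<Rightarrow> ('x set \<Rightarrow> ennreal) \<Rightarrow> bool" where
  "atomless_on S \<nu> \<longleftrightarrow>
     \<not> (\<exists>B\<in>S. \<nu> B > 0 \<and> (\<forall>C\<in>S. C \<subseteq> B \<longrightarrow> \<nu> C = 0 \<or> \<nu> C = \<nu> B))"

definition atomless_model :: "'x measure \<Rightarrow> 'a measure \<Rightarrow> ('x \<times> 'a \<Rightarrow> 'x measure)
    \<Rightarrow> 'x measure \<Rightarrow> 'x set \<Rightarrow> bool" where
  "atomless_model MX MA Q \<eta> \<Delta> \<longleftrightarrow>
     atomless_on (sets MX) (\<lambda>B. emeasure \<eta> (B - \<Delta>)) \<and>
     (\<exists>G. countable G \<and> sigma_sets (space MX) G \<subseteq> sets MX \<and>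
        (\<forall>x\<in>space MX - \<Delta>. \<forall>a\<in>space MA.
           atomless_on (sigma_sets (space MX) G) (\<lambda>B. emeasure (Q (x,a)) (B - \<Delta>))))"

definition occ :: "'x measure \<Rightarrow> 'a measure \<Rightarrow> ('x \<times> 'a \<Rightarrow> 'x measure) \<Rightarrow> 'x measure
    \<Rightarrow> 'x set \<Rightarrow> (nat \<Rightarrow> ('x,'a) hist \<Rightarrow> 'a measure) \<Rightarrow> ('x \<times> 'a) measure" where
  "occ MX MA Q \<eta> \<Delta> \<pi> = measure_of (space (MX \<Otimes>\<^sub>M MA)) (sets (MX \<Otimes>\<^sub>M MA))
     (\<lambda>\<Gamma>. \<Sum>t. emeasure (halaw MX MA Q \<eta> \<pi> t)
         {(h,a) \<in> space (HS MX MA t \<Otimes>\<^sub>M MA). alive \<Delta> t h \<and> (snd h, a) \<in> \<Gamma>})"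

definition det_policies :: "'x measure \<Rightarrow> 'a measure \<Rightarrow> ('x \<Rightarrow> 'a set) \<Rightarrow> ('x \<Rightarrow> 'a) set" where
  "det_policies MX MA Aset = {\<phi> \<in> measurable MX MA. \<forall>x\<in>space MX. \<phi> x \<in> Aset x}"

definition det_policy :: "'a measure \<Rightarrow> ('x \<Rightarrow> 'a) \<Rightarrow> nat \<Rightarrow> ('x,'a) hist \<Rightarrow> 'a measure" where
  "det_policy MA \<phi> = (\<lambda>n h. return MA (\<phi> (snd h)))"

text \<open>mu(g) = alpha, for g : X x A -> R^p given componentwise as g 0, ..., g (p-1).\<close>
definition constr :: "nat \<Rightarrow> (nat \<Rightarrow> 'b \<Rightarrow> real) \<Rightarrow> (nat \<Rightarrow> real) \<Rightarrow> 'b measure \<Rightarrow> bool" where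
  "constr p g \<alpha> \<mu> \<longleftrightarrow> (\<forall>i<p. integral\<^sup>L \<mu> (g i) = \<alpha> i)"

definition Ocon :: "'x measure \<Rightarrow> 'a measure \<Rightarrow> ('x \<Rightarrow> 'a set) \<Rightarrow> ('x \<times> 'a \<Rightarrow> 'x measure)
    \<Rightarrow> 'x measure \<Rightarrow> 'x set \<Rightarrow> nat \<Rightarrow> (nat \<Rightarrow> 'x \<times> 'a \<Rightarrow> real) \<Rightarrow> (nat \<Rightarrow> real)
    \<Rightarrow> ('x \<times> 'a) measure set" where
  "Ocon MX MA Aset Q \<eta> \<Delta> p g \<alpha> =
     {\<mu>. (\<exists>\<pi>. is_policy MX MA Aset \<pi> \<and> \<mu> = occ MX MA Q \<eta> \<Delta> \<pi>) \<and> constr p g \<alpha> \<mu>}"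

definition ODcon :: "'x measure \<Rightarrow> 'a measure \<Rightarrow> ('x \<Rightarrow> 'a set) \<Rightarrow> ('x \<times> 'a \<Rightarrow> 'x measure)
    \<Rightarrow> 'x measure \<Rightarrow> 'x set \<Rightarrow> nat \<Rightarrow> (nat \<Rightarrow> 'x \<times> 'a \<Rightarrow> real) \<Rightarrow> (nat \<Rightarrow> real)
    \<Rightarrow> ('x \<times> 'a) measure set" where
  "ODcon MX MA Aset Q \<eta> \<Delta> p g \<alpha> =
     {\<mu>. (\<exists>\<phi>\<in>det_policies MX MA Aset. \<mu> = occ MX MA Q \<eta> \<Delta> (det_policy MA \<phi>)) \<and> constr p g \<alpha> \<mu>}"

text \<open>Extreme points of a set S of (finite, nonnegative) measures on the sigma-algebra of N,
  in the sense of the linear space of finite signed measures.\<close>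
definition extreme_pts :: "'b measure \<Rightarrow> 'b measure set \<Rightarrow> 'b measure set" where
  "extreme_pts N S = {\<mu> \<in> S. \<forall>\<nu>1\<in>S. \<forall>\<nu>2\<in>S. \<forall>l::real. 0 < l \<and> l < 1 \<and>
      (\<forall>\<Gamma>\<in>sets N. emeasure \<mu> \<Gamma> = ennreal l * emeasure \<nu>1 \<Gamma> + ennreal (1 - l) * emeasure \<nu>2 \<Gamma>)
      \<longrightarrow> \<nu>1 = \<nu>2}"

end

theory Submission
  imports Defs
begin

text \<open>
  An occupation measure carried by the graph of some \<open>\<phi>\<close> determines the alive part of the process
  step by step, so it equals \<open>\<mu>\<^sub>\<phi>\<close>; since a convex component of \<open>\<mu>\<^sub>\<phi>\<close> lives on the same graph,
  \<open>\<mu>\<^sub>\<phi>\<close> is extreme. Conversely, disintegrate an occupation measure as \<open>\<lambda> \<otimes> \<sigma>\<close>. Then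
  \<open>\<mu> = \<mu>\<^sub>\<sigma>\<close>: iterating the balance equation leaves a remainder \<open>\<lambda> P\<^sup>n\<close>, which vanishes because every
  policy that follows the original one up to some time and \<open>\<sigma>\<close> afterwards has finite expected
  absorption time. If some \<open>\<sigma>(D|x)\<close> lies strictly between 0 and 1 with positive
  probability at a time \<open>t\<close>, replace \<open>\<sigma>\<close> by \<open>(1 \<plusminus> h) \<sigma>\<close> at that single time only. The occupation
  measure is affine in \<open>h\<close>, and injective since testing it against \<open>h\<close> itself yields \<open>\<integral> h\<^sup>2\<close>. The law
  of \<open>X\<^sub>t\<close> is atomless, so such \<open>h\<close> form an infinite-dimensional space, some nonzero
  \<open>h\<close> satisfies the \<open>p\<close> linear constraints, and \<open>\<mu>\<close> is the midpoint of two distinct points. Hence at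
  an extreme point \<open>\<sigma>\<close> takes only the values 0 and 1, which makes it a Dirac kernel.
\<close>

section \<open>Linear algebra and atomless measures\<close>

text \<open>A perturbation of the kernel at all times would enter the occupation measure
  nonlinearly, because the later state laws depend on it too. A change at one time t leaves the past
  untouched and keeps the future given (X_t, A_t) fixed, so the weight 1 + h enters exactly once.
  The price is that the competitors are no longer stationary, which is why Markov policies with
  time-dependent kernels appear. Injectivity rests on the conditional mean of h being zero. The
  functions 1 + h and 1 then have the same conditional expectation given the state, so they collect
  the same value at every time other than t, although the laws of later states do move with h. Only
  the difference at time t survives, and it contains the second moment of h. Finite expected
  absorption time is known for each policy separately, without a common bound. The remainder in the
  balance equation is therefore treated by pointwise convergence and an integrable majorant, not by
  a rate.\<close>

lemma exists_nontrivial_kernel_vector: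
  fixes G :: "nat \<Rightarrow> 'j \<Rightarrow> real"
  assumes "finite J" "p < card J"
  shows "\<exists>c. (\<exists>j\<in>J. c j \<noteq> 0) \<and> (\<forall>i<p. (\<Sum>j\<in>J. c j * G i j) = 0)"
  using assms
proof (induction p arbitrary: G J)
  case 0
  then obtain j where "j \<in> J" by fastforce
  then show ?case by (intro exI[of _ "\<lambda>_. 1"]) auto
next
  case (Suc p)
  show ?case
  proof (cases "\<forall>j\<in>J. G p j = 0")
    case True
    obtain c where "\<exists>j\<in>J. c j \<noteq> 0" "\<forall>i<p. (\<Sum>j\<in>J. c j * G i j) = 0"
      using Suc.IH[of J G] Suc.prems by auto
    with True show ?thesis by (intro exI[of _ c]) (auto simp: less_Suc_eq)
  next
    case False
    then obtain j0 where j0: "j0 \<in> J" "G p j0 \<noteq> 0" by auto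
    define J' where "J' = J - {j0}"
    have J': "finite J'" "p < card J'" using Suc.prems j0 by (auto simp: J'_def card_Diff_singleton)
    \<comment> \<open>One elimination step with pivot \<open>G p j0\<close>: constraint
      \<open>p\<close> is solved for the coefficient of \<open>j0\<close> and substituted into the
      other constraints.\<close>
    obtain c where c: "\<exists>j\<in>J'. c j \<noteq> 0"
      "\<forall>i<p. (\<Sum>j\<in>J'. c j * (G i j - G i j0 * G p j / G p j0)) = 0"
      using Suc.IH[OF J', of "\<lambda>i j. G i j - G i j0 * G p j / G p j0"] by auto
    define e where "e = (\<lambda>j. if j = j0 then - (\<Sum>k\<in>J'. c k * G p k) / G p j0 else c j)"
    have split: "(\<Sum>j\<in>J. e j * G i j) = - (\<Sum>k\<in>J'. c k * G p k) / G p j0 * G i j0 + (\<Sum>j\<in>J'. c j * G i j)" for i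
    proof -
      have "(\<Sum>j\<in>J. e j * G i j) = e j0 * G i j0 + (\<Sum>j\<in>J'. e j * G i j)"
        unfolding J'_def using Suc.prems j0 by (subst sum.remove[of J j0]) auto
      also have "(\<Sum>j\<in>J'. e j * G i j) = (\<Sum>j\<in>J'. c j * G i j)"
        by (rule sum.cong) (auto simp: e_def J'_def)
      finally show ?thesis by (simp add: e_def)
    qed
    have "(\<Sum>j\<in>J. e j * G i j) = 0" if "i < Suc p" for i
    proof (cases "i = p")
      case True
      then show ?thesis using j0 by (simp add: split)
    next
      case False
      then have "i < p" using that by simp
      then have "(\<Sum>j\<in>J'. c j * (G i j - G i j0 * G p j / G p j0)) = 0" using c by blast
      then have "(\<Sum>j\<in>J'. c j * G i j) - (\<Sum>k\<in>J'. c k * G p k) / G p j0 * G i j0 = 0"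
        by (simp add: algebra_simps sum_subtractf sum_distrib_left sum_divide_distrib)
      then show ?thesis by (simp add: split)
    qed
    moreover have "\<exists>j\<in>J. e j \<noteq> 0" using c(1) by (auto simp: e_def J'_def)
    ultimately show ?thesis by blast
  qed
qed

text \<open>The normalization serves the bound 1 on perturbations: for disjoint supports, a bound on
  the coefficients is a bound on the combination.\<close>

lemma exists_bounded_kernel_vector:
  fixes G :: "nat \<Rightarrow> 'j \<Rightarrow> real"
  assumes J: "finite J" "p < card J"
  shows "\<exists>c. (\<exists>j\<in>J. c j \<noteq> 0) \<and> (\<forall>j\<in>J. \<bar>c j\<bar> \<le> 1) \<and> (\<forall>i<p. (\<Sum>j\<in>J. c j * G i j) = 0)"
proof -
  obtain c where c: "\<exists>j\<in>J. c j \<noteq> 0" "\<forall>i<p. (\<Sum>j\<in>J. c j * G i j) = 0"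
    using exists_nontrivial_kernel_vector[OF J, of G] by blast
  define m where "m = (\<Sum>j\<in>J. \<bar>c j\<bar>)"
  have m: "m > 0"
  proof -
    obtain j where "j \<in> J" "c j \<noteq> 0" using c(1) by blast
    then show ?thesis unfolding m_def by (intro sum_pos2[of J j]) (use J in auto)
  qed
  have "\<bar>c j\<bar> \<le> m" if "j \<in> J" for j
    unfolding m_def by (rule member_le_sum) (use that J in auto)
  then have "\<bar>c j / m\<bar> \<le> 1" if "j \<in> J" for j using m that by simp
  moreover have "(\<Sum>j\<in>J. c j / m * G i j) = 0" if "i < p" for i
  proof -
    have "(\<Sum>j\<in>J. c j / m * G i j) = (\<Sum>j\<in>J. c j * G i j) / m"
      by (simp add: sum_divide_distrib)
    then show ?thesis using c(2) that by simp
  qed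
  ultimately show ?thesis using c(1) m by (intro exI[of _ "\<lambda>j. c j / m"]) auto
qed

text \<open>Atomlessness splits \<open>S\<close> into \<open>D\<close> and \<open>S - D\<close>,
  both of positive measure since the measure is finite. One keeps \<open>D\<close> and looks for the
  other sets inside \<open>S - D\<close>.\<close>

lemma atomless_disjoint_subsets:
  assumes "finite_measure M" and atomless: "atomless_on (sets M) (emeasure M)"
    and "S \<in> sets M" "emeasure M S > 0"
  shows "\<exists>C::nat \<Rightarrow> _. (\<forall>j\<le>n. C j \<in> sets M \<and> C j \<subseteq> S \<and> emeasure M (C j) > 0) \<and> disjoint_family_on C {..n}"
  using assms(3,4)
proof (induction n arbitrary: S)
  case 0
  then show ?case by (intro exI[of _ "\<lambda>_. S"]) (auto simp: disjoint_family_on_def)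
next
  case (Suc n)
  interpret finite_measure M by fact
  obtain D where D: "D \<in> sets M" "D \<subseteq> S" "emeasure M D \<noteq> 0" "emeasure M D \<noteq> emeasure M S"
    using atomless Suc.prems unfolding atomless_on_def by blast
  have "emeasure M (S - D) = emeasure M S - emeasure M D"
    using D Suc.prems by (intro emeasure_Diff) auto
  moreover have "emeasure M D < emeasure M S"
    using D emeasure_mono[OF D(2) Suc.prems(1)] by (simp add: less_le)
  ultimately have pos: "emeasure M (S - D) > 0"
    by (simp add: diff_gr0_ennreal)
  obtain C :: "nat \<Rightarrow> _" where C: "\<forall>j\<le>n. C j \<in> sets M \<and> C j \<subseteq> S - D \<and> emeasure M (C j) > 0"
    "disjoint_family_on C {..n}"
    using Suc.IH[of "S - D"] D(1) Suc.prems(1) pos by blast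
  define C' where "C' = (\<lambda>j. if j = Suc n then D else C j)"
  have "\<forall>j\<le>Suc n. C' j \<in> sets M \<and> C' j \<subseteq> S \<and> emeasure M (C' j) > 0"
    using C(1) D by (auto simp: C'_def le_Suc_eq zero_less_iff_neq_zero)
  moreover have "disjoint_family_on C' {..Suc n}"
    unfolding disjoint_family_on_def
  proof (intro ballI impI)
    fix i j assume "i \<in> {..Suc n}" "j \<in> {..Suc n}" "i \<noteq> j"
    then consider "i \<le> n" "j \<le> n" | "i = Suc n" "j \<le> n" | "i \<le> n" "j = Suc n" by fastforce
    then show "C' i \<inter> C' j = {}"
    proof cases
      case 1
      then show ?thesis using C(2) \<open>i \<noteq> j\<close> by (auto simp: C'_def disjoint_family_on_def)
    next
      case 2
      then have "C' i = D" "C' j \<subseteq> S - D" using C(1) by (auto simp: C'_def)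
      then show ?thesis by blast
    next
      case 3
      then have "C' j = D" "C' i \<subseteq> S - D" using C(1) by (auto simp: C'_def)
      then show ?thesis by blast
    qed
  qed
  ultimately show ?case by blast
qed

section \<open>Disintegration over a Borel space\<close>

text \<open>Digits 0 and 2 leave the gap between 1/3 and 2/3 free, so comparing \<open>t n\<close>
  with 1/2 reads off \<open>c n\<close>, and the recursion shifts to the next digit. No number has
  two expansions of this kind.\<close>

lemma ternary_decode:
  fixes c :: "nat \<Rightarrow> real"
  assumes c: "\<And>n. c n = 0 \<or> c n = 1"
  defines "t \<equiv> \<lambda>n. \<Sum>m. 2 * c (n + m) / 3 ^ Suc m"
  shows "t n = 2 / 3 * c n + t (Suc n) / 3" "0 \<le> t n" "t n \<le> 1"
proof -
  have geo: "(\<lambda>m. 2 / 3 * (1 / 3 :: real) ^ m) sums (2 / 3 * (1 / (1 - 1 / 3)))"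
    by (intro sums_mult geometric_sums) simp
  have eq: "2 / 3 * (1 / 3 :: real) ^ m = 2 / 3 ^ Suc m" for m by (simp add: power_divide)
  have bd: "0 \<le> 2 * c (n + m) / 3 ^ Suc m" "2 * c (n + m) / 3 ^ Suc m \<le> 2 / 3 ^ Suc m" for n m
    using c[of "n + m"] by auto
  have sm: "summable (\<lambda>m. 2 * c (n + m) / 3 ^ Suc m)" for n
  proof (rule summable_comparison_test'[OF sums_summable[OF geo], of 0])
    fix m show "norm (2 * c (n + m) / 3 ^ Suc m) \<le> 2 / 3 * (1 / 3) ^ m"
      unfolding eq real_norm_def using bd[of n m] by linarith
  qed
  show "0 \<le> t n" unfolding t_def by (rule suminf_nonneg[OF sm]) (use bd in auto)
  have "t n \<le> (\<Sum>m. 2 / 3 * (1 / 3 :: real) ^ m)" unfolding t_def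
    by (rule suminf_le[OF _ sm sums_summable[OF geo]]) (unfold eq, rule bd)
  then show "t n \<le> 1" using sums_unique[OF geo] by simp
  have "t n = 2 * c n / 3 + (\<Sum>m. 2 * c (n + Suc m) / 3 ^ Suc (Suc m))"
    unfolding t_def using suminf_split_head[OF sm[of n]] by simp
  also have "(\<Sum>m. 2 * c (n + Suc m) / 3 ^ Suc (Suc m)) = (\<Sum>m. 2 * c (Suc n + m) / 3 ^ Suc m / 3)"
    by simp
  also have "\<dots> = t (Suc n) / 3" unfolding t_def by (rule suminf_divide[OF sm])
  finally show "t n = 2 / 3 * c n + t (Suc n) / 3" by simp
qed

text \<open>A point is coded by the ternary expansion of its membership in a countable family of balls, and
  recovered as a limit of ball centres. Having a measurable left inverse avoids the question whether
  the image of the coding is a Borel set.\<close>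

lemma polish_real_retract:
  "\<exists>(f :: 'p::polish_space \<Rightarrow> real) g. f \<in> borel_measurable borel \<and> g \<in> borel_measurable borel \<and>
    (\<forall>x. 0 \<le> f x \<and> f x \<le> 1 \<and> g (f x) = x)"
proof -
  obtain D :: "'p set" where D: "countable D" "\<And>X. open X \<Longrightarrow> X \<noteq> {} \<Longrightarrow> \<exists>d\<in>D. d \<in> X"
    using countable_dense_setE by blast
  have "D \<noteq> {}" using D(2)[of UNIV] by auto
  define q where "q = from_nat_into D"
  have range_q: "range q = D" unfolding q_def using \<open>D \<noteq> {}\<close> D(1) by (rule range_from_nat_into)
  \<comment> \<open>Via \<open>prod_decode\<close> the index \<open>m\<close> stands for a pair (n,
    j): the ball of radius 1/(n + 1) about the j-th point of the dense set.\<close>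
  define U where "U m = ball (q (snd (prod_decode m))) (1 / real (Suc (fst (prod_decode m))))" for m
  define c where "c m x = (indicator (U m) x :: real)" for m and x :: 'p
  have c01: "c m x = 0 \<or> c m x = 1" for m x by (simp add: c_def indicator_def)
  define t where "t n x = (\<Sum>m. 2 * c (n + m) x / 3 ^ Suc m)" for n x
  note t = ternary_decode[of "\<lambda>m. c m x" for x, OF c01, folded t_def]
  \<comment> \<open>The shift on expansions, written for every real \<open>y\<close>: multiply by 3
    and drop the leading digit. On codes, \<open>\<delta> n\<close> returns the tail
    \<open>t n\<close>.\<close>
  define \<delta> :: "nat \<Rightarrow> real \<Rightarrow> real" where "\<delta> = rec_nat (\<lambda>y. y) (\<lambda>n d y. 3 * d y - (if d y \<ge> 1 / 2 then 2 else 0))"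
  have \<delta>_simps: "\<delta> 0 y = y" "\<delta> (Suc n) y = 3 * \<delta> n y - (if \<delta> n y \<ge> 1 / 2 then 2 else 0)" for n y
    by (simp_all add: \<delta>_def)
  have digit: "(t n x \<ge> 1 / 2) = (x \<in> U n)" for n x
    using t[of n x] t(2,3)[of "Suc n" x] by (auto simp: c_def indicator_def split: if_splits)
  have \<delta>_t: "\<delta> n (t 0 x) = t n x" for n x
  proof (induction n)
    case (Suc n)
    show ?case using t(1)[of n x] digit[of n x] by (simp add: \<delta>_simps Suc c_def)
  qed (simp add: \<delta>_simps)
  have [measurable]: "\<delta> n \<in> borel_measurable borel" for n
  proof (induction n)
    case (Suc n)
    note [measurable] = Suc
    show ?case unfolding \<delta>_simps(2)[abs_def] by measurable
  next
    case 0
    have "\<delta> 0 = (\<lambda>y. y)" by (rule ext) (rule \<delta>_simps)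
    then show ?case by simp
  qed
  have [measurable]: "U n \<in> sets borel" for n unfolding U_def by (rule borel_open) simp
  have [measurable]: "c n \<in> borel_measurable borel" for n
    unfolding c_def[abs_def] by measurable
  have t_meas[measurable]: "t n \<in> borel_measurable borel" for n
    unfolding t_def[abs_def] by measurable
  \<comment> \<open>Index of the first centre whose ball of radius 1/(n + 1) contains the coded
    point. On reals that are not codes the value carries no meaning.\<close>
  define k where "k n y = (LEAST j. \<delta> (prod_encode (n, j)) y \<ge> 1 / 2)" for n y
  have [measurable]: "k n \<in> borel \<rightarrow>\<^sub>M count_space UNIV" for n unfolding k_def[abs_def] by measurable
  have qk[measurable]: "(\<lambda>y. q (k n y)) \<in> borel_measurable borel" for n
    by (rule measurable_compose[of "k n" _ "count_space UNIV"]) auto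
  have conv: "(\<lambda>n. q (k n (t 0 x))) \<longlonglongrightarrow> x" for x
  proof (rule metric_LIMSEQ_I)
    fix e :: real assume "e > 0"
    then obtain n0 :: nat where n0: "1 / real (Suc n0) < e" by (rule nat_approx_posE)
    have "dist (q (k n (t 0 x))) x < e" if "n \<ge> n0" for n
    proof -
      have "\<exists>d\<in>D. d \<in> ball x (1 / real (Suc n))" by (rule D(2)) auto
      then obtain j where "q j \<in> ball x (1 / real (Suc n))" using range_q by blast
      then have "\<delta> (prod_encode (n, j)) (t 0 x) \<ge> 1 / 2"
        unfolding \<delta>_t digit U_def by (simp add: dist_commute)
      then have "\<delta> (prod_encode (n, k n (t 0 x))) (t 0 x) \<ge> 1 / 2"
        unfolding k_def by (rule LeastI)
      then have "dist (q (k n (t 0 x))) x < 1 / real (Suc n)"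
        unfolding \<delta>_t digit U_def by simp
      also have "\<dots> \<le> 1 / real (Suc n0)" using that by (simp add: frac_le)
      finally show ?thesis using n0 by simp
    qed
    then show "\<exists>n0. \<forall>n\<ge>n0. dist (q (k n (t 0 x))) x < e" by blast
  qed
  \<comment> \<open>For a real that is not a code the centres need not converge. The constant
    sequence \<open>q 0\<close> stands in there, so that a limit exists everywhere and is
    measurable.\<close>
  define h where "h n y = (if Cauchy (\<lambda>n. q (k n y)) then q (k n y) else q 0)" for n y
  have [measurable]: "h n \<in> borel_measurable borel" for n unfolding h_def[abs_def]
  proof (rule measurable_If)
    show "{y \<in> space borel. Cauchy (\<lambda>n. q (k n y))} \<in> sets borel"
      by (rule sets_Collect_Cauchy) (rule qk)
  qed (rule qk, simp)
  have lim_h: "(\<lambda>n. h n y) \<longlonglongrightarrow> lim (\<lambda>n. h n y)" for y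
  proof (cases "Cauchy (\<lambda>n. q (k n y))")
    case True
    then have "(\<lambda>n. q (k n y)) \<longlonglongrightarrow> lim (\<lambda>n. q (k n y))"
      using Cauchy_convergent convergent_LIMSEQ_iff by blast
    then show ?thesis by (simp only: h_def True if_True)
  next
    case False
    then show ?thesis by (simp only: h_def if_False lim_const tendsto_const)
  qed
  have lim_meas: "(\<lambda>y. lim (\<lambda>n. h n y)) \<in> borel_measurable borel"
    by (rule borel_measurable_LIMSEQ_metric[of h]) (simp_all only: lim_h, measurable)
  have "lim (\<lambda>n. h n (t 0 x)) = x" for x
  proof -
    have "Cauchy (\<lambda>n. q (k n (t 0 x)))" using conv[of x] by (rule LIMSEQ_imp_Cauchy)
    then show ?thesis using limI[OF conv[of x]] by (simp only: h_def if_True)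
  qed
  then show ?thesis using t(2,3)[of 0] t_meas[of 0] lim_meas by blast
qed

lemma borel_iso_real_retract:
  fixes B :: "'p::polish_space set"
  assumes iso: "borel_iso MA B" and a0: "a0 \<in> space MA"
  obtains f :: "'a \<Rightarrow> real" and g where "f \<in> borel_measurable MA" "g \<in> borel \<rightarrow>\<^sub>M MA"
    "\<And>a. a \<in> space MA \<Longrightarrow> 0 \<le> f a \<and> f a \<le> 1 \<and> g (f a) = a"
proof -
  obtain u v where u: "u \<in> measurable MA (restrict_space borel B)"
    and v[measurable]: "v \<in> measurable (restrict_space borel B) MA"
    and vu: "\<And>x. x \<in> space MA \<Longrightarrow> v (u x) = x" and [measurable]: "B \<in> sets borel"
    using iso unfolding borel_iso_def by blast
  have u': "u \<in> borel_measurable MA" "\<And>x. x \<in> space MA \<Longrightarrow> u x \<in> B"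
    using u unfolding measurable_restrict_space2_iff by blast+
  note [measurable] = u'(1)
  obtain f :: "'p \<Rightarrow> real" and g where [measurable]: "f \<in> borel_measurable borel" "g \<in> borel_measurable borel"
    and fg: "\<And>x. 0 \<le> f x \<and> f x \<le> 1 \<and> g (f x) = x"
    using polish_real_retract by blast
  \<comment> \<open>\<open>v\<close> is controlled only on \<open>B\<close>; the point
    \<open>a0\<close> fills the complement, so that the decoder is measurable on all reals.\<close>
  have "(\<lambda>x. if x \<in> B then v x else a0) \<in> borel \<rightarrow>\<^sub>M MA"
    using v a0 by (subst measurable_restrict_space_iff[symmetric]) auto
  then have "(\<lambda>y. if g y \<in> B then v (g y) else a0) \<in> borel \<rightarrow>\<^sub>M MA"
    by (rule measurable_compose[rotated]) measurable
  moreover have "(\<lambda>a. f (u a)) \<in> borel_measurable MA" by measurable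
  ultimately show ?thesis using that[of "\<lambda>a. f (u a)" "\<lambda>y. if g y \<in> B then v (g y) else a0"]
    by (simp add: fg u'(2) vu)
qed

text \<open>\<open>R A\<close> is a version of the conditional probability of the action set
  \<open>A\<close> given the state, obtained by Radon-Nikodym for each \<open>A\<close> separately.
  The exceptional null sets depend on \<open>A\<close>, so this is not yet a kernel.\<close>

lemma conditional_density_exists:
  fixes \<mu> :: "('x \<times> 'a) measure"
  assumes "finite_measure \<mu>" and sets: "sets \<mu> = sets (MX \<Otimes>\<^sub>M MA)"
  defines "lam \<equiv> distr \<mu> MX fst"
  obtains R :: "'a set \<Rightarrow> 'x \<Rightarrow> ennreal" where
    "\<And>A. A \<in> sets MA \<Longrightarrow> R A \<in> borel_measurable MX"
    "\<And>A B. A \<in> sets MA \<Longrightarrow> B \<in> sets MX \<Longrightarrow> (\<integral>\<^sup>+x. R A x * indicator B x \<partial>lam) = emeasure \<mu> (B \<times> A)"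
    "\<And>A A'. A \<in> sets MA \<Longrightarrow> A' \<in> sets MA \<Longrightarrow> A \<subseteq> A' \<Longrightarrow> AE x in lam. R A x \<le> R A' x"
    "\<And>A. A \<in> sets MA \<Longrightarrow> AE x in lam. R A x \<le> 1"
proof -
  interpret \<mu>: finite_measure \<mu> by fact
  note [measurable_cong] = sets
  have space_\<mu>: "space \<mu> = space MX \<times> space MA" using sets_eq_imp_space_eq[OF sets] by (simp add: space_pair_measure)
  have fst_m[measurable]: "fst \<in> \<mu> \<rightarrow>\<^sub>M MX" by measurable
  interpret lam: finite_measure lam unfolding lam_def by (rule \<mu>.finite_measure_distr) measurable
  have sets_lam[measurable_cong]: "sets lam = sets MX" by (simp add: lam_def)
  define N where "N A = distr (density \<mu> (indicator (space MX \<times> A))) MX fst" for A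
  have sets_N: "sets (N A) = sets MX" for A by (simp add: N_def)
  have N: "emeasure (N A) B = emeasure \<mu> (B \<times> A)" if [measurable]: "A \<in> sets MA" "B \<in> sets MX" for A B
  proof -
    have "emeasure (N A) B = emeasure (density \<mu> (indicator (space MX \<times> A))) (fst -` B \<inter> space \<mu>)"
      unfolding N_def by (subst emeasure_distr) auto
    also have "\<dots> = (\<integral>\<^sup>+w. indicator (space MX \<times> A) w * indicator (fst -` B \<inter> space \<mu>) w \<partial>\<mu>)"
      by (rule emeasure_density) measurable
    also have "\<dots> = (\<integral>\<^sup>+w. indicator (B \<times> A) w \<partial>\<mu>)"
      using sets.sets_into_space[OF that(2)] by (intro nn_integral_cong) (auto simp: space_\<mu> split: split_indicator)
    also have "\<dots> = emeasure \<mu> (B \<times> A)" by (rule nn_integral_indicator) (simp add: sets)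
    finally show ?thesis .
  qed
  have lam: "emeasure lam B = emeasure \<mu> (B \<times> space MA)" if "B \<in> sets MX" for B
    unfolding lam_def using sets.sets_into_space[OF that] that
    by (subst emeasure_distr) (auto simp: space_\<mu> intro!: arg_cong[of _ _ "emeasure \<mu>"])
  have ac: "absolutely_continuous lam (N A)" if A: "A \<in> sets MA" for A
    unfolding absolutely_continuous_def
  proof
    fix B assume "B \<in> null_sets lam"
    then have B: "B \<in> sets MX" "emeasure \<mu> (B \<times> space MA) = 0" using lam sets_lam by (auto simp: null_sets_def)
    have "emeasure \<mu> (B \<times> A) \<le> emeasure \<mu> (B \<times> space MA)"
      using sets.sets_into_space[OF A] B by (intro emeasure_mono) (auto simp: sets)
    then show "B \<in> null_sets (N A)" using B A by (auto simp: null_sets_def N sets_N)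
  qed
  define R where "R A = RN_deriv lam (N A)" for A
  have R_meas[measurable]: "R A \<in> borel_measurable MX" for A
    unfolding R_def by (subst measurable_cong_sets[OF sets_lam[symmetric] refl]) simp
  have dens: "density lam (R A) = N A" if "A \<in> sets MA" for A
    unfolding R_def by (rule lam.density_RN_deriv[OF ac[OF that]]) (simp add: sets_N sets_lam)
  have int: "(\<integral>\<^sup>+x. R A x * indicator B x \<partial>lam) = emeasure \<mu> (B \<times> A)" if "A \<in> sets MA" "B \<in> sets MX" for A B
    using N[OF that] unfolding dens[OF that(1), symmetric] using that
    by (subst (asm) emeasure_density) auto
  have mono: "AE x in lam. R A x \<le> R A' x" if A: "A \<in> sets MA" "A' \<in> sets MA" "A \<subseteq> A'" for A A'
  proof -
    \<comment> \<open>By uniqueness of densities, \<open>R A + R (A' - A)\<close> is a version of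
      \<open>R A'\<close>; hence monotonicity almost everywhere.\<close>
    have "density lam (\<lambda>x. R A x + R (A' - A) x) = N A'"
    proof (rule measure_eqI)
      fix B assume "B \<in> sets (density lam (\<lambda>x. R A x + R (A' - A) x))"
      then have B: "B \<in> sets MX" by (simp add: sets_lam)
      have "emeasure (density lam (\<lambda>x. R A x + R (A' - A) x)) B
        = (\<integral>\<^sup>+x. R A x * indicator B x + R (A' - A) x * indicator B x \<partial>lam)"
        using B by (subst emeasure_density) (auto simp: distrib_right)
      also have "\<dots> = emeasure \<mu> (B \<times> A) + emeasure \<mu> (B \<times> (A' - A))"
        using A B by (subst nn_integral_add) (auto simp: int)
      also have "\<dots> = emeasure \<mu> (B \<times> A \<union> B \<times> (A' - A))"
        using A B by (intro plus_emeasure) (auto simp: sets)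
      also have "B \<times> A \<union> B \<times> (A' - A) = B \<times> A'" using A(3) by auto
      finally show "emeasure (density lam (\<lambda>x. R A x + R (A' - A) x)) B = emeasure (N A') B"
        using A B by (simp add: N)
    qed (simp add: sets_lam sets_N)
    then have "AE x in lam. R A x + R (A' - A) x = R A' x"
      unfolding R_def[of A'] by (intro lam.RN_deriv_unique) auto
    then show ?thesis by eventually_elim (metis le_iff_add)
  qed
  have "AE x in lam. R (space MA) x = 1"
  proof -
    have "density lam (\<lambda>_. 1) = N (space MA)"
      by (rule measure_eqI) (auto simp: sets_lam sets_N density_1 N lam)
    then have "AE x in lam. 1 = R (space MA) x" unfolding R_def by (intro lam.RN_deriv_unique) auto
    then show ?thesis by eventually_elim simp
  qed
  then have "AE x in lam. R A x \<le> 1" if "A \<in> sets MA" for A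
    using mono[OF that sets.top sets.sets_into_space[OF that]] by eventually_elim simp
  then show ?thesis using R_meas int mono by (intro that[of R]) auto
qed

text \<open>Two uniqueness arguments: half-lines generate the Borel sets of the second coordinate
  for fixed \<open>B\<close>, and rectangles generate the product.\<close>

lemma measure_eqI_rectangle_lessThan:
  fixes M N :: "('x \<times> real) measure"
  assumes "finite_measure M" "finite_measure N" and sM: "sets M = sets (MX \<Otimes>\<^sub>M borel)" and sN: "sets N = sets (MX \<Otimes>\<^sub>M borel)"
    and eq: "\<And>B c. B \<in> sets MX \<Longrightarrow> emeasure M (B \<times> {..<c}) = emeasure N (B \<times> {..<c})"
  shows "M = N"
proof -
  interpret M: finite_measure M by fact
  interpret N: finite_measure N by fact
  have rect: "emeasure M (B \<times> C) = emeasure N (B \<times> C)" if B[measurable]: "B \<in> sets MX" and C: "C \<in> sets borel" for B C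
  proof -
    \<comment> \<open>Second marginal of \<open>K\<close> restricted to
      \<open>B \<times> UNIV\<close>; for fixed \<open>B\<close> this turns the hypothesis into one
      about measures on the line.\<close>
    define S where "S K = distr (density K (indicator (B \<times> UNIV))) borel snd" for K :: "('x \<times> real) measure"
    have S: "emeasure (S K) D = emeasure K (B \<times> D)" if sK[measurable_cong]: "sets K = sets (MX \<Otimes>\<^sub>M borel)"
      and D[measurable]: "D \<in> sets borel" for K D
    proof -
      have sp: "space K = space MX \<times> UNIV" using sets_eq_imp_space_eq[OF sK] by (simp add: space_pair_measure)
      have "emeasure (S K) D = emeasure (density K (indicator (B \<times> UNIV))) (snd -` D \<inter> space K)"
        unfolding S_def by (subst emeasure_distr) auto
      also have "\<dots> = (\<integral>\<^sup>+w. indicator (B \<times> UNIV) w * indicator (snd -` D \<inter> space K) w \<partial>K)"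
        by (rule emeasure_density) measurable
      also have "\<dots> = (\<integral>\<^sup>+w. indicator (B \<times> D) w \<partial>K)"
        using sets.sets_into_space[OF B] by (intro nn_integral_cong) (auto simp: sp split: split_indicator)
      also have "\<dots> = emeasure K (B \<times> D)" by (rule nn_integral_indicator) (simp add: sK)
      finally show ?thesis .
    qed
    have "S M = S N"
    proof (rule measure_eqI_generator_eq[where E="range lessThan" and \<Omega>=UNIV and A="\<lambda>i. {..<real i}"])
      show "Int_stable (range (lessThan :: real \<Rightarrow> _))"
      proof (rule Int_stableI_image)
        fix a b :: real
        show "\<exists>c\<in>UNIV. {..<a} \<inter> {..<b} = {..<c}" by (intro bexI[of _ "min a b"]) auto
      qed
      show "sets (S M) = sigma_sets UNIV (range lessThan)" "sets (S N) = sigma_sets UNIV (range lessThan)"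
        unfolding S_def by (simp_all add: borel_Iio)
      show "emeasure (S M) X = emeasure (S N) X" if "X \<in> range lessThan" for X
        using that eq[OF B] by (auto simp: S sM sN)
      show "(\<Union>i. {..<real i}) = UNIV" using reals_Archimedean2 by auto
      show "emeasure (S M) {..<real i} \<noteq> \<infinity>" for i by (simp add: S sM)
    qed auto
    then show ?thesis using S[OF sM C] S[OF sN C] by simp
  qed
  show ?thesis
  proof (rule measure_eqI_generator_eq[where E="{a \<times> b |a b. a \<in> sets MX \<and> b \<in> sets (borel :: real measure)}"
        and \<Omega>="space MX \<times> UNIV" and A="\<lambda>_. space MX \<times> UNIV"])
    show "Int_stable {a \<times> b |a b. a \<in> sets MX \<and> b \<in> sets (borel :: real measure)}"
      by (rule Int_stable_pair_measure_generator)
    show "sets M = sigma_sets (space MX \<times> UNIV) {a \<times> b |a b. a \<in> sets MX \<and> b \<in> sets borel}"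
      "sets N = sigma_sets (space MX \<times> UNIV) {a \<times> b |a b. a \<in> sets MX \<and> b \<in> sets borel}"
      by (simp_all add: sM sN sets_pair_measure)
    show "{a \<times> b |a b. a \<in> sets MX \<and> b \<in> sets (borel :: real measure)} \<subseteq> Pow (space MX \<times> UNIV)"
      using sets.sets_into_space by blast
    show "range (\<lambda>_. space MX \<times> UNIV) \<subseteq> {a \<times> b |a b. a \<in> sets MX \<and> b \<in> sets (borel :: real measure)}"
      by (simp add: image_subset_iff) (metis sets.top space_borel)
  qed (auto simp: rect)
qed


lemma emeasure_uniform_ennreal_le:
  assumes "s \<le> (1::ennreal)"
  shows "emeasure (restrict_space lborel {0<..1::real}) {u \<in> {0<..1}. ennreal u \<le> s} = s"
proof -
  have fin: "s \<noteq> top" using assms by (auto simp: top_unique)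
  have le1: "enn2real s \<le> 1" using assms by (simp add: enn2real_leI)
  have eq: "{u \<in> {0<..1}. ennreal u \<le> s} = {0<..enn2real s}"
  proof -
    have "ennreal u \<le> s \<longleftrightarrow> u \<le> enn2real s" if "u > 0" for u
      using fin that by (metis ennreal_enn2real enn2real_nonneg ennreal_le_iff less_top)
    then show ?thesis using le1 by auto
  qed
  have "emeasure (restrict_space lborel {0<..1::real}) {0<..enn2real s} = emeasure lborel {0<..enn2real s}"
    using le1 by (intro emeasure_restrict_space) auto
  then show ?thesis unfolding eq using fin by (simp add: less_top)
qed

text \<open>The kernel is the image of the uniform distribution under the conditional quantile function \<open>Y\<close>.
  Taking an infimum over rationals makes \<open>Y\<close> a quantile function even where the Radon--Nikodym
  densities fail to be monotone; monotonicity is only needed almost everywhere.\<close>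

lemma disintegration:
  fixes \<mu> :: "('x \<times> 'a) measure" and f :: "'a \<Rightarrow> real"
  assumes fin: "finite_measure \<mu>" and sets: "sets \<mu> = sets (MX \<Otimes>\<^sub>M MA)"
    and f[measurable]: "f \<in> borel_measurable MA" and g[measurable]: "g \<in> borel \<rightarrow>\<^sub>M MA"
    and fg: "\<And>a. a \<in> space MA \<Longrightarrow> 0 \<le> f a \<and> f a \<le> 1 \<and> g (f a) = a"
  obtains \<sigma> where "\<sigma> \<in> MX \<rightarrow>\<^sub>M prob_algebra MA"
    "\<And>F. F \<in> borel_measurable (MX \<Otimes>\<^sub>M MA) \<Longrightarrow>
       (\<integral>\<^sup>+w. F w \<partial>\<mu>) = (\<integral>\<^sup>+x. \<integral>\<^sup>+a. F (x, a) \<partial>\<sigma> x \<partial>distr \<mu> MX fst)"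
proof -
  interpret \<mu>: finite_measure \<mu> by fact
  note [measurable_cong] = sets
  define lam where "lam = distr \<mu> MX fst"
  interpret lam: finite_measure lam unfolding lam_def by (rule \<mu>.finite_measure_distr) measurable
  have sets_lam[measurable_cong]: "sets lam = sets MX" and space_lam: "space lam = space MX" by (simp_all add: lam_def)
  obtain R where R[measurable]: "\<And>A. A \<in> sets MA \<Longrightarrow> R A \<in> borel_measurable MX"
    and R_int: "\<And>A B. A \<in> sets MA \<Longrightarrow> B \<in> sets MX \<Longrightarrow> (\<integral>\<^sup>+x. R A x * indicator B x \<partial>lam) = emeasure \<mu> (B \<times> A)"
    and R_mono: "\<And>A A'. A \<in> sets MA \<Longrightarrow> A' \<in> sets MA \<Longrightarrow> A \<subseteq> A' \<Longrightarrow> AE x in lam. R A x \<le> R A' x"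
    and R_le: "\<And>A. A \<in> sets MA \<Longrightarrow> AE x in lam. R A x \<le> 1"
    using conditional_density_exists[OF fin sets, folded lam_def] by blast
  define U where "U = restrict_space lborel {0<..1::real}"
  have sets_U: "sets U = sets (restrict_space borel {0<..1::real})" and space_U: "space U = {0<..1}"
    by (simp_all add: U_def space_restrict_space sets_restrict_space)
  have id_U[measurable]: "(\<lambda>u. u) \<in> borel_measurable U"
    by (subst measurable_cong_sets[OF sets_U refl]) (simp add: measurable_restrict_space1)
  interpret U: prob_space U
    by (rule prob_spaceI) (simp add: U_def space_restrict_space emeasure_restrict_space)
  define D where "D c = {a \<in> space MA. f a \<le> c}" for c
  define D' where "D' c = {a \<in> space MA. f a < c}" for c
  have D[measurable]: "D c \<in> sets MA" "D' c \<in> sets MA" for c unfolding D_def D'_def by measurable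
  define I where "I = {q::rat. 0 \<le> q \<and> q \<le> 1}"
  have I: "countable I" "I \<noteq> {}" by (auto simp: I_def intro!: exI[of _ 0])
  \<comment> \<open>Generalized inverse of the conditional distribution function of
    \<open>f\<close>. The fallback 1 is the upper bound of \<open>f\<close>, so the family stays in
    [0, 1] even if no \<open>q\<close> qualifies.\<close>
  define Y where "Y x u = (INF q\<in>I. if ennreal u \<le> R (D (of_rat q)) x then real_of_rat q else 1)" for x u
  have bdd: "bdd_below ((\<lambda>q. if ennreal u \<le> R (D (of_rat q)) x then real_of_rat q else 1) ` I)" for x u
    by (rule bdd_belowI[of _ 0]) (auto simp: I_def)
  have Ym: "(\<lambda>(x, u). Y x u) \<in> borel_measurable (MX \<Otimes>\<^sub>M U)"
    unfolding Y_def split_beta' by (rule borel_measurable_cINF[OF I(1)]) (measurable, rule bdd)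
  note [measurable] = Ym
  \<comment> \<open>A strict upper bound passes through the infimum as an existential, so
    \<open>Y x u < c\<close> becomes a countable condition on the densities.\<close>
  have Y_less: "Y x u < c \<longleftrightarrow> (\<exists>q\<in>I. real_of_rat q < c \<and> ennreal u \<le> R (D (of_rat q)) x) \<or> 1 < c" for x u c
  proof -
    have "Y x u < c \<longleftrightarrow> (\<exists>q\<in>I. (if ennreal u \<le> R (D (of_rat q)) x then real_of_rat q else 1) < c)"
      unfolding Y_def by (rule cINF_less_iff[OF I(2) bdd])
    also have "\<dots> \<longleftrightarrow> (\<exists>q\<in>I. real_of_rat q < c \<and> ennreal u \<le> R (D (of_rat q)) x) \<or> 1 < c"
    proof
      assume "\<exists>q\<in>I. (if ennreal u \<le> R (D (of_rat q)) x then real_of_rat q else 1) < c"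
      then show "(\<exists>q\<in>I. real_of_rat q < c \<and> ennreal u \<le> R (D (of_rat q)) x) \<or> 1 < c"
        by (metis (full_types))
    next
      assume "(\<exists>q\<in>I. real_of_rat q < c \<and> ennreal u \<le> R (D (of_rat q)) x) \<or> 1 < c"
      then show "\<exists>q\<in>I. (if ennreal u \<le> R (D (of_rat q)) x then real_of_rat q else 1) < c"
      proof
        assume "1 < c"
        have "1 \<in> I" by (simp add: I_def)
        then show ?thesis using \<open>1 < c\<close> by (intro bexI[of _ 1]) auto
      qed auto
    qed
    finally show ?thesis .
  qed
  \<comment> \<open>Conditional probability that the quantile lies below \<open>c\<close>. It has to
    integrate to the mass of \<open>B \<times> D' c\<close>; \<open>upper\<close> and
    \<open>lower\<close> squeeze it between \<open>R (D q)\<close> for \<open>q < c\<close> and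
    \<open>R (D' c)\<close>.\<close>
  define W where "W c x = emeasure U {u \<in> {0<..1}. Y x u < c}" for c x
  have W_set: "{u \<in> {0<..1}. Y x u < c} \<in> sets U" if [measurable]: "x \<in> space MX" for x c
  proof -
    have "{u \<in> space U. Y x u < c} \<in> sets U" by measurable
    then show ?thesis by (simp add: space_U)
  qed
  have le_set: "{u \<in> {0<..1}. ennreal u \<le> s} \<in> sets U" for s
  proof -
    have "{u \<in> space U. ennreal u \<le> s} \<in> sets U" by measurable
    then show ?thesis by (simp add: space_U)
  qed
  have upper: "AE x in lam. W c x \<le> R (D' c) x" if c: "c \<le> 1" for c
  proof -
    have "AE x in lam. \<forall>q\<in>{q\<in>I. real_of_rat q < c}. R (D (of_rat q)) x \<le> R (D' c) x"
      using I(1) by (subst AE_ball_countable) (auto intro!: R_mono D simp: D_def D'_def)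
    moreover note R_le[OF D(2), of c]
    moreover have "AE x in lam. x \<in> space MX" using space_lam by auto
    ultimately show ?thesis
    proof eventually_elim
      case (elim x)
      have "W c x \<le> emeasure U {u \<in> {0<..1}. ennreal u \<le> R (D' c) x}" unfolding W_def
      proof (rule emeasure_mono[OF _ le_set], safe)
        fix u assume "Y x u < c"
        then have "\<exists>q\<in>I. real_of_rat q < c \<and> ennreal u \<le> R (D (of_rat q)) x"
          unfolding Y_less using c by linarith
        then obtain q where q: "q \<in> I" "real_of_rat q < c" "ennreal u \<le> R (D (of_rat q)) x" by blast
        then have "R (D (of_rat q)) x \<le> R (D' c) x" using elim(1) by blast
        with q(3) show "ennreal u \<le> R (D' c) x" by (rule order_trans)
      qed
      also have "\<dots> = R (D' c) x" unfolding U_def by (rule emeasure_uniform_ennreal_le[OF elim(2)])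
      finally show ?case .
    qed
  qed
  have lower: "AE x in lam. R (D (of_rat q)) x \<le> W c x" if "q \<in> I" "real_of_rat q < c" for c q
  proof -
    have "AE x in lam. x \<in> space MX" using space_lam by auto
    with R_le[OF D(1), of "of_rat q"] show ?thesis
    proof eventually_elim
      case (elim x)
      have "R (D (of_rat q)) x = emeasure U {u \<in> {0<..1}. ennreal u \<le> R (D (of_rat q)) x}"
        unfolding U_def by (rule emeasure_uniform_ennreal_le[OF elim(1), symmetric])
      also have "\<dots> \<le> W c x" unfolding W_def
        by (rule emeasure_mono[OF _ W_set[OF elim(2)]]) (use that Y_less in blast)
      finally show ?case .
    qed
  qed
  have W_meas[measurable]: "W c \<in> borel_measurable MX" for c
  proof -
    have "Measurable.pred (MX \<Otimes>\<^sub>M U) (\<lambda>(x, u). Y x u < c)" by measurable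
    then have "{w \<in> space (MX \<Otimes>\<^sub>M U). Y (fst w) (snd w) < c} \<in> sets (MX \<Otimes>\<^sub>M U)"
      by (simp add: pred_def split_beta')
    then have "(\<lambda>x. emeasure U (Pair x -` {w \<in> space (MX \<Otimes>\<^sub>M U). Y (fst w) (snd w) < c})) \<in> borel_measurable MX"
      by (rule U.measurable_emeasure_Pair)
    then show ?thesis unfolding W_def[abs_def]
      by (rule measurable_cong[THEN iffD1, rotated])
        (auto simp: space_pair_measure space_U intro!: arg_cong[of _ _ "emeasure U"])
  qed
  have W_int: "(\<integral>\<^sup>+x. W c x * indicator B x \<partial>lam) = emeasure \<mu> (B \<times> D' c)" if B[measurable]: "B \<in> sets MX" for B c
  proof -
    consider "1 < c" | "c \<le> 0" | "0 < c" "c \<le> 1" by linarith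
    then show ?thesis
    proof cases
      case 1
      then have "W c x = 1" for x using U.emeasure_space_1 by (simp add: W_def Y_less space_U greaterThanAtMost_def Int_def)
      moreover have "D' c = space MA" using fg 1 by (force simp: D'_def)
      ultimately show ?thesis using sets.sets_into_space[OF B] B sets_eq_imp_space_eq[OF sets]
        by (auto simp: lam_def emeasure_distr space_pair_measure intro!: arg_cong[of _ _ "emeasure \<mu>"])
    next
      case 2
      have "\<not> Y x u < c" for x u
      proof
        assume "Y x u < c"
        then obtain q where "q \<in> I" "real_of_rat q < c" using 2 unfolding Y_less by auto
        moreover have "0 \<le> real_of_rat q" using \<open>q \<in> I\<close> by (simp add: I_def)
        ultimately show False using 2 by linarith
      qed
      then have "W c x = 0" for x by (simp add: W_def)
      moreover have "D' c = {}" using fg 2 by (force simp: D'_def)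
      ultimately show ?thesis by simp
    next
      case 3
      show ?thesis
      proof (rule antisym)
        have "(\<integral>\<^sup>+x. W c x * indicator B x \<partial>lam) \<le> (\<integral>\<^sup>+x. R (D' c) x * indicator B x \<partial>lam)"
          by (rule nn_integral_mono_AE) (use upper[OF 3(2)] in \<open>eventually_elim, auto intro: mult_right_mono\<close>)
        then show "(\<integral>\<^sup>+x. W c x * indicator B x \<partial>lam) \<le> emeasure \<mu> (B \<times> D' c)" by (simp add: R_int)
      next
        \<comment> \<open>These sets increase to \<open>B \<times> D' c\<close>. A rational strictly
          between \<open>c - 1/(n+1)\<close> and \<open>c\<close> links each of them to
          \<open>lower\<close>; the maximum with 0 keeps that rational in \<open>I\<close>.\<close>
        define C where "C n = B \<times> D (c - 1 / real (Suc n))" for n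
        have "emeasure \<mu> (C n) \<le> (\<integral>\<^sup>+x. W c x * indicator B x \<partial>lam)" for n
        proof -
          obtain q where q: "max 0 (c - 1 / real (Suc n)) < real_of_rat q" "real_of_rat q < c"
            using of_rat_dense[of "max 0 (c - 1 / real (Suc n))" c] 3 by auto
          then have "real_of_rat 0 < real_of_rat q" "real_of_rat q < real_of_rat 1"
            using 3 unfolding of_rat_0 of_rat_1 by linarith+
          then have qI: "q \<in> I" unfolding of_rat_less by (simp add: I_def)
          have "emeasure \<mu> (C n) \<le> emeasure \<mu> (B \<times> D (of_rat q))"
            using q B by (intro emeasure_mono) (auto simp: C_def D_def sets)
          also have "\<dots> = (\<integral>\<^sup>+x. R (D (of_rat q)) x * indicator B x \<partial>lam)" by (simp add: R_int)
          also have "\<dots> \<le> (\<integral>\<^sup>+x. W c x * indicator B x \<partial>lam)"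
            by (rule nn_integral_mono_AE) (use lower[OF qI q(2)] in \<open>eventually_elim, auto intro: mult_right_mono\<close>)
          finally show ?thesis .
        qed
        then have "(SUP n. emeasure \<mu> (C n)) \<le> (\<integral>\<^sup>+x. W c x * indicator B x \<partial>lam)" by (rule SUP_least)
        also have "(SUP n. emeasure \<mu> (C n)) = emeasure \<mu> (\<Union>n. C n)"
        proof (rule SUP_emeasure_incseq)
          show "range C \<subseteq> sets \<mu>" by (auto simp: C_def sets)
          have "1 / real (Suc n) \<le> 1 / real (Suc m)" if "m \<le> n" for m n using that by (simp add: frac_le)
          then have "D (c - 1 / real (Suc m)) \<subseteq> D (c - 1 / real (Suc n))" if "m \<le> n" for m n
            using that unfolding D_def by (force intro: order_trans)
          then show "incseq C" unfolding C_def incseq_def by blast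
        qed
        also have "(\<Union>n. C n) = B \<times> D' c"
        proof -
          have "(\<Union>n. D (c - 1 / real (Suc n))) = D' c"
          proof safe
            fix a n assume "a \<in> D (c - 1 / real (Suc n))"
            then have a: "a \<in> space MA" "f a \<le> c - 1 / real (Suc n)" by (simp_all add: D_def)
            have "0 < 1 / real (Suc n)" by simp
            with a(2) have "f a < c" by linarith
            with a(1) show "a \<in> D' c" by (simp add: D'_def)
          next
            fix a assume a: "a \<in> D' c"
            then have "0 < c - f a" by (simp add: D'_def)
            then obtain n where "1 / real (Suc n) < c - f a" by (rule nat_approx_posE)
            then have "f a \<le> c - 1 / real (Suc n)" by linarith
            then have "a \<in> D (c - 1 / real (Suc n))" using a by (simp add: D_def D'_def)
            then show "a \<in> (\<Union>n. D (c - 1 / real (Suc n)))" by blast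
          qed
          then show ?thesis unfolding C_def by blast
        qed
        finally show "emeasure \<mu> (B \<times> D' c) \<le> (\<integral>\<^sup>+x. W c x * indicator B x \<partial>lam)" .
      qed
    qed
  qed
  note [measurable_cong] = sets_lam
  \<comment> \<open>Both \<open>M1\<close> and \<open>M2\<close> are laws of a state with a real
    code: once the code of the original action, once the simulated quantile.\<close>
  define M1 where "M1 = distr \<mu> (MX \<Otimes>\<^sub>M borel) (\<lambda>w. (fst w, f (snd w)))"
  define M2 where "M2 = distr (lam \<Otimes>\<^sub>M U) (MX \<Otimes>\<^sub>M borel) (\<lambda>w. (fst w, Y (fst w) (snd w)))"
  have YM[measurable]: "(\<lambda>w. Y (fst w) (snd w)) \<in> borel_measurable (MX \<Otimes>\<^sub>M U)"
    using Ym by (simp add: split_beta')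
  have "M1 = M2"
  proof (rule measure_eqI_rectangle_lessThan)
    show "finite_measure M1" unfolding M1_def by (rule \<mu>.finite_measure_distr) measurable
    have "finite_measure (lam \<Otimes>\<^sub>M U)"
      by (rule finite_measure_pair_measure) unfold_locales
    then show "finite_measure M2" unfolding M2_def by (rule finite_measure.finite_measure_distr) measurable
    show "sets M1 = sets (MX \<Otimes>\<^sub>M borel)" "sets M2 = sets (MX \<Otimes>\<^sub>M borel)" by (simp_all add: M1_def M2_def)
    fix B c assume B[measurable]: "B \<in> sets MX"
    have "emeasure M1 (B \<times> {..<c}) = emeasure \<mu> (B \<times> D' c)"
      unfolding M1_def using sets.sets_into_space[OF B] sets_eq_imp_space_eq[OF sets]
      by (subst emeasure_distr) (auto simp: D'_def space_pair_measure intro!: arg_cong[of _ _ "emeasure \<mu>"])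
    moreover have "emeasure M2 (B \<times> {..<c}) = (\<integral>\<^sup>+w. indicator (B \<times> {..<c}) w \<partial>M2)"
      by (rule nn_integral_indicator[symmetric]) (simp add: M2_def)
    moreover have "\<dots> = (\<integral>\<^sup>+w. indicator (B \<times> {..<c}) (fst w, Y (fst w) (snd w)) \<partial>(lam \<Otimes>\<^sub>M U))"
      unfolding M2_def by (rule nn_integral_distr) measurable
    moreover have "\<dots> = (\<integral>\<^sup>+x. \<integral>\<^sup>+u. indicator (B \<times> {..<c}) (x, Y x u) \<partial>U \<partial>lam)"
      by (subst U.nn_integral_fst[symmetric]) (simp_all, measurable)
    moreover have "\<dots> = (\<integral>\<^sup>+x. W c x * indicator B x \<partial>lam)"
    proof (rule nn_integral_cong)
      fix x assume "x \<in> space lam"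
      then have x[measurable]: "x \<in> space MX" by (simp add: space_lam)
      have "(\<integral>\<^sup>+u. indicator (B \<times> {..<c}) (x, Y x u) \<partial>U) = (\<integral>\<^sup>+u. indicator B x * indicator {u \<in> {0<..1}. Y x u < c} u \<partial>U)"
        by (intro nn_integral_cong) (auto simp: space_U split: split_indicator)
      also have "\<dots> = W c x * indicator B x" unfolding W_def
        using W_set[OF x, of c] by (subst nn_integral_cmult) (auto simp: mult.commute)
      finally show "(\<integral>\<^sup>+u. indicator (B \<times> {..<c}) (x, Y x u) \<partial>U) = W c x * indicator B x" .
    qed
    ultimately show "emeasure M1 (B \<times> {..<c}) = emeasure M2 (B \<times> {..<c})" by (simp only: W_int[OF B])
  qed
  \<comment> \<open>\<open>g\<close> is measurable on all reals, so quantiles that happen not to be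
    codes do no harm.\<close>
  define \<sigma> where "\<sigma> x = distr U MA (\<lambda>u. g (Y x u))" for x
  have \<sigma>: "\<sigma> \<in> MX \<rightarrow>\<^sub>M prob_algebra MA" unfolding \<sigma>_def[abs_def]
    by (rule measurable_distr_prob_space2[where M=U])
      (auto simp: space_prob_algebra U.prob_space_axioms intro!: measurable_const)
  show ?thesis
  proof (rule that[OF \<sigma>])
    fix F :: "'x \<times> 'a \<Rightarrow> ennreal" assume F[measurable]: "F \<in> borel_measurable (MX \<Otimes>\<^sub>M MA)"
    have "(\<integral>\<^sup>+w. F w \<partial>\<mu>) = (\<integral>\<^sup>+w. F (fst w, g (f (snd w))) \<partial>\<mu>)"
      using fg sets_eq_imp_space_eq[OF sets] by (intro nn_integral_cong) (auto simp: space_pair_measure)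
    also have "\<dots> = (\<integral>\<^sup>+w. F (fst w, g (snd w)) \<partial>M1)"
      unfolding M1_def by (subst nn_integral_distr) (simp_all, measurable)
    also have "\<dots> = (\<integral>\<^sup>+w. F (fst w, g (Y (fst w) (snd w))) \<partial>(lam \<Otimes>\<^sub>M U))"
      unfolding \<open>M1 = M2\<close> M2_def by (subst nn_integral_distr) (simp_all, measurable)
    also have "\<dots> = (\<integral>\<^sup>+x. \<integral>\<^sup>+u. F (x, g (Y x u)) \<partial>U \<partial>lam)"
      by (subst U.nn_integral_fst[symmetric]) (simp_all, measurable)
    also have "\<dots> = (\<integral>\<^sup>+x. \<integral>\<^sup>+a. F (x, a) \<partial>\<sigma> x \<partial>lam)"
    proof (rule nn_integral_cong)
      fix x assume "x \<in> space lam"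
      then have x[measurable]: "x \<in> space MX" by (simp add: space_lam)
      show "(\<integral>\<^sup>+u. F (x, g (Y x u)) \<partial>U) = (\<integral>\<^sup>+a. F (x, a) \<partial>\<sigma> x)"
        unfolding \<sigma>_def by (rule nn_integral_distr[symmetric]) measurable
    qed
    finally show "(\<integral>\<^sup>+w. F w \<partial>\<mu>) = (\<integral>\<^sup>+x. \<integral>\<^sup>+a. F (x, a) \<partial>\<sigma> x \<partial>distr \<mu> MX fst)" by (simp add: lam_def)
  qed
qed

section \<open>The controlled process\<close>

lemma ennreal_suminf_swap: "(\<Sum>i. \<Sum>j. f i j :: ennreal) = (\<Sum>j. \<Sum>i. f i j)"
proof -
  have "(\<Sum>i. \<Sum>j. f i j) = (\<integral>\<^sup>+i. (\<Sum>j. f i j) \<partial>count_space UNIV)"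
    by (simp add: nn_integral_count_space_nat)
  also have "\<dots> = (\<Sum>j. \<integral>\<^sup>+i. f i j \<partial>count_space UNIV)"
    by (rule nn_integral_suminf) auto
  finally show ?thesis by (simp add: nn_integral_count_space_nat)
qed

lemma prob_kernel_space:
  assumes "K \<in> M \<rightarrow>\<^sub>M prob_algebra N" "x \<in> space M"
  shows "prob_space (K x)" "sets (K x) = sets N" "space (K x) = space N"
  using measurable_space[OF assms] sets_eq_imp_space_eq[of "K x" N] by (auto simp: space_prob_algebra)

lemma ennreal_suminf_Suc: "(\<Sum>n. f n :: ennreal) = f 0 + (\<Sum>n. f (Suc n))"
  using suminf_offset[of f 1] by simp

lemma ennreal_suminf_finite_imp_tendsto_0:
  fixes f :: "nat \<Rightarrow> ennreal"
  assumes "(\<Sum>n. f n) \<noteq> top"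
  shows "f \<longlonglongrightarrow> 0"
proof -
  have fin: "f n \<noteq> top" for n
    using ennreal_suminf_lessD[of f top n] assms by (auto simp: less_top)
  then have eq: "f n = ennreal (enn2real (f n))" for n by (simp add: less_top)
  have "(\<Sum>n. ennreal (enn2real (f n))) \<noteq> top" using assms fin by (simp add: less_top)
  then have "summable (\<lambda>n. enn2real (f n))" by (intro summable_suminf_not_top) auto
  then have "(\<lambda>n. enn2real (f n)) \<longlonglongrightarrow> 0" by (rule summable_LIMSEQ_zero)
  then have "(\<lambda>n. ennreal (enn2real (f n))) \<longlonglongrightarrow> ennreal 0" by (rule tendsto_ennrealI)
  then show ?thesis using eq by simp
qed

text \<open>A distribution function with values 0 and 1 at the rationals has a single jump. The jump
  is located at the mean, which depends measurably on the state when \<open>M\<close> runs through a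
  kernel.\<close>

lemma zero_one_kernel_is_dirac:
  fixes f :: "'a \<Rightarrow> real"
  assumes "prob_space M" and f[measurable]: "f \<in> borel_measurable M"
    and bd: "\<And>a. a \<in> space M \<Longrightarrow> 0 \<le> f a \<and> f a \<le> 1"
    and zo: "\<And>q::rat. measure M {a \<in> space M. f a \<le> of_rat q} \<in> {0, 1}"
  shows "AE a in M. f a = (\<integral>a. f a \<partial>M)"
proof -
  interpret prob_space M by fact
  define s where "s = (\<integral>a. f a \<partial>M)"
  have int: "integrable M f" using bd by (intro integrable_const_bound[where B=1]) auto
  have D: "{a \<in> space M. f a \<le> c} \<in> events" for c by measurable
  \<comment> \<open>A rational \<open>q\<close> below the mean cannot have distribution function 1,
    since \<open>f\<close> would then be at most \<open>q\<close> almost surely.\<close>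
  have below: "AE a in M. of_rat q < f a" if q: "of_rat q < s" for q
  proof (rule ccontr)
    assume n: "\<not> (AE a in M. of_rat q < f a)"
    have "measure M {a \<in> space M. f a \<le> of_rat q} \<noteq> 0"
    proof
      assume "measure M {a \<in> space M. f a \<le> of_rat q} = 0"
      then have "AE a in M. a \<notin> {a \<in> space M. f a \<le> of_rat q}" using D by (simp add: prob_eq_0)
      moreover have "AE a in M. a \<in> space M" by auto
      ultimately have "AE a in M. of_rat q < f a" by eventually_elim auto
      with n show False ..
    qed
    then have "measure M {a \<in> space M. f a \<le> of_rat q} = 1" using zo[of q] by auto
    then have "AE a in M. a \<in> {a \<in> space M. f a \<le> of_rat q}" using D by (simp add: prob_eq_1)
    then have "AE a in M. f a \<le> of_rat q" by eventually_elim simp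
    then have "s \<le> (\<integral>a. of_rat q \<partial>M)" unfolding s_def using int by (intro integral_mono_AE) auto
    then show False using q by (simp add: prob_space)
  qed
  have above: "AE a in M. f a \<le> of_rat q" if q: "s < of_rat q" for q
  proof (rule ccontr)
    assume n: "\<not> (AE a in M. f a \<le> of_rat q)"
    have "measure M {a \<in> space M. f a \<le> of_rat q} \<noteq> 1"
    proof
      assume "measure M {a \<in> space M. f a \<le> of_rat q} = 1"
      then have "AE a in M. a \<in> {a \<in> space M. f a \<le> of_rat q}" using D by (simp add: prob_eq_1)
      then have "AE a in M. f a \<le> of_rat q" by eventually_elim simp
      with n show False ..
    qed
    then have "measure M {a \<in> space M. f a \<le> of_rat q} = 0" using zo[of q] by auto
    then have "AE a in M. a \<notin> {a \<in> space M. f a \<le> of_rat q}" using D by (simp add: prob_eq_0)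
    moreover have "AE a in M. a \<in> space M" by auto
    ultimately have "AE a in M. of_rat q \<le> f a" by eventually_elim auto
    then have "(\<integral>a. of_rat q \<partial>M) \<le> s" unfolding s_def using int by (intro integral_mono_AE) auto
    then show False using q by (simp add: prob_space)
  qed
  have "AE a in M. \<forall>q::rat. (of_rat q < s \<longrightarrow> of_rat q < f a) \<and> (s < of_rat q \<longrightarrow> f a \<le> of_rat q)"
    unfolding AE_all_countable
  proof
    fix q :: rat
    show "AE a in M. (of_rat q < s \<longrightarrow> of_rat q < f a) \<and> (s < of_rat q \<longrightarrow> f a \<le> of_rat q)"
      using below[of q] above[of q] by (cases "of_rat q < s"; cases "s < of_rat q") auto
  qed
  then show ?thesis unfolding s_def[symmetric]
  proof eventually_elim
    case (elim a)
    show ?case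
    proof (rule antisym; rule ccontr)
      assume "\<not> f a \<le> s"
      then obtain q where "s < of_rat q" "of_rat q < f a" using of_rat_dense[of s "f a"] by auto
      then show False using elim by fastforce
    next
      assume "\<not> s \<le> f a"
      then obtain q where "f a < of_rat q" "of_rat q < s" using of_rat_dense[of "f a" s] by auto
      then show False using elim by fastforce
    qed
  qed
qed

locale controlled_process =
  fixes MX :: "'x measure" and MA :: "'a measure"
    and Q :: "'x \<times> 'a \<Rightarrow> 'x measure" and \<eta> :: "'x measure" and \<Delta> :: "'x set"
  assumes Q_measurable[measurable]: "Q \<in> MX \<Otimes>\<^sub>M MA \<rightarrow>\<^sub>M prob_algebra MX"
    and prob_\<eta>: "prob_space \<eta>" and sets_\<eta>[measurable_cong]: "sets \<eta> = sets MX"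
    and \<Delta>_sets[measurable]: "\<Delta> \<in> sets MX"
begin

abbreviation "Hn \<equiv> HS MX MA"
abbreviation "law \<equiv> hlaw MX MA Q \<eta>"
abbreviation "alaw \<equiv> halaw MX MA Q \<eta>"
abbreviation "occm \<equiv> occ MX MA Q \<eta> \<Delta>"

text \<open>Measurability is kept apart from admissibility: the laws of the process are computed for
  any such sequence, and the action sets enter at the end.\<close>

definition kernels :: "(nat \<Rightarrow> ('x,'a) hist \<Rightarrow> 'a measure) \<Rightarrow> bool" where
  "kernels \<pi> \<longleftrightarrow> (\<forall>n. \<pi> n \<in> Hn n \<rightarrow>\<^sub>M prob_algebra MA)"

lemma kernelsD[measurable_dest]: "kernels \<pi> \<Longrightarrow> \<pi> n \<in> Hn n \<rightarrow>\<^sub>M prob_algebra MA"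
  by (simp add: kernels_def)

section \<open>Laws of histories and integration against them\<close>

lemma snd_HS[measurable]: "snd \<in> Hn n \<rightarrow>\<^sub>M MX"
  by (simp add: HS_def)

lemma fst_HS[measurable]: "fst \<in> Hn n \<rightarrow>\<^sub>M (PiM {..<n} (\<lambda>_. MX \<Otimes>\<^sub>M MA))"
  by (simp add: HS_def)

lemma history_extend_measurable[measurable]:
  "(\<lambda>((h, a), y). ((fst h)(n := (snd h, a)), y)) \<in> (Hn n \<Otimes>\<^sub>M MA) \<Otimes>\<^sub>M MX \<rightarrow>\<^sub>M Hn (Suc n)"
proof -
  have "(\<lambda>w. (fst (fst (fst w)))(n := (snd (fst (fst w)), snd (fst w))))
     \<in> (Hn n \<Otimes>\<^sub>M MA) \<Otimes>\<^sub>M MX \<rightarrow>\<^sub>M PiM {..<Suc n} (\<lambda>_. MX \<Otimes>\<^sub>M MA)"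
    by (rule measurable_fun_upd[where J="{..<n}"]) (auto simp: lessThan_Suc)
  then show ?thesis unfolding HS_def[of _ _ "Suc n"] by (simp add: split_beta')
qed

lemma alive_sets[measurable]: "Measurable.pred (Hn n) (alive \<Delta> n)"
proof -
  have "Measurable.pred (Hn n) (\<lambda>h. \<forall>i\<in>{..<n}. fst (fst h i) \<notin> \<Delta>)"
  proof (rule pred_intros_finite(3))
    fix i assume "i \<in> {..<n}"
    then have [measurable]: "(\<lambda>h. fst h i) \<in> Hn n \<rightarrow>\<^sub>M MX \<Otimes>\<^sub>M MA"
      using measurable_compose[OF fst_HS measurable_component_singleton] by fastforce
    show "Measurable.pred (Hn n) (\<lambda>h. fst (fst h i) \<notin> \<Delta>)" by measurable
  qed simp
  then show ?thesis unfolding alive_def[abs_def] by (simp add: Ball_def)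
qed

lemma transition_kernel:
  assumes [measurable]: "kernels \<pi>"
  shows "(\<lambda>h. bind (\<pi> n h) (\<lambda>a. distr (Q (snd h, a)) (Hn (Suc n)) (\<lambda>y. ((fst h)(n := (snd h, a)), y))))
    \<in> Hn n \<rightarrow>\<^sub>M prob_algebra (Hn (Suc n))"
  using history_extend_measurable[of n]
  by (intro measurable_bind_prob_space2[where N=MA] measurable_distr_prob_space2[where M=MX])
     (auto simp: split_beta')

lemma law_prob: assumes [measurable]: "kernels \<pi>" shows "law \<pi> n \<in> space (prob_algebra (Hn n))"
proof (induction n)
  case 0
  interpret prob_space \<eta> by (rule prob_\<eta>)
  have "(\<lambda>x. (\<lambda>_. undefined, x)) \<in> \<eta> \<rightarrow>\<^sub>M Hn 0"
    unfolding HS_def by (intro measurable_Pair measurable_const) (auto simp: space_PiM sets_\<eta>)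
  then show ?case by (auto simp: space_prob_algebra intro!: prob_space_distr)
next
  case (Suc n)
  have "law \<pi> (Suc n) = (law \<pi> n) \<bind> (\<lambda>h. bind (\<pi> n h) (\<lambda>a. distr (Q (snd h, a)) (Hn (Suc n)) (\<lambda>y. ((fst h)(n := (snd h, a)), y))))"
    by simp
  also have "\<dots> \<in> space (prob_algebra (Hn (Suc n)))"
    using measurable_space[OF measurable_bind_prob_space[OF _ transition_kernel[OF assms, of n], of "\<lambda>_. law \<pi> n" "count_space UNIV"], of undefined] Suc
    by simp
  finally show ?case .
qed

lemma sets_law: "kernels \<pi> \<Longrightarrow> sets (law \<pi> n) = sets (Hn n)"
  using law_prob by (auto simp: space_prob_algebra)

lemma space_law: "kernels \<pi> \<Longrightarrow> space (law \<pi> n) = space (Hn n)"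
  using sets_law sets_eq_imp_space_eq by blast

lemma nn_integral_law_0:
  assumes [measurable]: "f \<in> borel_measurable (Hn 0)"
  shows "(\<integral>\<^sup>+h. f h \<partial>law \<pi> 0) = (\<integral>\<^sup>+x. f (\<lambda>_. undefined, x) \<partial>\<eta>)"
proof -
  have "(\<lambda>x. (\<lambda>_. undefined, x)) \<in> \<eta> \<rightarrow>\<^sub>M Hn 0"
    unfolding HS_def by (intro measurable_Pair measurable_const) (auto simp: space_PiM sets_\<eta>)
  then show ?thesis by (simp add: nn_integral_distr)
qed

lemma nn_integral_law_Suc:
  assumes [measurable]: "kernels \<pi>" and f[measurable]: "f \<in> borel_measurable (Hn (Suc n))"
  shows "(\<integral>\<^sup>+h. f h \<partial>law \<pi> (Suc n)) =
    (\<integral>\<^sup>+h. \<integral>\<^sup>+a. \<integral>\<^sup>+y. f ((fst h)(n := (snd h, a)), y) \<partial>Q (snd h, a) \<partial>\<pi> n h \<partial>law \<pi> n)"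
proof -
  have 1: "(\<lambda>h. bind (\<pi> n h) (\<lambda>a. distr (Q (snd h, a)) (Hn (Suc n)) (\<lambda>y. ((fst h)(n := (snd h, a)), y))))
    \<in> law \<pi> n \<rightarrow>\<^sub>M subprob_algebra (Hn (Suc n))"
    using measurable_prob_algebraD[OF transition_kernel[OF assms(1), of n]]
    by (subst measurable_cong_sets[OF sets_law refl]) (auto simp: assms)
  show ?thesis
    unfolding hlaw.simps nn_integral_bind[OF f 1]
  proof (rule nn_integral_cong)
    fix h assume "h \<in> space (law \<pi> n)"
    then have h[measurable]: "h \<in> space (Hn n)" by (simp add: space_law assms)
    note K = prob_kernel_space[OF kernelsD[OF assms(1)] h]
    have [measurable]: "snd h \<in> space MX" using h by (rule measurable_space[OF snd_HS])
    have ext: "(\<lambda>(a, y). ((fst h)(n := (snd h, a)), y)) \<in> MA \<Otimes>\<^sub>M MX \<rightarrow>\<^sub>M Hn (Suc n)"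
      using measurable_compose[OF _ history_extend_measurable[of n], of "\<lambda>w. ((h, fst w), snd w)"]
      by (simp add: split_beta')
    have 2: "(\<lambda>a. distr (Q (snd h, a)) (Hn (Suc n)) (\<lambda>y. ((fst h)(n := (snd h, a)), y)))
       \<in> \<pi> n h \<rightarrow>\<^sub>M subprob_algebra (Hn (Suc n))"
      by (subst measurable_cong_sets[OF K(2) refl], rule measurable_prob_algebraD,
          rule measurable_distr_prob_space2[where M=MX]) (use ext in auto)
    show "integral\<^sup>N (\<pi> n h \<bind> (\<lambda>a. distr (Q (snd h, a)) (Hn (Suc n)) (\<lambda>y. ((fst h)(n := (snd h, a)), y)))) f
       = (\<integral>\<^sup>+a. \<integral>\<^sup>+y. f ((fst h)(n := (snd h, a)), y) \<partial>Q (snd h, a) \<partial>\<pi> n h)"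
      unfolding nn_integral_bind[OF f 2]
    proof (rule nn_integral_cong)
      fix a assume "a \<in> space (\<pi> n h)"
      then have a: "a \<in> space MA" by (simp add: K)
      then have "(snd h, a) \<in> space (MX \<Otimes>\<^sub>M MA)" using \<open>snd h \<in> space MX\<close> by (simp add: space_pair_measure)
      note q = prob_kernel_space[OF Q_measurable this]
      have "(\<lambda>y. ((fst h)(n := (snd h, a)), y)) \<in> Q (snd h, a) \<rightarrow>\<^sub>M Hn (Suc n)"
        using measurable_compose[OF _ ext, of "\<lambda>y. (a,y)" MX] a
        by (subst measurable_cong_sets[OF q(2) refl]) auto
      then show "(\<integral>\<^sup>+h. f h \<partial>distr (Q (snd h, a)) (Hn (Suc n)) (\<lambda>y. ((fst h)(n := (snd h, a)), y)))
         = (\<integral>\<^sup>+y. f ((fst h)(n := (snd h, a)), y) \<partial>Q (snd h, a))"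
        by (rule nn_integral_distr) (simp add: f)
    qed
  qed
qed

lemma alaw_kernel:
  assumes [measurable]: "kernels \<pi>"
  shows "(\<lambda>h. distr (\<pi> n h) (Hn n \<Otimes>\<^sub>M MA) (\<lambda>a. (h, a))) \<in> Hn n \<rightarrow>\<^sub>M prob_algebra (Hn n \<Otimes>\<^sub>M MA)"
  by (rule measurable_distr_prob_space2[where M=MA]) auto

lemma alaw_prob: assumes "kernels \<pi>" shows "alaw \<pi> n \<in> space (prob_algebra (Hn n \<Otimes>\<^sub>M MA))"
  unfolding halaw_def
  using measurable_space[OF measurable_bind_prob_space[OF _ alaw_kernel[OF assms, of n], of "\<lambda>_. law \<pi> n" "count_space UNIV"], of undefined] law_prob[OF assms, of n]
  by simp

lemma sets_alaw: "kernels \<pi> \<Longrightarrow> sets (alaw \<pi> n) = sets (Hn n \<Otimes>\<^sub>M MA)"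
  using alaw_prob by (auto simp: space_prob_algebra)

lemma nn_integral_alaw:
  assumes [measurable]: "kernels \<pi>" and f[measurable]: "f \<in> borel_measurable (Hn n \<Otimes>\<^sub>M MA)"
  shows "(\<integral>\<^sup>+w. f w \<partial>alaw \<pi> n) = (\<integral>\<^sup>+h. \<integral>\<^sup>+a. f (h, a) \<partial>\<pi> n h \<partial>law \<pi> n)"
proof -
  have 1: "(\<lambda>h. distr (\<pi> n h) (Hn n \<Otimes>\<^sub>M MA) (\<lambda>a. (h, a))) \<in> law \<pi> n \<rightarrow>\<^sub>M subprob_algebra (Hn n \<Otimes>\<^sub>M MA)"
    using measurable_prob_algebraD[OF alaw_kernel[OF assms(1), of n]]
    by (subst measurable_cong_sets[OF sets_law refl]) (auto simp: assms)
  show ?thesis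
    unfolding halaw_def nn_integral_bind[OF f 1]
  proof (rule nn_integral_cong)
    fix h assume "h \<in> space (law \<pi> n)"
    then have h[measurable]: "h \<in> space (Hn n)" by (simp add: space_law assms)
    note K = prob_kernel_space[OF kernelsD[OF assms(1)] h]
    have "(\<lambda>a. (h, a)) \<in> \<pi> n h \<rightarrow>\<^sub>M Hn n \<Otimes>\<^sub>M MA"
      by (subst measurable_cong_sets[OF K(2) refl]) (use h in auto)
    then show "integral\<^sup>N (distr (\<pi> n h) (Hn n \<Otimes>\<^sub>M MA) (\<lambda>a. (h, a))) f = (\<integral>\<^sup>+a. f (h, a) \<partial>\<pi> n h)"
      by (rule nn_integral_distr) (simp add: f)
  qed
qed

subsection \<open>Alive laws and occupation measures\<close>

text \<open>\<open>st \<pi> t\<close> and \<open>so \<pi> t\<close> are the laws of \<open>X\<^sub>t\<close> and \<open>(X\<^sub>t, A\<^sub>t)\<close> restricted to the event \<open>T\<^sub>\<Delta> > t\<close>, hence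
  sub-probabilities.\<close>

definition st :: "(nat \<Rightarrow> ('x,'a) hist \<Rightarrow> 'a measure) \<Rightarrow> nat \<Rightarrow> 'x measure" where
  "st \<pi> t = distr (density (law \<pi> t) (indicator {h. alive \<Delta> t h})) MX snd"

definition so :: "(nat \<Rightarrow> ('x,'a) hist \<Rightarrow> 'a measure) \<Rightarrow> nat \<Rightarrow> ('x \<times> 'a) measure" where
  "so \<pi> t = distr (density (alaw \<pi> t) (\<lambda>w. indicator {h. alive \<Delta> t h} (fst w))) (MX \<Otimes>\<^sub>M MA)
     (\<lambda>w. (snd (fst w), snd w))"

text \<open>Transition operator, acting on functions, of the process killed on entering
  \<Delta>.\<close>

definition step :: "('x \<Rightarrow> ennreal) \<Rightarrow> 'x \<times> 'a \<Rightarrow> ennreal" where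
  "step f w = (\<integral>\<^sup>+y. indicator (- \<Delta>) y * f y \<partial>Q w)"

lemma sets_st[simp, measurable_cong]: "sets (st \<pi> t) = sets MX"
  and space_st[simp]: "space (st \<pi> t) = space MX"
  by (simp_all add: st_def)

lemma sets_so[simp, measurable_cong]: "sets (so \<pi> t) = sets (MX \<Otimes>\<^sub>M MA)"
  and space_so[simp]: "space (so \<pi> t) = space (MX \<Otimes>\<^sub>M MA)"
  by (simp_all add: so_def)

lemma alive_indicator[measurable]:
  "(indicator {h. alive \<Delta> n h} :: _ \<Rightarrow> ennreal) \<in> borel_measurable (Hn n)"
proof -
  have "{h \<in> space (Hn n). alive \<Delta> n h} \<in> sets (Hn n)" by measurable
  then have "(indicator {h \<in> space (Hn n). alive \<Delta> n h} :: _ \<Rightarrow> ennreal) \<in> borel_measurable (Hn n)" by simp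
  then show ?thesis by (rule measurable_cong[THEN iffD1, rotated]) (auto split: split_indicator)
qed

lemma step_measurable[measurable]:
  assumes [measurable]: "f \<in> borel_measurable MX"
  shows "step f \<in> borel_measurable (MX \<Otimes>\<^sub>M MA)"
proof -
  have [measurable]: "Q \<in> MX \<Otimes>\<^sub>M MA \<rightarrow>\<^sub>M subprob_algebra MX" by (rule measurable_prob_algebraD) measurable
  have [measurable]: "(indicator (- \<Delta>) :: _ \<Rightarrow> ennreal) \<in> borel_measurable MX"
    by (rule measurable_cong[THEN iffD1, of _ "indicator (space MX - \<Delta>)"]) (auto split: split_indicator)
  show ?thesis unfolding step_def[abs_def]
    by (rule nn_integral_measurable_subprob_algebra2[where N=MX]) auto
qed

lemma nn_integral_st:
  assumes [measurable]: "kernels \<pi>" "f \<in> borel_measurable MX"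
  shows "(\<integral>\<^sup>+x. f x \<partial>st \<pi> t) = (\<integral>\<^sup>+h. indicator {h. alive \<Delta> t h} h * f (snd h) \<partial>law \<pi> t)"
proof -
  note [measurable_cong] = sets_law[OF assms(1)]
  show ?thesis unfolding st_def by (simp add: nn_integral_distr nn_integral_density)
qed

lemma nn_integral_so_alaw:
  assumes [measurable]: "kernels \<pi>" "F \<in> borel_measurable (MX \<Otimes>\<^sub>M MA)"
  shows "(\<integral>\<^sup>+w. F w \<partial>so \<pi> t) = (\<integral>\<^sup>+w. indicator {h. alive \<Delta> t h} (fst w) * F (snd (fst w), snd w) \<partial>alaw \<pi> t)"
proof -
  note [measurable_cong] = sets_alaw[OF assms(1)]
  show ?thesis unfolding so_def by (simp add: nn_integral_distr nn_integral_density)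
qed

lemma nn_integral_so:
  assumes k[measurable]: "kernels \<pi>" and F[measurable]: "F \<in> borel_measurable (MX \<Otimes>\<^sub>M MA)"
  shows "(\<integral>\<^sup>+w. F w \<partial>so \<pi> t) =
    (\<integral>\<^sup>+h. indicator {h. alive \<Delta> t h} h * (\<integral>\<^sup>+a. F (snd h, a) \<partial>\<pi> t h) \<partial>law \<pi> t)"
  unfolding nn_integral_so_alaw[OF assms]
proof (subst nn_integral_alaw[OF k], measurable, rule nn_integral_cong, simp)
  fix h assume "h \<in> space (law \<pi> t)"
  then have h[measurable]: "h \<in> space (Hn t)" by (simp add: space_law assms)
  note [measurable_cong] = prob_kernel_space(2)[OF kernelsD[OF assms(1)] h]
  have [measurable]: "snd h \<in> space MX" using h by (rule measurable_space[OF snd_HS])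
  show "(\<integral>\<^sup>+ a. indicator {h. alive \<Delta> t h} h * F (snd h, a) \<partial>\<pi> t h) =
         indicator {h. alive \<Delta> t h} h * (\<integral>\<^sup>+ a. F (snd h, a) \<partial>\<pi> t h)"
    by (rule nn_integral_cmult) measurable
qed

lemma nn_integral_so_fst:
  assumes k[measurable]: "kernels \<pi>" and f[measurable]: "f \<in> borel_measurable MX"
  shows "(\<integral>\<^sup>+w. f (fst w) \<partial>so \<pi> t) = (\<integral>\<^sup>+x. f x \<partial>st \<pi> t)"
proof -
  have "(\<integral>\<^sup>+a. f (snd h) \<partial>\<pi> t h) = f (snd h)" if "h \<in> space (Hn t)" for h
    using prob_space.emeasure_space_1[OF prob_kernel_space(1)[OF kernelsD[OF k] that]] by simp
  then show ?thesis
    by (subst nn_integral_so, simp_all add: nn_integral_st assms)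
       (auto intro!: nn_integral_cong simp: space_law assms)
qed

lemma nn_integral_st_0:
  assumes k[measurable]: "kernels \<pi>" and f[measurable]: "f \<in> borel_measurable MX"
  shows "(\<integral>\<^sup>+x. f x \<partial>st \<pi> 0) = (\<integral>\<^sup>+x. indicator (- \<Delta>) x * f x \<partial>\<eta>)"
  unfolding nn_integral_st[OF assms]
  by (subst nn_integral_law_0) (auto simp: alive_def indicator_def)

text \<open>A history is alive at \<open>Suc t\<close> iff it is alive at \<open>t\<close> and the
  new state avoids \<Delta>, and \<open>Q\<close> sees only the last pair. So the next state law
  depends on the past only through \<open>so \<pi> t\<close>, however the policy uses the
  history.\<close>

lemma nn_integral_st_Suc:
  assumes k[measurable]: "kernels \<pi>" and f[measurable]: "f \<in> borel_measurable MX"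
  shows "(\<integral>\<^sup>+x. f x \<partial>st \<pi> (Suc t)) = (\<integral>\<^sup>+w. step f w \<partial>so \<pi> t)"
proof -
  have aliveS: "indicator {h. alive \<Delta> (Suc t) h} ((fst h)(t := (snd h, a)), y) =
      (indicator {h. alive \<Delta> t h} h * indicator (- \<Delta>) y :: ennreal)" for h a y
    by (auto simp: alive_def less_Suc_eq split: split_indicator)
  have [measurable]: "(indicator (- \<Delta>) :: _ \<Rightarrow> ennreal) \<in> borel_measurable MX"
    by (rule measurable_cong[THEN iffD1, of _ "indicator (space MX - \<Delta>)"]) (auto split: split_indicator)
  show ?thesis
    unfolding nn_integral_st[OF assms]
  proof (subst nn_integral_law_Suc[OF k], measurable, subst nn_integral_so[OF k], measurable,
      rule nn_integral_cong)
    fix h assume "h \<in> space (law \<pi> t)"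
    then have h[measurable]: "h \<in> space (Hn t)" by (simp add: space_law assms)
    note [measurable_cong] = prob_kernel_space(2)[OF kernelsD[OF assms(1)] h]
    note sp = prob_kernel_space(3)[OF kernelsD[OF assms(1)] h]
    have x[measurable]: "snd h \<in> space MX" using h by (rule measurable_space[OF snd_HS])
    have "(\<integral>\<^sup>+ a. \<integral>\<^sup>+ y. indicator {h. alive \<Delta> (Suc t) h} ((fst h)(t := (snd h, a)), y) *
                 f (snd ((fst h)(t := (snd h, a)), y)) \<partial>Q (snd h, a) \<partial>\<pi> t h)
      = (\<integral>\<^sup>+ a. indicator {h. alive \<Delta> t h} h * step f (snd h, a) \<partial>\<pi> t h)"
    proof (rule nn_integral_cong)
      fix a assume "a \<in> space (\<pi> t h)"
      then have "(snd h, a) \<in> space (MX \<Otimes>\<^sub>M MA)" using x sp by (simp add: space_pair_measure)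
      note [measurable_cong] = prob_kernel_space(2)[OF Q_measurable this]
      show "(\<integral>\<^sup>+ y. indicator {h. alive \<Delta> (Suc t) h} ((fst h)(t := (snd h, a)), y) *
                 f (snd ((fst h)(t := (snd h, a)), y)) \<partial>Q (snd h, a)) =
           indicator {h. alive \<Delta> t h} h * step f (snd h, a)"
        by (simp add: aliveS mult.assoc step_def nn_integral_cmult)
    qed
    also have "\<dots> = indicator {h. alive \<Delta> t h} h * (\<integral>\<^sup>+ a. step f (snd h, a) \<partial>\<pi> t h)"
      by (rule nn_integral_cmult) measurable
    finally show "(\<integral>\<^sup>+ a. \<integral>\<^sup>+ y. indicator {h. alive \<Delta> (Suc t) h} ((fst h)(t := (snd h, a)), y) *
                 f (snd ((fst h)(t := (snd h, a)), y)) \<partial>Q (snd h, a) \<partial>\<pi> t h)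
      = indicator {h. alive \<Delta> t h} h * (\<integral>\<^sup>+ a. step f (snd h, a) \<partial>\<pi> t h)" .
  qed
qed

lemma expT_eq:
  assumes k[measurable]: "kernels \<pi>"
  shows "expT MX MA Q \<eta> \<Delta> \<pi> = (\<Sum>t. emeasure (st \<pi> t) (space MX))"
proof -
  have "emeasure (law \<pi> t) {h \<in> space (Hn t). alive \<Delta> t h} = emeasure (st \<pi> t) (space MX)" for t
  proof -
    have "emeasure (st \<pi> t) (space MX) = (\<integral>\<^sup>+x. 1 \<partial>st \<pi> t)" by simp
    also have "\<dots> = (\<integral>\<^sup>+h. indicator {h \<in> space (Hn t). alive \<Delta> t h} h \<partial>law \<pi> t)"
      by (subst nn_integral_st) (auto simp: space_law k intro!: nn_integral_cong split: split_indicator)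
    also have "\<dots> = emeasure (law \<pi> t) {h \<in> space (Hn t). alive \<Delta> t h}"
      by (rule nn_integral_indicator) (simp add: sets_law[OF k])
    finally show ?thesis ..
  qed
  then show ?thesis by (simp add: expT_def)
qed

lemma sets_occ[simp, measurable_cong]: "sets (occm \<pi>) = sets (MX \<Otimes>\<^sub>M MA)"
  and space_occ[simp]: "space (occm \<pi>) = space (MX \<Otimes>\<^sub>M MA)"
  using sets.space_closed[of "MX \<Otimes>\<^sub>M MA"] by (auto simp: occ_def sets.sigma_sets_eq)

text \<open>\<open>occ\<close> is declared by \<open>measure_of\<close>, which has the prescribed
  values once these are known to be countably additive; that amounts to exchanging two sums of
  nonnegative terms.\<close>

lemma emeasure_occ:
  assumes k[measurable]: "kernels \<pi>" and \<Gamma>: "\<Gamma> \<in> sets (MX \<Otimes>\<^sub>M MA)"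
  shows "emeasure (occm \<pi>) \<Gamma> = (\<Sum>t. emeasure (so \<pi> t) \<Gamma>)"
proof -
  have eq: "emeasure (alaw \<pi> t) {(h,a) \<in> space (Hn t \<Otimes>\<^sub>M MA). alive \<Delta> t h \<and> (snd h, a) \<in> \<Gamma>}
     = emeasure (so \<pi> t) \<Gamma>" if [measurable]: "\<Gamma> \<in> sets (MX \<Otimes>\<^sub>M MA)" for t \<Gamma>
  proof -
    have "{w \<in> space (Hn t \<Otimes>\<^sub>M MA). alive \<Delta> t (fst w) \<and> (snd (fst w), snd w) \<in> \<Gamma>} \<in> sets (Hn t \<Otimes>\<^sub>M MA)"
      by measurable
    then have m: "{(h,a) \<in> space (Hn t \<Otimes>\<^sub>M MA). alive \<Delta> t h \<and> (snd h, a) \<in> \<Gamma>} \<in> sets (alaw \<pi> t)"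
      by (simp add: split_beta' sets_alaw[OF k])
    have "emeasure (so \<pi> t) \<Gamma> = (\<integral>\<^sup>+w. indicator \<Gamma> w \<partial>so \<pi> t)" by simp
    also have "\<dots> = (\<integral>\<^sup>+w. indicator {(h,a) \<in> space (Hn t \<Otimes>\<^sub>M MA). alive \<Delta> t h \<and> (snd h, a) \<in> \<Gamma>} w \<partial>alaw \<pi> t)"
      by (subst nn_integral_so_alaw[OF k])
        (auto simp: sets_eq_imp_space_eq[OF sets_alaw[OF k]] intro!: nn_integral_cong split: split_indicator)
    also have "\<dots> = emeasure (alaw \<pi> t) {(h,a) \<in> space (Hn t \<Otimes>\<^sub>M MA). alive \<Delta> t h \<and> (snd h, a) \<in> \<Gamma>}"
      by (rule nn_integral_indicator) (fact m)
    finally show ?thesis ..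
  qed
  have occ_eq: "occm \<pi> = measure_of (space (MX \<Otimes>\<^sub>M MA)) (sets (MX \<Otimes>\<^sub>M MA)) (\<lambda>\<Gamma>. \<Sum>t. emeasure (so \<pi> t) \<Gamma>)"
    unfolding occ_def
    by (rule measure_of_eq) (auto simp: eq sets.sigma_sets_eq sets.space_closed)
  show ?thesis
    unfolding occ_eq
  proof (rule emeasure_measure_of_sigma)
    show "sigma_algebra (space (MX \<Otimes>\<^sub>M MA)) (sets (MX \<Otimes>\<^sub>M MA))" ..
    show "positive (sets (MX \<Otimes>\<^sub>M MA)) (\<lambda>\<Gamma>. \<Sum>t. emeasure (so \<pi> t) \<Gamma>)" by (simp add: positive_def)
    show "countably_additive (sets (MX \<Otimes>\<^sub>M MA)) (\<lambda>\<Gamma>. \<Sum>t. emeasure (so \<pi> t) \<Gamma>)"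
    proof (rule countably_additiveI)
      fix A :: "nat \<Rightarrow> _" assume A: "range A \<subseteq> sets (MX \<Otimes>\<^sub>M MA)" "disjoint_family A"
      have "(\<Sum>i. \<Sum>t. emeasure (so \<pi> t) (A i)) = (\<Sum>t. \<Sum>i. emeasure (so \<pi> t) (A i))"
        by (rule ennreal_suminf_swap)
      also have "\<dots> = (\<Sum>t. emeasure (so \<pi> t) (\<Union> (range A)))"
        using A by (intro suminf_cong suminf_emeasure) auto
      finally show "(\<Sum>i. \<Sum>t. emeasure (so \<pi> t) (A i)) = (\<Sum>t. emeasure (so \<pi> t) (\<Union> (range A)))" .
    qed
  qed (fact \<Gamma>)
qed

lemma nn_integral_occ:
  assumes k[measurable]: "kernels \<pi>" and F: "F \<in> borel_measurable (MX \<Otimes>\<^sub>M MA)"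
  shows "(\<integral>\<^sup>+w. F w \<partial>occm \<pi>) = (\<Sum>t. \<integral>\<^sup>+w. F w \<partial>so \<pi> t)"
  using F
proof induct
  case (cong f g)
  then show ?case using nn_integral_cong[of "occm \<pi>" f g] nn_integral_cong[of "so \<pi> _" f g]
    by (simp add: space_so)
next
  case (set A)
  then show ?case by (simp add: emeasure_occ k)
next
  case (mult u c)
  then show ?case by (simp add: nn_integral_cmult)
next
  case (add u v)
  then show ?case by (simp add: nn_integral_add suminf_add)
next
  case (seq U)
  have "(\<integral>\<^sup>+ x. (SUP i. U i) x \<partial>occm \<pi>) = (SUP i. \<integral>\<^sup>+ x. U i x \<partial>occm \<pi>)"
    unfolding SUP_apply using seq by (intro nn_integral_monotone_convergence_SUP) auto
  also have "\<dots> = (SUP i. \<Sum>t. \<integral>\<^sup>+ x. U i x \<partial>so \<pi> t)" using seq by simp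
  also have "\<dots> = (SUP i. \<integral>\<^sup>+t. (\<integral>\<^sup>+ x. U i x \<partial>so \<pi> t) \<partial>count_space UNIV)"
    by (simp add: nn_integral_count_space_nat)
  also have "\<dots> = (\<integral>\<^sup>+t. (SUP i. \<integral>\<^sup>+ x. U i x \<partial>so \<pi> t) \<partial>count_space UNIV)"
    using seq by (intro nn_integral_monotone_convergence_SUP[symmetric])
      (auto simp: incseq_def le_fun_def intro!: nn_integral_mono)
  also have "\<dots> = (\<integral>\<^sup>+t. (\<integral>\<^sup>+ x. (SUP i. U i) x \<partial>so \<pi> t) \<partial>count_space UNIV)"
    unfolding SUP_apply using seq by (intro nn_integral_cong nn_integral_monotone_convergence_SUP[symmetric]) auto
  finally show ?case by (simp add: nn_integral_count_space_nat)
qed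

text \<open>Lets the atomlessness hypothesis on \<open>Q\<close>, which concerns states outside
  \<Delta>, be applied almost everywhere.\<close>

lemma AE_so_alive:
  assumes k[measurable]: "kernels \<pi>"
  shows "AE w in so \<pi> t. fst w \<notin> \<Delta>"
proof -
  have "emeasure (so \<pi> t) {w \<in> space (MX \<Otimes>\<^sub>M MA). fst w \<in> \<Delta>} = (\<integral>\<^sup>+w. indicator {w \<in> space (MX \<Otimes>\<^sub>M MA). fst w \<in> \<Delta>} w \<partial>so \<pi> t)"
    by simp
  also have "\<dots> = (\<integral>\<^sup>+w. 0 \<partial>alaw \<pi> t)"
    by (subst nn_integral_so_alaw[OF k]) (auto simp: alive_def simp flip: nn_integral_0_iff_AE intro!: nn_integral_zero' AE_I2 split: split_indicator)
  finally show ?thesis by (intro AE_I[of _ _ "{w \<in> space (MX \<Otimes>\<^sub>M MA). fst w \<in> \<Delta>}"]) auto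
qed

text \<open>Causality; it transfers the state law at time \<open>t\<close> to policies altered from
  \<open>t\<close> on.\<close>

lemma law_cong:
  assumes "\<And>s. s < t \<Longrightarrow> \<pi> s = \<pi>' s"
  shows "law \<pi> t = law \<pi>' t"
  using assms by (induction t) auto

lemma st_cong: "(\<And>s. s < t \<Longrightarrow> \<pi> s = \<pi>' s) \<Longrightarrow> st \<pi> t = st \<pi>' t"
  unfolding st_def by (simp add: law_cong[of t \<pi> \<pi>'])

subsection \<open>Markov policies and graphs\<close>

abbreviation "stat \<equiv> MX \<rightarrow>\<^sub>M prob_algebra MA"

definition Kint :: "('x \<Rightarrow> 'a measure) \<Rightarrow> ('x \<times> 'a \<Rightarrow> ennreal) \<Rightarrow> 'x \<Rightarrow> ennreal" where
  "Kint \<sigma> F x = (\<integral>\<^sup>+a. F (x, a) \<partial>\<sigma> x)"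

lemma Kint_measurable[measurable]:
  assumes "\<sigma> \<in> stat" and [measurable]: "F \<in> borel_measurable (MX \<Otimes>\<^sub>M MA)"
  shows "Kint \<sigma> F \<in> borel_measurable MX"
  unfolding Kint_def[abs_def] using measurable_prob_algebraD[OF assms(1)]
  by (intro nn_integral_measurable_subprob_algebra2[where N=MA]) auto

lemma kernels_markov:
  assumes "\<And>t. \<sigma> t \<in> stat"
  shows "kernels (\<lambda>t h. \<sigma> t (snd h))"
  unfolding kernels_def using measurable_compose[OF snd_HS assms] by blast

lemma nn_integral_so_markov:
  assumes k: "kernels \<pi>" and \<pi>: "\<pi> t = (\<lambda>h. \<sigma> (snd h))" and \<sigma>[measurable]: "\<sigma> \<in> stat"
    and F[measurable]: "F \<in> borel_measurable (MX \<Otimes>\<^sub>M MA)"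
  shows "(\<integral>\<^sup>+w. F w \<partial>so \<pi> t) = (\<integral>\<^sup>+x. Kint \<sigma> F x \<partial>st \<pi> t)"
  by (subst nn_integral_st[OF k Kint_measurable[OF \<sigma> F]]) (simp add: nn_integral_so[OF k F] \<pi> Kint_def)

text \<open>Transition operator of the stationary chain killed on entering \<Delta>; the killing
  makes it substochastic.\<close>

abbreviation "P \<sigma> f \<equiv> Kint \<sigma> (step f)"

lemma P_funpow_measurable[measurable]:
  assumes "\<sigma> \<in> stat" "f \<in> borel_measurable MX"
  shows "((P \<sigma>) ^^ k) f \<in> borel_measurable MX"
  using assms by (induction k) auto

text \<open>The kernel is prescribed from time \<open>n\<close> on, so the formula serves
  stationary, switched and perturbed policies alike. Powers of \<open>P \<sigma>\<close> act on the
  test function; hence the induction varies \<open>f\<close> and peels off the last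
  transition.\<close>

lemma nn_integral_st_iterate:
  assumes k: "kernels \<pi>" and \<pi>: "\<And>s. s \<ge> n \<Longrightarrow> \<pi> s = (\<lambda>h. \<sigma> (snd h))" and \<sigma>[measurable]: "\<sigma> \<in> stat"
    and "f \<in> borel_measurable MX"
  shows "(\<integral>\<^sup>+x. f x \<partial>st \<pi> (n + k)) = (\<integral>\<^sup>+x. ((P \<sigma>) ^^ k) f x \<partial>st \<pi> n)"
  using assms(4)
proof (induction k arbitrary: f)
  case (Suc k)
  have "(\<integral>\<^sup>+x. f x \<partial>st \<pi> (n + Suc k)) = (\<integral>\<^sup>+x. P \<sigma> f x \<partial>st \<pi> (n + k))"
    using Suc.prems \<pi>[of "n + k"] by (simp add: nn_integral_st_Suc k nn_integral_so_markov[where \<sigma>=\<sigma>])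
  also have "\<dots> = (\<integral>\<^sup>+x. ((P \<sigma>) ^^ k) (P \<sigma> f) x \<partial>st \<pi> n)" using Suc by simp
  finally show ?case by (simp add: funpow_Suc_right del: funpow.simps)
qed simp

lemma AE_so_of_AE_occ:
  assumes k: "kernels \<pi>" and "AE w in occm \<pi>. R w"
  shows "AE w in so \<pi> t. R w"
proof -
  obtain N where N: "{w \<in> space (occm \<pi>). \<not> R w} \<subseteq> N" "emeasure (occm \<pi>) N = 0" "N \<in> sets (occm \<pi>)"
    using AE_E[OF assms(2)] by blast
  then have "(\<Sum>t. emeasure (so \<pi> t) N) = 0" using emeasure_occ[OF k, of N] by simp
  then have "emeasure (so \<pi> t) N = 0" by (subst (asm) suminf_eq_zero_iff) auto
  then show ?thesis using N by (intro AE_I[of _ _ N]) auto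
qed

lemma return_stat: "\<phi> \<in> MX \<rightarrow>\<^sub>M MA \<Longrightarrow> (\<lambda>x. return MA (\<phi> x)) \<in> stat"
  by measurable

lemma kernels_det: "\<phi> \<in> MX \<rightarrow>\<^sub>M MA \<Longrightarrow> kernels (det_policy MA \<phi>)"
  unfolding det_policy_def by (rule kernels_markov) (rule return_stat)

lemma nn_integral_so_graph:
  assumes k: "kernels \<pi>" and \<phi>[measurable]: "\<phi> \<in> MX \<rightarrow>\<^sub>M MA" and ae: "AE w in so \<pi> t. snd w = \<phi> (fst w)"
    and F[measurable]: "F \<in> borel_measurable (MX \<Otimes>\<^sub>M MA)"
  shows "(\<integral>\<^sup>+w. F w \<partial>so \<pi> t) = (\<integral>\<^sup>+x. F (x, \<phi> x) \<partial>st \<pi> t)"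
proof -
  have "(\<integral>\<^sup>+w. F w \<partial>so \<pi> t) = (\<integral>\<^sup>+w. F (fst w, \<phi> (fst w)) \<partial>so \<pi> t)"
    using ae by (intro nn_integral_cong_AE) (auto elim!: eventually_mono simp: prod_eq_iff)
  also have "\<dots> = (\<integral>\<^sup>+x. F (x, \<phi> x) \<partial>st \<pi> t)"
    by (rule nn_integral_so_fst[OF k]) measurable
  finally show ?thesis .
qed

lemma nn_integral_so_det:
  assumes \<phi>[measurable]: "\<phi> \<in> MX \<rightarrow>\<^sub>M MA" and F[measurable]: "F \<in> borel_measurable (MX \<Otimes>\<^sub>M MA)"
  shows "(\<integral>\<^sup>+w. F w \<partial>so (det_policy MA \<phi>) t) = (\<integral>\<^sup>+x. F (x, \<phi> x) \<partial>st (det_policy MA \<phi>) t)"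
proof -
  have "(\<integral>\<^sup>+w. F w \<partial>so (det_policy MA \<phi>) t) = (\<integral>\<^sup>+x. Kint (\<lambda>x. return MA (\<phi> x)) F x \<partial>st (det_policy MA \<phi>) t)"
    by (rule nn_integral_so_markov[OF kernels_det]) (auto simp: det_policy_def)
  also have "\<dots> = (\<integral>\<^sup>+x. F (x, \<phi> x) \<partial>st (det_policy MA \<phi>) t)"
    unfolding Kint_def using measurable_space[OF \<phi>]
    by (intro nn_integral_cong nn_integral_return) auto
  finally show ?thesis .
qed

text \<open>On surviving histories the actions of \<open>\<pi>\<close> are almost surely
  \<phi>(X_t), even if \<open>\<pi>\<close> is randomized elsewhere. Both sequences of state laws
  thus obey the same recursion with the same start.\<close>

lemma occ_graph_eq_det:
  assumes k: "kernels \<pi>" and \<phi>[measurable]: "\<phi> \<in> MX \<rightarrow>\<^sub>M MA"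
    and ae: "AE w in occm \<pi>. snd w = \<phi> (fst w)"
  shows "occm \<pi> = occm (det_policy MA \<phi>)"
proof -
  note so = nn_integral_so_graph[OF k \<phi> AE_so_of_AE_occ[OF k ae]]
  have st: "(\<integral>\<^sup>+x. f x \<partial>st \<pi> t) = (\<integral>\<^sup>+x. f x \<partial>st (det_policy MA \<phi>) t)" if "f \<in> borel_measurable MX" for f t
    using that
  proof (induction t arbitrary: f)
    case 0
    then show ?case by (simp add: nn_integral_st_0 k kernels_det)
  next
    case (Suc t)
    then have [measurable]: "f \<in> borel_measurable MX" by simp
    show ?case by (simp add: nn_integral_st_Suc k kernels_det so nn_integral_so_det Suc.IH)
  qed
  show ?thesis
  proof (rule measure_eqI)
    fix \<Gamma> assume "\<Gamma> \<in> sets (occm \<pi>)"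
    then have [measurable]: "\<Gamma> \<in> sets (MX \<Otimes>\<^sub>M MA)" by simp
    have "(\<integral>\<^sup>+w. indicator \<Gamma> w \<partial>occm \<pi>) = (\<integral>\<^sup>+w. indicator \<Gamma> w \<partial>occm (det_policy MA \<phi>))"
      by (simp add: nn_integral_occ k kernels_det so nn_integral_so_det st del: nn_integral_indicator)
    then show "emeasure (occm \<pi>) \<Gamma> = emeasure (occm (det_policy MA \<phi>)) \<Gamma>" by simp
  qed simp
qed

lemma emeasure_occ_det_off_graph:
  assumes \<phi>[measurable]: "\<phi> \<in> MX \<rightarrow>\<^sub>M MA" and [measurable]: "{w \<in> space (MX \<Otimes>\<^sub>M MA). snd w \<noteq> \<phi> (fst w)} \<in> sets (MX \<Otimes>\<^sub>M MA)"
  shows "emeasure (occm (det_policy MA \<phi>)) {w \<in> space (MX \<Otimes>\<^sub>M MA). snd w \<noteq> \<phi> (fst w)} = 0"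
proof -
  let ?N = "{w \<in> space (MX \<Otimes>\<^sub>M MA). snd w \<noteq> \<phi> (fst w)}"
  have "emeasure (so (det_policy MA \<phi>) t) ?N = 0" for t
  proof -
    have "emeasure (so (det_policy MA \<phi>) t) ?N = (\<integral>\<^sup>+w. indicator ?N w \<partial>so (det_policy MA \<phi>) t)" by simp
    also have "\<dots> = 0" by (subst nn_integral_so_det) auto
    finally show ?thesis .
  qed
  then show ?thesis by (simp add: emeasure_occ kernels_det)
qed

text \<open>A convex component is dominated by a multiple of the whole measure, and domination
  already forces it to be null off the graph.\<close>

lemma occ_component_of_det:
  assumes \<phi>[measurable]: "\<phi> \<in> MX \<rightarrow>\<^sub>M MA" and N: "{w \<in> space (MX \<Otimes>\<^sub>M MA). snd w \<noteq> \<phi> (fst w)} \<in> sets (MX \<Otimes>\<^sub>M MA)"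
    and k: "kernels \<pi>"
    and l: "0 < l" "\<And>\<Gamma>. \<Gamma> \<in> sets (MX \<Otimes>\<^sub>M MA) \<Longrightarrow> ennreal l * emeasure (occm \<pi>) \<Gamma> \<le> emeasure (occm (det_policy MA \<phi>)) \<Gamma>"
  shows "occm \<pi> = occm (det_policy MA \<phi>)"
proof (rule occ_graph_eq_det[OF k \<phi>])
  have "ennreal l * emeasure (occm \<pi>) {w \<in> space (MX \<Otimes>\<^sub>M MA). snd w \<noteq> \<phi> (fst w)} = 0"
    using l(2)[OF N] emeasure_occ_det_off_graph[OF \<phi> N] by simp
  then have "emeasure (occm \<pi>) {w \<in> space (MX \<Otimes>\<^sub>M MA). snd w \<noteq> \<phi> (fst w)} = 0" using l(1) by simp
  then show "AE w in occm \<pi>. snd w = \<phi> (fst w)"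
    by (intro AE_I[OF _ _, of _ _ "{w \<in> space (MX \<Otimes>\<^sub>M MA). snd w \<noteq> \<phi> (fst w)}"]) (use N in auto)
qed

subsection \<open>Reduction to stationary policies\<close>

lemma Kint_le_1:
  assumes "\<sigma> \<in> stat" "x \<in> space MX" "\<And>a. a \<in> space MA \<Longrightarrow> F (x, a) \<le> 1"
  shows "Kint \<sigma> F x \<le> 1"
proof -
  note s = prob_kernel_space[OF assms(1,2)]
  have "Kint \<sigma> F x \<le> (\<integral>\<^sup>+a. 1 \<partial>\<sigma> x)" unfolding Kint_def
    by (intro nn_integral_mono) (simp add: s assms)
  then show ?thesis using prob_space.emeasure_space_1[OF s(1)] by simp
qed

lemma step_le_1:
  assumes "w \<in> space (MX \<Otimes>\<^sub>M MA)" "\<And>x. x \<in> space MX \<Longrightarrow> f x \<le> 1"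
  shows "step f w \<le> 1"
proof -
  note s = prob_kernel_space[OF Q_measurable assms(1)]
  have "step f w \<le> (\<integral>\<^sup>+y. 1 \<partial>Q w)" unfolding step_def
    by (intro nn_integral_mono) (auto simp: s assms split: split_indicator)
  then show ?thesis using prob_space.emeasure_space_1[OF s(1)] by simp
qed

lemma P_funpow_le_1:
  assumes "\<sigma> \<in> stat" "\<And>x. x \<in> space MX \<Longrightarrow> f x \<le> 1" "x \<in> space MX"
  shows "((P \<sigma>) ^^ k) f x \<le> 1"
  using assms(3)
proof (induction k arbitrary: x)
  case (Suc k)
  show ?case unfolding funpow.simps comp_apply
    by (rule Kint_le_1[OF assms(1) Suc.prems], rule step_le_1) (use Suc in \<open>auto simp: space_pair_measure\<close>)
qed (simp add: assms)

definition switch :: "(nat \<Rightarrow> ('x,'a) hist \<Rightarrow> 'a measure) \<Rightarrow> nat \<Rightarrow> ('x \<Rightarrow> 'a measure) \<Rightarrow> nat \<Rightarrow> ('x,'a) hist \<Rightarrow> 'a measure" where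
  "switch \<pi> n \<sigma> = (\<lambda>t. if t < n then \<pi> t else (\<lambda>h. \<sigma> (snd h)))"

abbreviation stationary :: "('x \<Rightarrow> 'a measure) \<Rightarrow> nat \<Rightarrow> ('x,'a) hist \<Rightarrow> 'a measure" where
  "stationary \<sigma> \<equiv> (\<lambda>_ h. \<sigma> (snd h))"

lemma kernels_stationary: "\<sigma> \<in> stat \<Longrightarrow> kernels (stationary \<sigma>)"
  by (rule kernels_markov)

lemma kernels_switch: "kernels \<pi> \<Longrightarrow> \<sigma> \<in> stat \<Longrightarrow> kernels (switch \<pi> n \<sigma>)"
  using kernels_stationary[of \<sigma>] unfolding kernels_def switch_def by simp

text \<open>\<open>W\<close> is the expected remaining lifetime under \<open>\<sigma>\<close>; it is integrable against each \<open>st \<pi> n\<close> because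
  switching to \<open>\<sigma>\<close> at time \<open>n\<close> gives a policy with finite expected absorption time. Note that the
  expected lifetime need not be integrable against the marginal itself.\<close>

lemma occ_stationary_eq:
  assumes k[measurable]: "kernels \<pi>" and \<sigma>[measurable]: "\<sigma> \<in> stat"
    and fin: "(\<Sum>t. emeasure (st \<pi> t) (space MX)) < \<infinity>"
    and fin_switch: "\<And>n. (\<Sum>t. emeasure (st (switch \<pi> n \<sigma>) t) (space MX)) < \<infinity>"
    and disint: "\<And>F. F \<in> borel_measurable (MX \<Otimes>\<^sub>M MA) \<Longrightarrow>
       (\<integral>\<^sup>+w. F w \<partial>occm \<pi>) = (\<integral>\<^sup>+x. Kint \<sigma> F x \<partial>distr (occm \<pi>) MX fst)"
  shows "occm (stationary \<sigma>) = occm \<pi>"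
proof -
  define lam where "lam = distr (occm \<pi>) MX fst"
  note ks = kernels_stationary[OF \<sigma>]
  have sets_lam[measurable_cong]: "sets lam = sets MX" by (simp add: lam_def)
  have lam: "(\<integral>\<^sup>+x. f x \<partial>lam) = (\<Sum>t. \<integral>\<^sup>+x. f x \<partial>st \<pi> t)" if [measurable]: "f \<in> borel_measurable MX" for f
  proof -
    have "(\<integral>\<^sup>+x. f x \<partial>lam) = (\<integral>\<^sup>+w. f (fst w) \<partial>occm \<pi>)" unfolding lam_def by (rule nn_integral_distr) auto
    also have "\<dots> = (\<Sum>t. \<integral>\<^sup>+w. f (fst w) \<partial>so \<pi> t)" by (rule nn_integral_occ[OF k]) auto
    finally show ?thesis by (simp add: nn_integral_so_fst[OF k])
  qed
  \<comment> \<open>Balance equation: \<open>lam\<close> is the initial law plus what one transition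
    under \<open>\<sigma>\<close> makes of \<open>lam\<close>. The initial law is the same for every
    policy, so it may be written with the stationary one.\<close>
  have lam_step: "(\<integral>\<^sup>+x. f x \<partial>lam) = (\<integral>\<^sup>+x. f x \<partial>st (stationary \<sigma>) 0) + (\<integral>\<^sup>+x. P \<sigma> f x \<partial>lam)"
    if [measurable]: "f \<in> borel_measurable MX" for f
  proof -
    have "(\<integral>\<^sup>+x. f x \<partial>lam) = (\<integral>\<^sup>+x. f x \<partial>st \<pi> 0) + (\<Sum>t. \<integral>\<^sup>+w. step f w \<partial>so \<pi> t)"
      by (subst lam[OF that], subst ennreal_suminf_Suc) (simp add: nn_integral_st_Suc k)
    also have "(\<Sum>t. \<integral>\<^sup>+w. step f w \<partial>so \<pi> t) = (\<integral>\<^sup>+w. step f w \<partial>occm \<pi>)"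
      by (rule nn_integral_occ[OF k, symmetric]) auto
    also have "\<dots> = (\<integral>\<^sup>+x. P \<sigma> f x \<partial>lam)" unfolding lam_def by (rule disint) measurable
    finally show ?thesis by (simp add: nn_integral_st_0 k ks)
  qed
  have iter: "(\<integral>\<^sup>+x. f x \<partial>lam) = (\<Sum>j<n. \<integral>\<^sup>+x. f x \<partial>st (stationary \<sigma>) j) + (\<integral>\<^sup>+x. ((P \<sigma>) ^^ n) f x \<partial>lam)"
    if [measurable]: "f \<in> borel_measurable MX" for f n
  proof (induction n)
    case (Suc n)
    have "(\<integral>\<^sup>+x. f x \<partial>st (stationary \<sigma>) n) = (\<integral>\<^sup>+x. ((P \<sigma>) ^^ n) f x \<partial>st (stationary \<sigma>) 0)"
      using nn_integral_st_iterate[OF ks, of 0 \<sigma> f n] by simp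
    then show ?case using Suc lam_step[of "((P \<sigma>) ^^ n) f"] by (simp add: add.assoc)
  qed simp
  have vanish: "(\<lambda>n. \<integral>\<^sup>+x. ((P \<sigma>) ^^ n) (\<lambda>_. 1) x \<partial>lam) \<longlonglongrightarrow> 0"
  proof -
    define W where "W x = (\<Sum>n. ((P \<sigma>) ^^ n) (\<lambda>_. 1) x)" for x
    have W[measurable]: "W \<in> borel_measurable MX" unfolding W_def[abs_def] by measurable
    have "AE x in st \<pi> n. W x \<noteq> \<infinity>" for n
    proof (rule nn_integral_PInf_AE)
      have "(\<integral>\<^sup>+x. W x \<partial>st \<pi> n) = (\<integral>\<^sup>+x. W x \<partial>st (switch \<pi> n \<sigma>) n)"
        using st_cong[of n \<pi> "switch \<pi> n \<sigma>"] by (simp add: switch_def)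
      also have "\<dots> = (\<Sum>j. \<integral>\<^sup>+x. ((P \<sigma>) ^^ j) (\<lambda>_. 1) x \<partial>st (switch \<pi> n \<sigma>) n)"
        unfolding W_def by (rule nn_integral_suminf) measurable
      also have "\<dots> = (\<Sum>j. \<integral>\<^sup>+x. 1 \<partial>st (switch \<pi> n \<sigma>) (n + j))"
        by (intro suminf_cong nn_integral_st_iterate[symmetric] kernels_switch k \<sigma>) (auto simp: switch_def)
      also have "\<dots> \<le> (\<Sum>t. emeasure (st (switch \<pi> n \<sigma>) t) (space MX))"
        by (subst suminf_offset[of _ n]) (auto simp: add.commute)
      finally show "(\<integral>\<^sup>+x. W x \<partial>st \<pi> n) \<noteq> \<infinity>" using fin_switch[of n] by (auto simp: top_unique)
    qed measurable
    then have "emeasure (st \<pi> n) {x \<in> space MX. W x = \<infinity>} = 0" for n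
      by (subst (asm) AE_iff_measurable[OF _ refl]) auto
    \<comment> \<open>\<open>lam\<close> is the sum of the laws \<open>st \<pi> n\<close>, so a set
      that is null for all of them is \<open>lam\<close>-null.\<close>
    then have "emeasure lam {x \<in> space MX. W x = \<infinity>} = 0"
      using lam[of "indicator {x \<in> space MX. W x = \<infinity>}"] by simp
    then have "AE x in lam. W x \<noteq> \<infinity>"
      by (subst AE_iff_measurable[OF _ refl]) (auto simp: sets_eq_imp_space_eq[OF sets_lam])
    then have "AE x in lam. (\<lambda>n. ((P \<sigma>) ^^ n) (\<lambda>_. 1) x) \<longlonglongrightarrow> 0"
      by eventually_elim (auto simp: W_def intro: ennreal_suminf_finite_imp_tendsto_0)
    moreover have "AE x in lam. ((P \<sigma>) ^^ n) (\<lambda>_. 1) x \<le> 1" for n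
      by (rule AE_I2, rule P_funpow_le_1) (auto simp: \<sigma> sets_eq_imp_space_eq[OF sets_lam])
    \<comment> \<open>The mass of \<open>lam\<close> is the expected absorption time of
      \<open>\<pi>\<close>, so the constant 1 is an integrable majorant.\<close>
    moreover have "(\<integral>\<^sup>+x. 1 \<partial>lam) < \<infinity>" using fin by (subst lam) auto
    ultimately have "(\<lambda>n. \<integral>\<^sup>+x. ((P \<sigma>) ^^ n) (\<lambda>_. 1) x \<partial>lam) \<longlonglongrightarrow> (\<integral>\<^sup>+x. 0 \<partial>lam)"
      by (intro nn_integral_dominated_convergence[where w="\<lambda>_. 1"]) auto
    then show ?thesis by simp
  qed
  \<comment> \<open>Test functions bounded by 1 suffice for \<open>Kint\<close> of indicators, and
    their remainder is dominated by that of the constant 1.\<close>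
  have eq: "(\<Sum>j. \<integral>\<^sup>+x. f x \<partial>st (stationary \<sigma>) j) = (\<integral>\<^sup>+x. f x \<partial>lam)"
    if [measurable]: "f \<in> borel_measurable MX" and f: "\<And>x. x \<in> space MX \<Longrightarrow> f x \<le> 1" for f
  proof -
    have le: "((P \<sigma>) ^^ n) f x \<le> ((P \<sigma>) ^^ n) (\<lambda>_. 1) x" if "x \<in> space MX" for n x
      using that
    proof (induction n arbitrary: x)
      case (Suc n)
      note s = prob_kernel_space[OF \<sigma> Suc.prems]
      have "step (((P \<sigma>) ^^ n) f) (x, a) \<le> step (((P \<sigma>) ^^ n) (\<lambda>_. 1)) (x, a)" if "a \<in> space MA" for a
      proof -
        have "(x, a) \<in> space (MX \<Otimes>\<^sub>M MA)" using that Suc.prems by (simp add: space_pair_measure)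
        note q = prob_kernel_space[OF Q_measurable this]
        show ?thesis unfolding step_def[of _ "(x, a)"] by (intro nn_integral_mono mult_left_mono Suc.IH) (auto simp: q)
      qed
      then show ?case unfolding funpow.simps comp_apply Kint_def[of _ _ x]
        by (intro nn_integral_mono) (simp add: s)
    qed (use f in simp)
    have "(\<lambda>n. \<integral>\<^sup>+x. ((P \<sigma>) ^^ n) f x \<partial>lam) \<longlonglongrightarrow> 0"
      by (rule tendsto_sandwich[OF _ _ tendsto_const vanish])
        (auto intro!: always_eventually nn_integral_mono le simp: sets_eq_imp_space_eq[OF sets_lam])
    then have "(\<lambda>n. (\<Sum>j<n. \<integral>\<^sup>+x. f x \<partial>st (stationary \<sigma>) j) + (\<integral>\<^sup>+x. ((P \<sigma>) ^^ n) f x \<partial>lam))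
      \<longlonglongrightarrow> (\<Sum>j. \<integral>\<^sup>+x. f x \<partial>st (stationary \<sigma>) j) + 0"
      by (intro tendsto_add summable_LIMSEQ) auto
    then have "(\<lambda>n::nat. \<integral>\<^sup>+x. f x \<partial>lam) \<longlonglongrightarrow> (\<Sum>j. \<integral>\<^sup>+x. f x \<partial>st (stationary \<sigma>) j) + 0"
      by (subst (asm) iter[symmetric]) auto
    then show ?thesis using LIMSEQ_unique[OF tendsto_const] by fastforce
  qed
  show ?thesis
  proof (rule measure_eqI)
    fix \<Gamma> assume "\<Gamma> \<in> sets (occm (stationary \<sigma>))"
    then have [measurable]: "\<Gamma> \<in> sets (MX \<Otimes>\<^sub>M MA)" by simp
    have "(\<integral>\<^sup>+w. indicator \<Gamma> w \<partial>occm (stationary \<sigma>)) = (\<Sum>t. \<integral>\<^sup>+w. indicator \<Gamma> w \<partial>so (stationary \<sigma>) t)"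
      by (rule nn_integral_occ[OF ks]) measurable
    also have "\<dots> = (\<Sum>t. \<integral>\<^sup>+x. Kint \<sigma> (indicator \<Gamma>) x \<partial>st (stationary \<sigma>) t)"
      by (intro suminf_cong nn_integral_so_markov[OF ks]) auto
    also have "\<dots> = (\<integral>\<^sup>+x. Kint \<sigma> (indicator \<Gamma>) x \<partial>lam)"
      by (rule eq) (measurable, rule Kint_le_1[OF \<sigma>], auto split: split_indicator)
    also have "\<dots> = (\<integral>\<^sup>+w. indicator \<Gamma> w \<partial>occm \<pi>)"
      unfolding lam_def by (rule disint[symmetric]) measurable
    finally show "emeasure (occm (stationary \<sigma>)) \<Gamma> = emeasure (occm \<pi>) \<Gamma>" by simp
  qed simp
qed

subsection \<open>Atomlessness of the state laws\<close>

lemma emeasure_st_le_1: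
  assumes k[measurable]: "kernels \<pi>"
  shows "emeasure (st \<pi> t) (space MX) \<le> 1"
proof -
  have "emeasure (st \<pi> t) (space MX) = (\<integral>\<^sup>+x. 1 \<partial>st \<pi> t)" by simp
  also have "\<dots> = (\<integral>\<^sup>+h. indicator {h. alive \<Delta> t h} h * 1 \<partial>law \<pi> t)"
    by (rule nn_integral_st[OF k]) simp
  also have "\<dots> \<le> (\<integral>\<^sup>+h. 1 \<partial>law \<pi> t)"
    by (rule nn_integral_mono) (simp split: split_indicator)
  also have "\<dots> = 1" using law_prob[OF k, of t] by (auto simp: space_prob_algebra prob_space.emeasure_space_1)
  finally show ?thesis .
qed

lemma finite_measure_st: "kernels \<pi> \<Longrightarrow> finite_measure (st \<pi> t)"
  using emeasure_st_le_1[of \<pi> t] by (intro finite_measureI) (auto simp: top_unique)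

lemma finite_measure_so:
  assumes k: "kernels \<pi>"
  shows "finite_measure (so \<pi> t)"
proof (rule finite_measureI)
  have "emeasure (so \<pi> t) (space (so \<pi> t)) = (\<integral>\<^sup>+w. 1 \<partial>so \<pi> t)" by simp
  also have "\<dots> = (\<integral>\<^sup>+x. 1 \<partial>st \<pi> t)" by (rule nn_integral_so_fst[OF k]) simp
  also have "\<dots> \<le> 1" using emeasure_st_le_1[OF k, of t] by simp
  finally show "emeasure (so \<pi> t) (space (so \<pi> t)) \<noteq> \<infinity>" by (auto simp: top_unique)
qed

text \<open>A measure-theoretic atom of the law of \<open>X\<^sub>t\<close> would be concentrated on a set-theoretic atom \<open>I\<close> of the
  countably generated sub-\<open>\<sigma>\<close>-algebra, but such \<open>I\<close> is null for each atomless transition law.\<close>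

lemma st_atomless:
  assumes k: "kernels \<pi>" and atomless: "atomless_model MX MA Q \<eta> \<Delta>"
  shows "atomless_on (sets MX) (emeasure (st \<pi> t))"
proof (cases t)
  case 0
  have "emeasure (st \<pi> 0) C = emeasure \<eta> (C - \<Delta>)" if [measurable]: "C \<in> sets MX" for C
  proof -
    have "emeasure (st \<pi> 0) C = (\<integral>\<^sup>+x. indicator C x \<partial>st \<pi> 0)" by simp
    also have "\<dots> = (\<integral>\<^sup>+x. indicator (- \<Delta>) x * indicator C x \<partial>\<eta>)" by (rule nn_integral_st_0[OF k]) simp
    also have "\<dots> = (\<integral>\<^sup>+x. indicator (C - \<Delta>) x \<partial>\<eta>)" by (intro nn_integral_cong) (auto split: split_indicator)
    also have "\<dots> = emeasure \<eta> (C - \<Delta>)" by (rule nn_integral_indicator) (simp add: sets_\<eta>)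
    finally show ?thesis .
  qed
  then show ?thesis using atomless unfolding 0 atomless_model_def atomless_on_def by metis
next
  case (Suc t')
  interpret finite_measure "st \<pi> t" by (rule finite_measure_st[OF k])
  obtain G where G: "countable G" "sigma_sets (space MX) G \<subseteq> sets MX"
    and G_atomless: "\<And>x a. x \<in> space MX - \<Delta> \<Longrightarrow> a \<in> space MA \<Longrightarrow>
      atomless_on (sigma_sets (space MX) G) (\<lambda>B. emeasure (Q (x,a)) (B - \<Delta>))"
    using atomless unfolding atomless_model_def by blast
  have G_sets: "C \<in> sets MX" if "C \<in> G" for C using G(2) that by (auto intro: sigma_sets.Basic)
  then have "G \<subseteq> Pow (space MX)" using sets.sets_into_space by blast
  then interpret sG: sigma_algebra "space MX" "sigma_sets (space MX) G" by (rule sigma_algebra_sigma_sets)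
  show ?thesis unfolding atomless_on_def
  proof (rule notI, elim bexE conjE)
    fix B assume B[measurable]: "B \<in> sets MX" and pos: "0 < emeasure (st \<pi> t) B"
      and atom: "\<forall>C\<in>sets MX. C \<subseteq> B \<longrightarrow> emeasure (st \<pi> t) C = 0 \<or> emeasure (st \<pi> t) C = emeasure (st \<pi> t) B"
    \<comment> \<open>Of \<open>C\<close> and its complement, the one that carries the whole mass of
      the atom \<open>B\<close>.\<close>
    define E where "E C = (if emeasure (st \<pi> t) (B \<inter> C) = 0 then space MX - C else C)" for C
    have E_G: "E C \<in> sigma_sets (space MX) G" if "C \<in> G" for C
      using that by (auto simp: E_def intro: sigma_sets.Basic sigma_sets.Compl)
    have null: "emeasure (st \<pi> t) (B - E C) = 0" if "C \<in> G" for C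
    proof (cases "emeasure (st \<pi> t) (B \<inter> C) = 0")
      case True
      have "B - E C = B \<inter> C" using True sets.sets_into_space[OF B] by (auto simp: E_def)
      then show ?thesis using True by simp
    next
      case False
      have [measurable]: "C \<in> sets MX" by (rule G_sets[OF that])
      have "emeasure (st \<pi> t) (B \<inter> C) = emeasure (st \<pi> t) B" using atom False by (meson B G_sets inf_le1 sets.Int that)
      moreover have "emeasure (st \<pi> t) (B - B \<inter> C) = emeasure (st \<pi> t) B - emeasure (st \<pi> t) (B \<inter> C)"
        by (rule emeasure_Diff) auto
      moreover have "B - E C = B - B \<inter> C" using False by (auto simp: E_def)
      ultimately show ?thesis by simp
    qed
    \<comment> \<open>Countability of \<open>G\<close> keeps the mass of \<open>B\<close> on this
      intersection; inserting \<open>space MX\<close> covers the case of empty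
      \<open>G\<close>.\<close>
    define I where "I = (\<Inter>C\<in>insert (space MX) (E ` G). C)"
    have I_sG: "I \<in> sigma_sets (space MX) G" unfolding I_def
      by (rule sG.countable_INT') (use G(1) E_G sG.top in auto)
    then have I[measurable]: "I \<in> sets MX" using G(2) by blast
    \<comment> \<open>No set of the generated \<sigma>-algebra cuts \<open>I\<close>: this holds for
      generators and passes to complements and countable unions.\<close>
    have I_atom: "I \<subseteq> C \<or> I \<inter> C = {}" if "C \<in> sigma_sets (space MX) G" for C
      using that
    proof induction
      case (Basic C)
      have "I \<subseteq> E C" using Basic by (auto simp: I_def)
      then show ?case by (auto simp: E_def split: if_splits)
    next
      case (Compl C)
      have "I \<subseteq> space MX" by (auto simp: I_def)
      then show ?case using Compl.IH by blast
    qed auto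
    have Q0: "emeasure (Q (x, a)) (I - \<Delta>) = 0" if xa: "x \<in> space MX - \<Delta>" "a \<in> space MA" for x a
    proof (rule ccontr)
      assume "emeasure (Q (x, a)) (I - \<Delta>) \<noteq> 0"
      then obtain C where C: "C \<in> sigma_sets (space MX) G" "C \<subseteq> I" "emeasure (Q (x, a)) (C - \<Delta>) \<noteq> 0"
         "emeasure (Q (x, a)) (C - \<Delta>) \<noteq> emeasure (Q (x, a)) (I - \<Delta>)"
        using G_atomless[OF xa] I_sG unfolding atomless_on_def by (meson not_gr_zero)
      from I_atom[OF C(1)] C(2) have "C = I \<or> C = {}" by auto
      with C(3,4) show False by auto
    qed
    have "emeasure (st \<pi> t) I = (\<integral>\<^sup>+x. indicator I x \<partial>st \<pi> (Suc t'))" by (simp add: Suc)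
    also have "\<dots> = (\<integral>\<^sup>+w. step (indicator I) w \<partial>so \<pi> t')" by (rule nn_integral_st_Suc[OF k]) simp
    also have "\<dots> = (\<integral>\<^sup>+w. 0 \<partial>so \<pi> t')"
    proof (rule nn_integral_cong_AE)
      have "AE w in so \<pi> t'. w \<in> space (MX \<Otimes>\<^sub>M MA)" by auto
      with AE_so_alive[OF k] show "AE w in so \<pi> t'. step (indicator I) w = 0"
      proof eventually_elim
        case (elim w)
        have "step (indicator I) w = (\<integral>\<^sup>+y. indicator (I - \<Delta>) y \<partial>Q w)"
          unfolding step_def by (intro nn_integral_cong) (auto split: split_indicator)
        also have "\<dots> = emeasure (Q w) (I - \<Delta>)"
          by (rule nn_integral_indicator) (simp add: prob_kernel_space(2)[OF Q_measurable elim(2)])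
        also have "\<dots> = 0" using Q0[of "fst w" "snd w"] elim by (auto simp: space_pair_measure)
        finally show ?case .
      qed
    qed
    finally have I0: "emeasure (st \<pi> t) I = 0" by simp
    have "B - (\<Union>C\<in>G. B - E C) \<subseteq> I" using sets.sets_into_space[OF B] by (auto simp: I_def)
    moreover have "(\<Union>C\<in>G. B - E C) \<in> null_sets (st \<pi> t)"
    proof (rule null_sets_UN'[OF G(1)])
      fix C assume "C \<in> G"
      then have "E C \<in> sets MX" using E_G G(2) by blast
      then show "B - E C \<in> null_sets (st \<pi> t)" using null[OF \<open>C \<in> G\<close>] by (auto simp: null_sets_def)
    qed
    moreover have "I \<in> null_sets (st \<pi> t)" using I0 by (auto simp: null_sets_def)
    ultimately have "B \<subseteq> I \<union> (\<Union>C\<in>G. B - E C)" "I \<union> (\<Union>C\<in>G. B - E C) \<in> null_sets (st \<pi> t)"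
      by (blast, intro null_sets.Un)
    then have "B \<in> null_sets (st \<pi> t)" using B null_sets_subset by (metis sets_st)
    then show False using pos by (auto simp: null_sets_def)
  qed
qed

subsection \<open>Perturbation at a single time\<close>

text \<open>The bound makes both 1 + h and 1 - h nonnegative. The last clause says that
  \<open>h\<close> has mean 0 under each \<open>\<sigma> x\<close>, in the form that 1 + h is a
  probability density.\<close>

definition perturbation :: "('x \<Rightarrow> 'a measure) \<Rightarrow> ('x \<times> 'a \<Rightarrow> real) \<Rightarrow> bool" where
  "perturbation \<sigma> h \<longleftrightarrow> h \<in> borel_measurable (MX \<Otimes>\<^sub>M MA) \<and> (\<forall>w\<in>space (MX \<Otimes>\<^sub>M MA). \<bar>h w\<bar> \<le> 1) \<and>
     (\<forall>x\<in>space MX. (\<integral>\<^sup>+a. ennreal (1 + h (x, a)) \<partial>\<sigma> x) = 1)"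

definition perturbed :: "('x \<Rightarrow> 'a measure) \<Rightarrow> nat \<Rightarrow> ('x \<times> 'a \<Rightarrow> real) \<Rightarrow> nat \<Rightarrow> 'x \<Rightarrow> 'a measure" where
  "perturbed \<sigma> t h s x = (if s = t then density (\<sigma> x) (\<lambda>a. ennreal (1 + h (x, a))) else \<sigma> x)"

abbreviation pol where "pol \<sigma> t h \<equiv> (\<lambda>s w. perturbed \<sigma> t h s (snd w))"

lemma perturbed_stat:
  assumes \<sigma>[measurable]: "\<sigma> \<in> stat" and h: "perturbation \<sigma> h"
  shows "perturbed \<sigma> t h s \<in> stat"
proof (cases "s = t")
  case True
  have hm[measurable]: "h \<in> borel_measurable (MX \<Otimes>\<^sub>M MA)" using h by (simp add: perturbation_def)
  have "(\<lambda>x. density (\<sigma> x) (\<lambda>a. ennreal (1 + h (x, a)))) \<in> stat"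
  proof (rule measurable_prob_algebraI)
    fix x assume x[measurable]: "x \<in> space MX"
    note s = prob_kernel_space[OF \<sigma> x]
    note [measurable_cong] = s(2)
    show "prob_space (density (\<sigma> x) (\<lambda>a. ennreal (1 + h (x, a))))"
      using h x by (intro prob_spaceI) (simp add: emeasure_density perturbation_def cong: nn_integral_cong)
  next
    show "(\<lambda>x. density (\<sigma> x) (\<lambda>a. ennreal (1 + h (x, a)))) \<in> MX \<rightarrow>\<^sub>M subprob_algebra MA"
    proof (rule measurable_subprob_algebra)
      fix x assume x[measurable]: "x \<in> space MX"
      note s = prob_kernel_space[OF \<sigma> x]
      note [measurable_cong] = s(2)
      show "subprob_space (density (\<sigma> x) (\<lambda>a. ennreal (1 + h (x, a))))"
        using h x by (intro prob_space_imp_subprob_space prob_spaceI) (simp add: emeasure_density perturbation_def cong: nn_integral_cong)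
      show "sets (density (\<sigma> x) (\<lambda>a. ennreal (1 + h (x, a)))) = sets MA" by (simp add: s)
    next
      fix A assume A[measurable]: "A \<in> sets MA"
      have "(\<lambda>x. \<integral>\<^sup>+a. ennreal (1 + h (x, a)) * indicator A a \<partial>\<sigma> x) \<in> borel_measurable MX"
        using Kint_measurable[OF \<sigma>, of "\<lambda>w. ennreal (1 + h w) * indicator A (snd w)"] by (simp add: Kint_def[abs_def])
      then show "(\<lambda>x. emeasure (density (\<sigma> x) (\<lambda>a. ennreal (1 + h (x, a)))) A) \<in> borel_measurable MX"
      proof (rule measurable_cong[THEN iffD2, rotated])
        fix x assume x[measurable]: "x \<in> space MX"
        note [measurable_cong] = prob_kernel_space(2)[OF \<sigma> x]
        show "emeasure (density (\<sigma> x) (\<lambda>a. ennreal (1 + h (x, a)))) A = (\<integral>\<^sup>+a. ennreal (1 + h (x, a)) * indicator A a \<partial>\<sigma> x)"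
          by (rule emeasure_density) measurable
      qed
    qed
  qed
  then show ?thesis using True by (simp add: perturbed_def[abs_def])
next
  case False
  then show ?thesis using \<sigma> by (simp add: perturbed_def[abs_def])
qed

lemma kernels_pol: "\<sigma> \<in> stat \<Longrightarrow> perturbation \<sigma> h \<Longrightarrow> kernels (pol \<sigma> t h)"
  by (intro kernels_markov perturbed_stat)

text \<open>Expected sum of \<open>F\<close> over all surviving times strictly after the current
  one, given the current state and action, when later actions follow
  \<open>\<sigma>\<close>.\<close>

definition tail :: "('x \<Rightarrow> 'a measure) \<Rightarrow> ('x \<times> 'a \<Rightarrow> ennreal) \<Rightarrow> 'x \<times> 'a \<Rightarrow> ennreal" where
  "tail \<sigma> F w = (\<Sum>k. step (((P \<sigma>) ^^ k) (Kint \<sigma> F)) w)"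

lemma tail_measurable[measurable]:
  assumes [measurable]: "\<sigma> \<in> stat" "F \<in> borel_measurable (MX \<Otimes>\<^sub>M MA)"
  shows "tail \<sigma> F \<in> borel_measurable (MX \<Otimes>\<^sub>M MA)"
  unfolding tail_def[abs_def] by measurable

text \<open>Before \<open>t\<close> nothing has changed, at \<open>t\<close> the law of state and
  action is reweighted by 1 + h, and given that pair the future runs under \<open>\<sigma>\<close>.
  So \<open>h\<close> enters through this single weight, also for the times after
  \<open>t\<close>.\<close>

lemma nn_integral_occ_pol:
  assumes \<sigma>[measurable]: "\<sigma> \<in> stat" and h: "perturbation \<sigma> h"
    and F[measurable]: "F \<in> borel_measurable (MX \<Otimes>\<^sub>M MA)"
  shows "(\<integral>\<^sup>+w. F w \<partial>occm (pol \<sigma> t h)) = (\<Sum>s<t. \<integral>\<^sup>+x. Kint \<sigma> F x \<partial>st (stationary \<sigma>) s) +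
    (\<integral>\<^sup>+w. ennreal (1 + h w) * (F w + tail \<sigma> F w) \<partial>so (stationary \<sigma>) t)"
proof -
  have hm[measurable]: "h \<in> borel_measurable (MX \<Otimes>\<^sub>M MA)" using h by (simp add: perturbation_def)
  note k = kernels_pol[OF \<sigma> h, of t] and ks = kernels_stationary[OF \<sigma>]
  have other: "pol \<sigma> t h s = (\<lambda>w. \<sigma> (snd w))" if "s \<noteq> t" for s
    using that by (simp add: perturbed_def)
  have st_eq: "st (pol \<sigma> t h) s = st (stationary \<sigma>) s" if "s \<le> t" for s
    by (rule st_cong, rule other) (use that in auto)
  have at: "(\<integral>\<^sup>+w. F' w \<partial>so (pol \<sigma> t h) t) = (\<integral>\<^sup>+w. ennreal (1 + h w) * F' w \<partial>so (stationary \<sigma>) t)"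
    if [measurable]: "F' \<in> borel_measurable (MX \<Otimes>\<^sub>M MA)" for F'
  proof -
    have "(\<integral>\<^sup>+w. F' w \<partial>so (pol \<sigma> t h) t) = (\<integral>\<^sup>+x. Kint (perturbed \<sigma> t h t) F' x \<partial>st (pol \<sigma> t h) t)"
      by (rule nn_integral_so_markov[OF k]) (simp_all add: perturbed_stat[OF \<sigma> h])
    also have "\<dots> = (\<integral>\<^sup>+x. Kint \<sigma> (\<lambda>w. ennreal (1 + h w) * F' w) x \<partial>st (stationary \<sigma>) t)"
      unfolding st_eq[OF order_refl]
    proof (rule nn_integral_cong)
      fix x assume "x \<in> space (st (stationary \<sigma>) t)"
      then have x[measurable]: "x \<in> space MX" by simp
      note [measurable_cong] = prob_kernel_space(2)[OF \<sigma> x]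
      show "Kint (perturbed \<sigma> t h t) F' x = Kint \<sigma> (\<lambda>w. ennreal (1 + h w) * F' w) x"
        by (simp add: Kint_def perturbed_def nn_integral_density)
    qed
    also have "\<dots> = (\<integral>\<^sup>+w. ennreal (1 + h w) * F' w \<partial>so (stationary \<sigma>) t)"
      by (rule nn_integral_so_markov[OF ks, symmetric]) auto
    finally show ?thesis .
  qed
  define a where "a s = (\<integral>\<^sup>+w. F w \<partial>so (pol \<sigma> t h) s)" for s
  have a_other: "a s = (\<integral>\<^sup>+x. Kint \<sigma> F x \<partial>st (pol \<sigma> t h) s)" if "s \<noteq> t" for s
    unfolding a_def by (rule nn_integral_so_markov[OF k other[OF that]]) auto
  \<comment> \<open>The first transition after time \<open>t\<close> starts from the perturbed pair
    law at \<open>t\<close>; the remaining \<open>j\<close> transitions use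
    \<open>\<sigma>\<close>.\<close>
  have a_after: "a (j + Suc t) = (\<integral>\<^sup>+w. ennreal (1 + h w) * step (((P \<sigma>) ^^ j) (Kint \<sigma> F)) w \<partial>so (stationary \<sigma>) t)" for j
  proof -
    have "a (j + Suc t) = (\<integral>\<^sup>+x. Kint \<sigma> F x \<partial>st (pol \<sigma> t h) (Suc t + j))"
      by (subst a_other) (simp_all add: add.commute)
    also have "\<dots> = (\<integral>\<^sup>+x. ((P \<sigma>) ^^ j) (Kint \<sigma> F) x \<partial>st (pol \<sigma> t h) (Suc t))"
      by (rule nn_integral_st_iterate[OF k], rule other) auto
    also have "\<dots> = (\<integral>\<^sup>+w. step (((P \<sigma>) ^^ j) (Kint \<sigma> F)) w \<partial>so (pol \<sigma> t h) t)"
      by (rule nn_integral_st_Suc[OF k]) measurable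
    also have "\<dots> = (\<integral>\<^sup>+w. ennreal (1 + h w) * step (((P \<sigma>) ^^ j) (Kint \<sigma> F)) w \<partial>so (stationary \<sigma>) t)"
      by (rule at) measurable
    finally show ?thesis .
  qed
  have "(\<integral>\<^sup>+w. F w \<partial>occm (pol \<sigma> t h)) = (\<Sum>s. a s)" unfolding a_def by (rule nn_integral_occ[OF k F])
  also have "\<dots> = (\<Sum>s<Suc t. a s) + (\<Sum>j. a (j + Suc t))" by (subst suminf_offset[of a "Suc t"]) (auto simp: add.commute)
  also have "(\<Sum>s<Suc t. a s) = (\<Sum>s<t. \<integral>\<^sup>+x. Kint \<sigma> F x \<partial>st (stationary \<sigma>) s) + a t"
    by (simp add: a_other st_eq)
  also have "a t = (\<integral>\<^sup>+w. ennreal (1 + h w) * F w \<partial>so (stationary \<sigma>) t)" unfolding a_def by (rule at) simp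
  also have "(\<Sum>j. a (j + Suc t)) = (\<integral>\<^sup>+w. ennreal (1 + h w) * tail \<sigma> F w \<partial>so (stationary \<sigma>) t)"
    unfolding tail_def a_after ennreal_suminf_cmult[symmetric] by (rule nn_integral_suminf[symmetric]) measurable
  finally show ?thesis by (simp add: distrib_left nn_integral_add add.assoc)
qed

lemma perturbation_0: "\<sigma> \<in> stat \<Longrightarrow> perturbation \<sigma> (\<lambda>_. 0)"
  using prob_kernel_space(1)[of \<sigma> MX MA] by (auto simp: perturbation_def prob_space.emeasure_space_1)

lemma pol_0: "pol \<sigma> t (\<lambda>_. 0) = stationary \<sigma>"
  by (auto simp: perturbed_def density_1 fun_eq_iff)

text \<open>The weights satisfy (1 + h)/2 + (1 - h)/2 = 1 pointwise. Extended reals are added and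
  never subtracted, so the identity also holds where \<open>tail\<close> is infinite.\<close>

lemma occ_pol_midpoint:
  assumes \<sigma>[measurable]: "\<sigma> \<in> stat" and h: "perturbation \<sigma> h" "perturbation \<sigma> (\<lambda>w. - h w)"
    and \<Gamma>[measurable]: "\<Gamma> \<in> sets (MX \<Otimes>\<^sub>M MA)"
  shows "emeasure (occm (stationary \<sigma>)) \<Gamma> = ennreal (1/2) * emeasure (occm (pol \<sigma> t h)) \<Gamma>
     + ennreal (1 - 1/2) * emeasure (occm (pol \<sigma> t (\<lambda>w. - h w))) \<Gamma>"
proof -
  have hm[measurable]: "h \<in> borel_measurable (MX \<Otimes>\<^sub>M MA)" using h by (simp add: perturbation_def)
  let ?N = "so (stationary \<sigma>) t"
  define V where "V w = indicator \<Gamma> w + tail \<sigma> (indicator \<Gamma>) w" for w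
  have [measurable]: "V \<in> borel_measurable (MX \<Otimes>\<^sub>M MA)" unfolding V_def[abs_def] by measurable
  define C where "C = (\<Sum>s<t. \<integral>\<^sup>+x. Kint \<sigma> (indicator \<Gamma>) x \<partial>st (stationary \<sigma>) s)"
  have e: "emeasure (occm (pol \<sigma> t h')) \<Gamma> = C + (\<integral>\<^sup>+w. ennreal (1 + h' w) * V w \<partial>?N)" if "perturbation \<sigma> h'" for h'
    using nn_integral_occ_pol[OF \<sigma> that, of "indicator \<Gamma>" t] by (simp add: C_def V_def)
  have half: "ennreal (1/2) * a + ennreal (1/2) * a = a" for a
  proof -
    have "ennreal (1/2) + ennreal (1/2) = ennreal (1/2 + 1/2)" by (rule ennreal_plus[symmetric]) auto
    then have "ennreal (1/2) + ennreal (1/2) = 1" by simp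
    then show ?thesis by (metis distrib_right mult_1)
  qed
  have "(\<integral>\<^sup>+w. ennreal (1/2) * (ennreal (1 + h w) * V w) + ennreal (1/2) * (ennreal (1 + - h w) * V w) \<partial>?N) = (\<integral>\<^sup>+w. V w \<partial>?N)"
  proof (rule nn_integral_cong)
    fix w assume "w \<in> space ?N"
    then have "\<bar>h w\<bar> \<le> 1" using h by (simp add: perturbation_def)
    then have "ennreal (1/2) * ennreal (1 + h w) + ennreal (1/2) * ennreal (1 + - h w)
      = ennreal (1/2 * (1 + h w) + 1/2 * (1 + - h w))"
    proof -
      have "0 \<le> 1 + h w" "0 \<le> 1 + - h w" using \<open>\<bar>h w\<bar> \<le> 1\<close> by auto
      then have "ennreal (1/2 * (1 + h w) + 1/2 * (1 + - h w)) = ennreal (1/2 * (1 + h w)) + ennreal (1/2 * (1 + - h w))"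
        "ennreal (1/2 * (1 + h w)) = ennreal (1/2) * ennreal (1 + h w)"
        "ennreal (1/2 * (1 + - h w)) = ennreal (1/2) * ennreal (1 + - h w)"
        by (intro ennreal_plus ennreal_mult mult_nonneg_nonneg; simp)+
      then show ?thesis by (simp only:)
    qed
    also have "1/2 * (1 + h w) + 1/2 * (1 + - h w) = 1" by (simp add: field_simps)
    finally have "ennreal (1/2) * ennreal (1 + h w) + ennreal (1/2) * ennreal (1 + - h w) = 1" by simp
    then show "ennreal (1/2) * (ennreal (1 + h w) * V w) + ennreal (1/2) * (ennreal (1 + - h w) * V w) = V w"
      by (metis distrib_right mult.assoc mult_1)
  qed
  moreover have "(\<integral>\<^sup>+w. ennreal (1/2) * (ennreal (1 + h w) * V w) + ennreal (1/2) * (ennreal (1 + - h w) * V w) \<partial>?N)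
    = ennreal (1/2) * (\<integral>\<^sup>+w. ennreal (1 + h w) * V w \<partial>?N) + ennreal (1/2) * (\<integral>\<^sup>+w. ennreal (1 + - h w) * V w \<partial>?N)"
    by (subst nn_integral_add, measurable, subst (1 2) nn_integral_cmult, measurable)
  ultimately have "ennreal (1/2) * (\<integral>\<^sup>+w. ennreal (1 + h w) * V w \<partial>?N) + ennreal (1/2) * (\<integral>\<^sup>+w. ennreal (1 + - h w) * V w \<partial>?N) = (\<integral>\<^sup>+w. V w \<partial>?N)"
    by simp
  moreover have "emeasure (occm (stationary \<sigma>)) \<Gamma> = C + (\<integral>\<^sup>+w. V w \<partial>?N)"
    using e[OF perturbation_0[OF \<sigma>]] by (simp add: pol_0)
  ultimately have "emeasure (occm (stationary \<sigma>)) \<Gamma> = (ennreal (1/2) * C + ennreal (1/2) * C) +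
     (ennreal (1/2) * (\<integral>\<^sup>+w. ennreal (1 + h w) * V w \<partial>?N) + ennreal (1/2) * (\<integral>\<^sup>+w. ennreal (1 + - h w) * V w \<partial>?N))"
    by (simp only: half)
  moreover have "(1 - 1/2 :: real) = 1/2" by simp
  ultimately show ?thesis unfolding e[OF h(1)] e[OF h(2)] by (simp only: distrib_left ac_simps)
qed

section \<open>Real integrals as affine functions of the perturbation, and injectivity\<close>

lemma emeasure_occ_space:
  assumes k: "kernels \<pi>"
  shows "emeasure (occm \<pi>) (space (MX \<Otimes>\<^sub>M MA)) = (\<Sum>t. emeasure (st \<pi> t) (space MX))"
proof -
  have "emeasure (so \<pi> t) (space (MX \<Otimes>\<^sub>M MA)) = emeasure (st \<pi> t) (space MX)" for t
    using nn_integral_so_fst[OF k, of "\<lambda>_. 1" t] by simp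
  then show ?thesis by (simp add: emeasure_occ k)
qed

lemma integrable_perturbed:
  assumes h: "perturbation \<sigma> h" and v: "integrable (so \<pi> t) v"
  shows "integrable (so \<pi> t) (\<lambda>w. h w * v w)"
proof (rule Bochner_Integration.integrable_bound[OF v])
  have [measurable]: "h \<in> borel_measurable (MX \<Otimes>\<^sub>M MA)" using h by (simp add: perturbation_def)
  have [measurable]: "v \<in> borel_measurable (MX \<Otimes>\<^sub>M MA)" using borel_measurable_integrable[OF v] by simp
  show "(\<lambda>w. h w * v w) \<in> borel_measurable (so \<pi> t)" by simp
  show "AE w in so \<pi> t. norm (h w * v w) \<le> norm (v w)"
  proof (rule AE_I2)
    fix w assume "w \<in> space (so \<pi> t)"
    then have "\<bar>h w\<bar> \<le> 1" using h by (simp add: perturbation_def)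
    then show "norm (h w * v w) \<le> norm (v w)" by (simp add: abs_mult mult_left_le_one_le)
  qed
qed

text \<open>Passage from extended to real integrals. At h = 0 the value is finite, which makes both
  the constant and the integral of \<open>V\<close> finite; \<open>V\<close> may still be infinite
  on a null set and is replaced by \<open>enn2real\<close> of it.\<close>

lemma nn_integral_occ_pol_affine:
  assumes \<sigma>[measurable]: "\<sigma> \<in> stat" and fin: "emeasure (occm (stationary \<sigma>)) (space (MX \<Otimes>\<^sub>M MA)) < \<infinity>"
    and F[measurable]: "F \<in> borel_measurable (MX \<Otimes>\<^sub>M MA)"
    and bound: "\<And>w. w \<in> space (MX \<Otimes>\<^sub>M MA) \<Longrightarrow> F w \<le> ennreal c"
  obtains R v where "R \<ge> 0" "\<And>w. v w \<ge> (0::real)" "integrable (so (stationary \<sigma>) t) v"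
    "\<And>h. perturbation \<sigma> h \<Longrightarrow> (\<integral>\<^sup>+w. F w \<partial>occm (pol \<sigma> t h)) = ennreal (R + (\<integral>w. (1 + h w) * v w \<partial>so (stationary \<sigma>) t))"
proof -
  let ?N = "so (stationary \<sigma>) t"
  define V where "V w = F w + tail \<sigma> F w" for w
  have V[measurable]: "V \<in> borel_measurable (MX \<Otimes>\<^sub>M MA)" unfolding V_def[abs_def] by measurable
  define C where "C = (\<Sum>s<t. \<integral>\<^sup>+x. Kint \<sigma> F x \<partial>st (stationary \<sigma>) s)"
  note occ = nn_integral_occ_pol[OF \<sigma> _ F, of _ t, folded C_def, folded V_def]
  have "(\<integral>\<^sup>+w. F w \<partial>occm (stationary \<sigma>)) \<le> (\<integral>\<^sup>+w. ennreal c \<partial>occm (stationary \<sigma>))"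
    by (intro nn_integral_mono) (simp add: bound)
  also have "\<dots> < \<infinity>" using fin by (simp add: ennreal_mult_less_top)
  finally have *: "C + (\<integral>\<^sup>+w. V w \<partial>?N) < \<infinity>" using occ[OF perturbation_0[OF \<sigma>]] by (simp add: pol_0)
  then have C: "C = ennreal (enn2real C)" and Vfin: "(\<integral>\<^sup>+w. V w \<partial>?N) < \<infinity>"
    by (auto simp: less_top)
  define v where "v w = enn2real (V w)" for w
  have [measurable]: "v \<in> borel_measurable (MX \<Otimes>\<^sub>M MA)" unfolding v_def[abs_def] by measurable
  have "AE w in ?N. V w \<noteq> \<infinity>" by (rule nn_integral_PInf_AE) (use Vfin in \<open>auto simp: less_top\<close>)
  then have Vv: "AE w in ?N. V w = ennreal (v w)" by eventually_elim (simp add: v_def less_top)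
  have "(\<integral>\<^sup>+w. ennreal (v w) \<partial>?N) = (\<integral>\<^sup>+w. V w \<partial>?N)"
    by (rule nn_integral_cong_AE) (use Vv in \<open>eventually_elim, simp\<close>)
  then have int: "integrable ?N v" using Vfin by (intro integrableI_nonneg) (auto simp: v_def)
  show ?thesis
  proof (rule that[of "enn2real C" v])
    fix h assume h: "perturbation \<sigma> h"
    have [measurable]: "h \<in> borel_measurable (MX \<Otimes>\<^sub>M MA)" using h by (simp add: perturbation_def)
    have h1: "0 \<le> 1 + h w" if "w \<in> space (MX \<Otimes>\<^sub>M MA)" for w
    proof -
      have "\<bar>h w\<bar> \<le> 1" using h that by (simp add: perturbation_def)
      then show ?thesis by linarith
    qed
    have int': "integrable ?N (\<lambda>w. (1 + h w) * v w)"
      using int integrable_perturbed[OF h int] by (simp add: distrib_right)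
    have nn: "AE w in ?N. 0 \<le> (1 + h w) * v w" by (rule AE_I2) (simp add: h1 v_def)
    have "(\<integral>\<^sup>+w. ennreal (1 + h w) * V w \<partial>?N) = (\<integral>\<^sup>+w. ennreal ((1 + h w) * v w) \<partial>?N)"
    proof (rule nn_integral_cong_AE)
      have "AE w in ?N. w \<in> space (MX \<Otimes>\<^sub>M MA)" by auto
      with Vv show "AE w in ?N. ennreal (1 + h w) * V w = ennreal ((1 + h w) * v w)"
        by eventually_elim (simp only: h1 ennreal_mult v_def enn2real_nonneg)
    qed
    also have "\<dots> = ennreal (\<integral>w. (1 + h w) * v w \<partial>?N)" by (rule nn_integral_eq_integral[OF int' nn])
    finally have "(\<integral>\<^sup>+w. F w \<partial>occm (pol \<sigma> t h)) = ennreal (enn2real C) + ennreal (\<integral>w. (1 + h w) * v w \<partial>?N)"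
      using occ[OF h] C by simp
    also have "\<dots> = ennreal (enn2real C + (\<integral>w. (1 + h w) * v w \<partial>?N))"
      using integral_nonneg_AE[OF nn] by (simp add: ennreal_plus)
    finally show "(\<integral>\<^sup>+w. F w \<partial>occm (pol \<sigma> t h)) = ennreal (enn2real C + (\<integral>w. (1 + h w) * v w \<partial>?N))" .
  qed (use int in \<open>auto simp: v_def\<close>)
qed

text \<open>Positive and negative part of \<open>g\<close> are affine in \<open>h\<close>
  separately. Moving the integral of \<open>v\<close> into \<open>R\<close> leaves a term linear in
  \<open>h\<close>, so a constraint is preserved iff this term vanishes.\<close>

lemma integral_occ_pol_affine:
  fixes g :: "'x \<times> 'a \<Rightarrow> real"
  assumes \<sigma>[measurable]: "\<sigma> \<in> stat" and fin: "emeasure (occm (stationary \<sigma>)) (space (MX \<Otimes>\<^sub>M MA)) < \<infinity>"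
    and g[measurable]: "g \<in> borel_measurable (MX \<Otimes>\<^sub>M MA)" and bdd: "bounded (g ` space (MX \<Otimes>\<^sub>M MA))"
  obtains R v where "integrable (so (stationary \<sigma>) t) v"
    "\<And>h. perturbation \<sigma> h \<Longrightarrow> integral\<^sup>L (occm (pol \<sigma> t h)) g = R + (\<integral>w. h w * v w \<partial>so (stationary \<sigma>) t)"
proof -
  let ?N = "so (stationary \<sigma>) t"
  obtain c where c: "\<And>w. w \<in> space (MX \<Otimes>\<^sub>M MA) \<Longrightarrow> \<bar>g w\<bar> \<le> c"
    using bdd unfolding bounded_iff by auto
  have b: "ennreal (g w) \<le> ennreal c" "ennreal (- g w) \<le> ennreal c" if "w \<in> space (MX \<Otimes>\<^sub>M MA)" for w
    using c[OF that] by (auto intro!: ennreal_leI)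
  obtain R1 v1 where 1: "R1 \<ge> 0" "\<And>w. v1 w \<ge> (0::real)" "integrable ?N v1"
    "\<And>h. perturbation \<sigma> h \<Longrightarrow> (\<integral>\<^sup>+w. ennreal (g w) \<partial>occm (pol \<sigma> t h)) = ennreal (R1 + (\<integral>w. (1 + h w) * v1 w \<partial>?N))"
  proof -
    have "(\<lambda>w. ennreal (g w)) \<in> borel_measurable (MX \<Otimes>\<^sub>M MA)" by measurable
    from nn_integral_occ_pol_affine[OF \<sigma> fin this b(1), where t=t] that show ?thesis by blast
  qed
  obtain R2 v2 where 2: "R2 \<ge> 0" "\<And>w. v2 w \<ge> (0::real)" "integrable ?N v2"
    "\<And>h. perturbation \<sigma> h \<Longrightarrow> (\<integral>\<^sup>+w. ennreal (- g w) \<partial>occm (pol \<sigma> t h)) = ennreal (R2 + (\<integral>w. (1 + h w) * v2 w \<partial>?N))"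
  proof -
    have "(\<lambda>w. ennreal (- g w)) \<in> borel_measurable (MX \<Otimes>\<^sub>M MA)" by measurable
    from nn_integral_occ_pol_affine[OF \<sigma> fin this b(2), where t=t] that show ?thesis by blast
  qed
  show ?thesis
  proof (rule that[of "\<lambda>w. v1 w - v2 w" "R1 - R2 + (\<integral>w. v1 w \<partial>?N) - (\<integral>w. v2 w \<partial>?N)"])
    show "integrable ?N (\<lambda>w. v1 w - v2 w)" using 1(3) 2(3) by simp
    fix h assume h: "perturbation \<sigma> h"
    have h1: "0 \<le> 1 + h w" if "w \<in> space (MX \<Otimes>\<^sub>M MA)" for w
    proof -
      have "\<bar>h w\<bar> \<le> 1" using h that by (simp add: perturbation_def)
      then show ?thesis by linarith
    qed
    have int: "integrable ?N (\<lambda>w. h w * v1 w)" "integrable ?N (\<lambda>w. h w * v2 w)"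
      using integrable_perturbed[OF h] 1(3) 2(3) by blast+
    have nn: "0 \<le> (\<integral>w. (1 + h w) * v1 w \<partial>?N)" "0 \<le> (\<integral>w. (1 + h w) * v2 w \<partial>?N)"
      using h1 1(2) 2(2) by (auto intro!: integral_nonneg_AE AE_I2)
    have "integrable (occm (pol \<sigma> t h)) g"
      unfolding real_integrable_def using 1(4)[OF h] 2(4)[OF h] by auto
    then have "integral\<^sup>L (occm (pol \<sigma> t h)) g = (R1 + (\<integral>w. (1 + h w) * v1 w \<partial>?N)) - (R2 + (\<integral>w. (1 + h w) * v2 w \<partial>?N))"
      using add_nonneg_nonneg[OF 1(1) nn(1)] add_nonneg_nonneg[OF 2(1) nn(2)]
      by (simp only: real_lebesgue_integral_def 1(4)[OF h] 2(4)[OF h] enn2real_ennreal)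
    then show "integral\<^sup>L (occm (pol \<sigma> t h)) g = R1 - R2 + (\<integral>w. v1 w \<partial>?N) - (\<integral>w. v2 w \<partial>?N) + (\<integral>w. h w * (v1 w - v2 w) \<partial>?N)"
      using int 1(3) 2(3) by (simp add: distrib_right right_diff_distrib)
  qed
qed

lemma step_cong: "w \<in> space (MX \<Otimes>\<^sub>M MA) \<Longrightarrow> (\<And>x. x \<in> space MX \<Longrightarrow> f x = f' x) \<Longrightarrow> step f w = step f' w"
  unfolding step_def by (intro nn_integral_cong) (simp add: prob_kernel_space(3)[OF Q_measurable])

lemma P_funpow_cong:
  assumes "\<sigma> \<in> stat" "\<And>x. x \<in> space MX \<Longrightarrow> f x = f' x" "x \<in> space MX"
  shows "((P \<sigma>) ^^ k) f x = ((P \<sigma>) ^^ k) f' x"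
  using assms(3)
proof (induction k arbitrary: x)
  case (Suc k)
  show ?case unfolding funpow.simps comp_apply Kint_def[of _ _ x]
    by (intro nn_integral_cong step_cong Suc.IH)
      (auto simp: space_pair_measure Suc.prems prob_kernel_space(3)[OF assms(1) Suc.prems])
qed (simp add: assms)

text \<open>Both occupation measures are tested against 1 + h and against 1. The two tests differ
  only at time \<open>t\<close>, by the integral of (1 + h) h for one policy and of (1 - h) h for
  the other. Equality of these integrals gives a zero second moment.\<close>

lemma occ_pol_eq_imp_perturbation_0:
  assumes \<sigma>[measurable]: "\<sigma> \<in> stat" and fin: "emeasure (occm (stationary \<sigma>)) (space (MX \<Otimes>\<^sub>M MA)) < \<infinity>"
    and h: "perturbation \<sigma> h" "perturbation \<sigma> (\<lambda>w. - h w)"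
    and eq: "occm (pol \<sigma> t h) = occm (pol \<sigma> t (\<lambda>w. - h w))"
  shows "AE w in so (stationary \<sigma>) t. h w = 0"
proof -
  let ?N = "so (stationary \<sigma>) t"
  interpret N: finite_measure ?N by (rule finite_measure_so[OF kernels_stationary[OF \<sigma>]])
  have [measurable]: "h \<in> borel_measurable (MX \<Otimes>\<^sub>M MA)" using h by (simp add: perturbation_def)
  have hb: "\<bar>h w\<bar> \<le> 1" if "w \<in> space (MX \<Otimes>\<^sub>M MA)" for w using h that by (simp add: perturbation_def)
  \<comment> \<open>1 + h instead of h: a nonnegative test function with the same conditional mean
    as 1.\<close>
  define F where "F w = ennreal (1 + h w)" for w
  have F[measurable]: "F \<in> borel_measurable (MX \<Otimes>\<^sub>M MA)" unfolding F_def[abs_def] by measurable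
  have one[measurable]: "(\<lambda>_. 1 :: ennreal) \<in> borel_measurable (MX \<Otimes>\<^sub>M MA)" by simp
  have Kint_eq: "Kint \<sigma> F x = Kint \<sigma> (\<lambda>_. 1) x" if "x \<in> space MX" for x
    using h(1) that prob_space.emeasure_space_1[OF prob_kernel_space(1)[OF \<sigma> that]]
    by (simp add: perturbation_def Kint_def F_def)
  define T where "T = tail \<sigma> (\<lambda>_. 1)"
  have T[measurable]: "T \<in> borel_measurable (MX \<Otimes>\<^sub>M MA)" unfolding T_def by measurable
  have tail_eq: "tail \<sigma> F w = T w" if "w \<in> space (MX \<Otimes>\<^sub>M MA)" for w
    unfolding T_def tail_def by (intro suminf_cong step_cong[OF that] P_funpow_cong[OF \<sigma> Kint_eq])
  define C where "C = (\<Sum>s<t. \<integral>\<^sup>+x. Kint \<sigma> (\<lambda>_. 1) x \<partial>st (stationary \<sigma>) s)"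
  have C_F: "(\<Sum>s<t. \<integral>\<^sup>+x. Kint \<sigma> F x \<partial>st (stationary \<sigma>) s) = C"
    unfolding C_def by (intro sum.cong refl nn_integral_cong) (simp add: Kint_eq)
  \<comment> \<open>Contribution of all times except \<open>t\<close> itself. It may depend on
    \<open>e\<close>, but it is the same for the test functions \<open>F\<close> and 1.\<close>
  define X where "X e = C + (\<integral>\<^sup>+w. ennreal (1 + e w) * T w \<partial>?N)" for e
  have occ_F: "(\<integral>\<^sup>+w. F w \<partial>occm (pol \<sigma> t e)) = X e + (\<integral>\<^sup>+w. ennreal (1 + e w) * F w \<partial>?N)"
    and occ_1: "(\<integral>\<^sup>+w. 1 \<partial>occm (pol \<sigma> t e)) = X e + (\<integral>\<^sup>+w. ennreal (1 + e w) \<partial>?N)"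
    if e: "perturbation \<sigma> e" for e
  proof -
    have [measurable]: "e \<in> borel_measurable (MX \<Otimes>\<^sub>M MA)" using e by (simp add: perturbation_def)
    have "(\<integral>\<^sup>+w. F w \<partial>occm (pol \<sigma> t e)) = C + (\<integral>\<^sup>+w. ennreal (1 + e w) * (F w + T w) \<partial>?N)"
      unfolding nn_integral_occ_pol[OF \<sigma> e F] C_F
      by (intro arg_cong2[of _ _ _ _ plus] refl nn_integral_cong) (simp add: tail_eq)
    then show "(\<integral>\<^sup>+w. F w \<partial>occm (pol \<sigma> t e)) = X e + (\<integral>\<^sup>+w. ennreal (1 + e w) * F w \<partial>?N)"
      by (simp add: distrib_left nn_integral_add X_def ac_simps)
    have "(\<integral>\<^sup>+w. 1 \<partial>occm (pol \<sigma> t e)) = C + (\<integral>\<^sup>+w. ennreal (1 + e w) * (1 + T w) \<partial>?N)"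
      unfolding nn_integral_occ_pol[OF \<sigma> e one] C_def T_def ..
    also have "(\<integral>\<^sup>+w. ennreal (1 + e w) * (1 + T w) \<partial>?N) = (\<integral>\<^sup>+w. ennreal (1 + e w) + ennreal (1 + e w) * T w \<partial>?N)"
      by (simp only: distrib_left mult_1_right)
    also have "\<dots> = (\<integral>\<^sup>+w. ennreal (1 + e w) \<partial>?N) + (\<integral>\<^sup>+w. ennreal (1 + e w) * T w \<partial>?N)"
      by (rule nn_integral_add) measurable
    finally show "(\<integral>\<^sup>+w. 1 \<partial>occm (pol \<sigma> t e)) = X e + (\<integral>\<^sup>+w. ennreal (1 + e w) \<partial>?N)"
      by (simp only: X_def ac_simps)
  qed
  have X_fin: "X e < \<infinity>" if e: "perturbation \<sigma> e" for e
  proof -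
    have "(\<integral>\<^sup>+w. 1 \<partial>occm (pol \<sigma> t e)) < \<infinity>"
    proof (rule nn_integral_occ_pol_affine[OF \<sigma> fin one, where c=1 and t=t])
      fix R and v :: "'x \<times> 'a \<Rightarrow> real"
      assume "\<And>h. perturbation \<sigma> h \<Longrightarrow> (\<integral>\<^sup>+w. 1 \<partial>occm (pol \<sigma> t h)) = ennreal (R + (\<integral>w. (1 + h w) * v w \<partial>?N))"
      from this[OF e] show ?thesis by (simp del: nn_integral_const)
    qed simp
    then have "X e + (\<integral>\<^sup>+w. ennreal (1 + e w) \<partial>?N) < \<infinity>" unfolding occ_1[OF e] .
    then show ?thesis by (auto simp: less_top)
  qed
  have int: "integrable ?N h" "integrable ?N (\<lambda>w. h w * h w)"
    using integrable_perturbed[OF h(1), of "stationary \<sigma>" t "\<lambda>_. 1"] integrable_perturbed[OF h(1), of "stationary \<sigma>" t h] by auto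
  define m where "m = (\<integral>w. h w \<partial>?N)"
  define q where "q = (\<integral>w. h w * h w \<partial>?N)"
  define n where "n = (\<integral>w. (1::real) \<partial>?N)"
  have ev: "(\<integral>\<^sup>+w. ennreal (1 + s * h w) \<partial>?N) = ennreal (n + s * m) \<and> 0 \<le> n + s * m"
    "(\<integral>\<^sup>+w. ennreal (1 + s * h w) * F w \<partial>?N) = ennreal (n + (1 + s) * m + s * q) \<and> 0 \<le> n + (1 + s) * m + s * q"
    if s: "s = 1 \<or> s = -1" for s :: real
  proof -
    have nn: "0 \<le> 1 + s * h w" "0 \<le> 1 + h w" if "w \<in> space (MX \<Otimes>\<^sub>M MA)" for w using hb[OF that] s by auto
    have i: "integrable ?N (\<lambda>w. 1 + s * h w)" using int by auto
    have j: "integrable ?N (\<lambda>w. 1 + (1 + s) * h w + s * (h w * h w))" using int by auto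
    have a: "AE w in ?N. 0 \<le> 1 + s * h w" by (rule AE_I2) (simp add: nn)
    have "0 \<le> (1 + s * h w) * (1 + h w)" if "w \<in> space (MX \<Otimes>\<^sub>M MA)" for w
      using nn[OF that] by (rule mult_nonneg_nonneg)
    moreover have e: "(1 + s * h w) * (1 + h w) = 1 + (1 + s) * h w + s * (h w * h w)" for w by (simp add: algebra_simps)
    ultimately have b: "AE w in ?N. 0 \<le> 1 + (1 + s) * h w + s * (h w * h w)" by (intro AE_I2) simp
    have "(\<integral>w. 1 + s * h w \<partial>?N) = n + s * m" using int by (simp add: n_def m_def)
    then show "(\<integral>\<^sup>+w. ennreal (1 + s * h w) \<partial>?N) = ennreal (n + s * m) \<and> 0 \<le> n + s * m"
      using nn_integral_eq_integral[OF i a] integral_nonneg_AE[OF a] by simp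
    have J: "(\<integral>w. 1 + (1 + s) * h w + s * (h w * h w) \<partial>?N) = n + (1 + s) * m + s * q" using int by (simp add: n_def m_def q_def)
    have "(\<integral>\<^sup>+w. ennreal (1 + s * h w) * F w \<partial>?N) = (\<integral>\<^sup>+w. ennreal (1 + (1 + s) * h w + s * (h w * h w)) \<partial>?N)"
      unfolding F_def e[symmetric] by (intro nn_integral_cong ennreal_mult[symmetric]) (auto simp: nn)
    then show "(\<integral>\<^sup>+w. ennreal (1 + s * h w) * F w \<partial>?N) = ennreal (n + (1 + s) * m + s * q) \<and> 0 \<le> n + (1 + s) * m + s * q"
      using nn_integral_eq_integral[OF j b] integral_nonneg_AE[OF b] J by simp
  qed
  obtain x y where x: "X h = ennreal x" "x \<ge> 0" and y: "X (\<lambda>w. - h w) = ennreal y" "y \<ge> 0"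
    using X_fin[OF h(1)] X_fin[OF h(2)] by (metis ennreal_enn2real enn2real_nonneg infinity_ennreal_def)
  have "ennreal x + ennreal (n + m) = ennreal y + ennreal (n - m)"
    using occ_1[OF h(1)] occ_1[OF h(2)] ev(1)[of 1] ev(1)[of "-1"] eq x y by (simp del: nn_integral_const)
  then have r1: "x + (n + m) = y + (n - m)"
    using x y ev(1)[of 1] ev(1)[of "-1"] by (simp add: ennreal_plus[symmetric] del: ennreal_plus)
  have "ennreal x + ennreal (n + 2 * m + q) = ennreal y + ennreal (n - q)"
    using occ_F[OF h(1)] occ_F[OF h(2)] ev(2)[of 1] ev(2)[of "-1"] eq x y by simp
  then have r2: "x + (n + 2 * m + q) = y + (n - q)"
    using x y ev(2)[of 1] ev(2)[of "-1"] by (simp add: ennreal_plus[symmetric] del: ennreal_plus)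
  \<comment> \<open>\<open>r1\<close> gives x - y = -2m, while \<open>r2\<close> gives x - y = -2m -
    2q.\<close>
  have "q = 0" using r1 r2 by linarith
  then have "AE w in ?N. h w * h w = 0"
    unfolding q_def by (subst (asm) integral_nonneg_eq_0_iff_AE[OF int(2)]) auto
  then show ?thesis by eventually_elim simp
qed

subsection \<open>Admissible policies\<close>

abbreviation "policy Aset \<equiv> is_policy MX MA Aset"

lemma policy_kernels: "policy Aset \<pi> \<Longrightarrow> kernels \<pi>"
  by (simp add: is_policy_def kernels_def)

lemma space_HS_snd: "h \<in> space (Hn n) \<Longrightarrow> snd h \<in> space MX"
  by (rule measurable_space[OF snd_HS])

lemma policy_markov:
  assumes "\<And>t. \<sigma> t \<in> stat" "\<And>t x. x \<in> space MX \<Longrightarrow> emeasure (\<sigma> t x) (Aset x) = 1"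
  shows "policy Aset (\<lambda>t h. \<sigma> t (snd h))"
  using kernels_markov[of \<sigma>, OF assms(1)] assms(2) space_HS_snd by (simp add: is_policy_def kernels_def)

lemma policy_switch:
  assumes "policy Aset \<pi>" "policy Aset (stationary \<sigma>)"
  shows "policy Aset (switch \<pi> n \<sigma>)"
  using assms unfolding is_policy_def switch_def by simp

text \<open>The perturbed kernel has a density with respect to \<open>\<sigma> x\<close>, so it
  still lives on the admissible actions.\<close>

lemma policy_pol:
  assumes \<sigma>: "\<sigma> \<in> stat" and A: "\<And>x. x \<in> space MX \<Longrightarrow> Aset x \<in> sets MA"
    and adm: "\<And>x. x \<in> space MX \<Longrightarrow> emeasure (\<sigma> x) (Aset x) = 1" and h: "perturbation \<sigma> h"
  shows "policy Aset (pol \<sigma> t h)"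
proof (rule policy_markov)
  show "perturbed \<sigma> t h s \<in> stat" for s by (rule perturbed_stat[OF \<sigma> h])
  fix s x assume x[measurable]: "x \<in> space MX"
  have [measurable]: "h \<in> borel_measurable (MX \<Otimes>\<^sub>M MA)" using h by (simp add: perturbation_def)
  note s = prob_kernel_space[OF \<sigma> x] and p = prob_kernel_space[OF perturbed_stat[OF \<sigma> h, of t s] x]
  interpret \<sigma>x: prob_space "\<sigma> x" by (rule s)
  interpret px: prob_space "perturbed \<sigma> t h s x" by (rule p)
  note [measurable_cong] = s(2)
  have Ax: "Aset x \<in> sets MA" by (rule A[OF x])
  have "AE a in \<sigma> x. a \<in> Aset x"
    using adm[OF x] Ax by (subst \<sigma>x.AE_in_set_eq_1) (auto simp: s measure_def)
  then have "AE a in perturbed \<sigma> t h s x. a \<in> Aset x"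
    unfolding perturbed_def by (auto simp: AE_density)
  then have "px.prob (Aset x) = 1" using Ax by (subst (asm) px.AE_in_set_eq_1) (auto simp: p)
  then show "emeasure (perturbed \<sigma> t h s x) (Aset x) = 1" by (simp add: px.emeasure_eq_measure)
qed

lemma AE_occ_Kset:
  assumes A: "\<And>x. x \<in> space MX \<Longrightarrow> Aset x \<in> sets MA" and K[measurable]: "Kset MX MA Aset \<in> sets (MX \<Otimes>\<^sub>M MA)"
    and pol: "policy Aset \<pi>"
  shows "AE w in occm \<pi>. w \<in> Kset MX MA Aset"
proof -
  note k = policy_kernels[OF pol]
  let ?N = "space (MX \<Otimes>\<^sub>M MA) - Kset MX MA Aset"
  have "emeasure (so \<pi> t) ?N = 0" for t
  proof -
    have "emeasure (so \<pi> t) ?N = (\<integral>\<^sup>+w. indicator ?N w \<partial>so \<pi> t)" by simp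
    also have "\<dots> = (\<integral>\<^sup>+h. indicator {h. alive \<Delta> t h} h * (\<integral>\<^sup>+a. indicator ?N (snd h, a) \<partial>\<pi> t h) \<partial>law \<pi> t)"
      by (rule nn_integral_so[OF k]) measurable
    also have "\<dots> = (\<integral>\<^sup>+h. 0 \<partial>law \<pi> t)"
    proof (rule nn_integral_cong)
      fix h assume "h \<in> space (law \<pi> t)"
      then have h: "h \<in> space (Hn t)" by (simp add: space_law k)
      note x = space_HS_snd[OF h]
      note s = prob_kernel_space[OF kernelsD[OF k] h]
      interpret s: prob_space "\<pi> t h" by (rule s)
      have "emeasure (\<pi> t h) (Aset (snd h)) = 1" using pol h by (simp add: is_policy_def)
      then have "AE a in \<pi> t h. a \<in> Aset (snd h)"
        using A[OF x] by (subst s.AE_in_set_eq_1) (auto simp: s measure_def)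
      then have "AE a in \<pi> t h. indicator ?N (snd h, a) = (0::ennreal)"
        by eventually_elim (use x in \<open>auto simp: Kset_def space_pair_measure split: split_indicator\<close>)
      then have "(\<integral>\<^sup>+a. indicator ?N (snd h, a) \<partial>\<pi> t h) = (\<integral>\<^sup>+a. 0 \<partial>\<pi> t h)" by (rule nn_integral_cong_AE)
      then show "indicator {h. alive \<Delta> t h} h * (\<integral>\<^sup>+a. indicator ?N (snd h, a) \<partial>\<pi> t h) = 0" by simp
    qed
    finally show ?thesis by simp
  qed
  then have "emeasure (occm \<pi>) ?N = 0" by (simp add: emeasure_occ k)
  then show ?thesis by (intro AE_I[of _ _ ?N]) auto
qed

lemma nn_integral_marginal:
  assumes k: "kernels \<pi>" and f[measurable]: "f \<in> borel_measurable MX"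
  shows "(\<integral>\<^sup>+x. f x \<partial>distr (occm \<pi>) MX fst) = (\<Sum>t. \<integral>\<^sup>+x. f x \<partial>st \<pi> t)"
proof -
  have "(\<integral>\<^sup>+x. f x \<partial>distr (occm \<pi>) MX fst) = (\<integral>\<^sup>+w. f (fst w) \<partial>occm \<pi>)" by (rule nn_integral_distr) auto
  also have "\<dots> = (\<Sum>t. \<integral>\<^sup>+w. f (fst w) \<partial>so \<pi> t)" by (rule nn_integral_occ[OF k]) auto
  finally show ?thesis by (simp add: nn_integral_so_fst[OF k])
qed

text \<open>Disintegration yields admissibility only for almost every state. The exceptional states
  form a measurable null set, on which the Dirac kernel at the selector \<open>\<theta>\<close>
  takes over without changing any integral.\<close>

lemma admissible_disintegration:
  assumes A: "\<And>x. x \<in> space MX \<Longrightarrow> Aset x \<in> sets MA" and K[measurable]: "Kset MX MA Aset \<in> sets (MX \<Otimes>\<^sub>M MA)"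
    and \<theta>[measurable]: "\<theta> \<in> MX \<rightarrow>\<^sub>M MA" and \<theta>A: "\<And>x. x \<in> space MX \<Longrightarrow> \<theta> x \<in> Aset x"
    and pol: "policy Aset \<pi>" and fin: "emeasure (occm \<pi>) (space (MX \<Otimes>\<^sub>M MA)) < \<infinity>"
    and f: "f \<in> borel_measurable MA" and g: "g \<in> borel \<rightarrow>\<^sub>M MA"
    and fg: "\<And>a. a \<in> space MA \<Longrightarrow> 0 \<le> f a \<and> f a \<le> (1::real) \<and> g (f a) = a"
  obtains \<sigma> where "\<sigma> \<in> stat" "\<And>x. x \<in> space MX \<Longrightarrow> emeasure (\<sigma> x) (Aset x) = 1"
    "\<And>F. F \<in> borel_measurable (MX \<Otimes>\<^sub>M MA) \<Longrightarrow>
       (\<integral>\<^sup>+w. F w \<partial>occm \<pi>) = (\<integral>\<^sup>+x. Kint \<sigma> F x \<partial>distr (occm \<pi>) MX fst)"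
proof -
  let ?lam = "distr (occm \<pi>) MX fst"
  have "finite_measure (occm \<pi>)" using fin by (intro finite_measureI) auto
  from disintegration[OF this sets_occ f g fg]
  obtain \<sigma>0 where \<sigma>0[measurable]: "\<sigma>0 \<in> stat"
    and dis: "\<And>F. F \<in> borel_measurable (MX \<Otimes>\<^sub>M MA) \<Longrightarrow> (\<integral>\<^sup>+w. F w \<partial>occm \<pi>) = (\<integral>\<^sup>+x. Kint \<sigma>0 F x \<partial>?lam)"
    unfolding Kint_def by metis
  define G where "G = {x \<in> space MX. Kint \<sigma>0 (indicator (Kset MX MA Aset)) x = 1}"
  have G[measurable]: "G \<in> sets MX" unfolding G_def by measurable
  have Kint_K: "Kint \<sigma>' (indicator (Kset MX MA Aset)) x = emeasure (\<sigma>' x) (Aset x)"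
    if "\<sigma>' \<in> stat" and x: "x \<in> space MX" for x \<sigma>'
  proof -
    note s = prob_kernel_space[OF that]
    have "Kint \<sigma>' (indicator (Kset MX MA Aset)) x = (\<integral>\<^sup>+a. indicator (Aset x) a \<partial>\<sigma>' x)"
      unfolding Kint_def using x by (intro nn_integral_cong) (auto simp: Kset_def s split: split_indicator)
    then show ?thesis using A[OF x] by (simp add: s)
  qed
  define \<sigma> where "\<sigma> x = (if x \<in> G then \<sigma>0 x else return MA (\<theta> x))" for x
  have \<sigma>: "\<sigma> \<in> stat" unfolding \<sigma>_def[abs_def] by (rule measurable_If_set) auto
  have "(\<integral>\<^sup>+x. Kint \<sigma>0 (indicator (space (MX \<Otimes>\<^sub>M MA) - Kset MX MA Aset)) x \<partial>?lam) = 0"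
  proof -
    have "(\<integral>\<^sup>+w. indicator (space (MX \<Otimes>\<^sub>M MA) - Kset MX MA Aset) w \<partial>occm \<pi>) = (\<integral>\<^sup>+w. 0 \<partial>occm \<pi>)"
      using AE_occ_Kset[OF A K pol] by (intro nn_integral_cong_AE) (auto elim!: eventually_mono)
    then show ?thesis by (subst dis[symmetric]) (simp_all del: nn_integral_indicator)
  qed
  then have "AE x in ?lam. Kint \<sigma>0 (indicator (space (MX \<Otimes>\<^sub>M MA) - Kset MX MA Aset)) x = 0"
    by (subst (asm) nn_integral_0_iff_AE) auto
  then have "AE x in ?lam. x \<in> space MX \<and> Kint \<sigma>0 (indicator (space (MX \<Otimes>\<^sub>M MA) - Kset MX MA Aset)) x = 0" by auto
  then have AE_G: "AE x in ?lam. x \<in> G"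
  proof eventually_elim
    case (elim x)
    then have x: "x \<in> space MX" by simp
    note s = prob_kernel_space[OF \<sigma>0 x]
    interpret s: prob_space "\<sigma>0 x" by (rule s)
    have "Kint \<sigma>0 (indicator (space (MX \<Otimes>\<^sub>M MA) - Kset MX MA Aset)) x = (\<integral>\<^sup>+a. indicator (space MA - Aset x) a \<partial>\<sigma>0 x)"
      unfolding Kint_def using x
      by (intro nn_integral_cong) (auto simp: Kset_def space_pair_measure s split: split_indicator)
    also have "\<dots> = emeasure (\<sigma>0 x) (space (\<sigma>0 x) - Aset x)"
      using A[OF x] by (simp add: s sets.compl_sets)
    finally have "emeasure (\<sigma>0 x) (space (\<sigma>0 x) - Aset x) = 0" using elim by simp
    then have "emeasure (\<sigma>0 x) (Aset x) = 1"
      using A[OF x] s.prob_compl[of "Aset x"] by (simp add: s s.emeasure_eq_measure)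
    then show "x \<in> G" using x by (simp add: G_def Kint_K[OF \<sigma>0])
  qed
  show ?thesis
  proof (rule that[OF \<sigma>])
    fix x assume x: "x \<in> space MX"
    show "emeasure (\<sigma> x) (Aset x) = 1"
    proof (cases "x \<in> G")
      case True
      then show ?thesis using Kint_K[OF \<sigma>0 x] by (simp add: \<sigma>_def G_def)
    next
      case False
      then show ?thesis using A[OF x] \<theta>A[OF x] by (simp add: \<sigma>_def)
    qed
  next
    fix F :: "'x \<times> 'a \<Rightarrow> ennreal" assume F[measurable]: "F \<in> borel_measurable (MX \<Otimes>\<^sub>M MA)"
    have "(\<integral>\<^sup>+x. Kint \<sigma>0 F x \<partial>?lam) = (\<integral>\<^sup>+x. Kint \<sigma> F x \<partial>?lam)"
      using AE_G by (intro nn_integral_cong_AE) (auto simp: \<sigma>_def Kint_def elim!: eventually_mono)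
    then show "(\<integral>\<^sup>+w. F w \<partial>occm \<pi>) = (\<integral>\<^sup>+x. Kint \<sigma> F x \<partial>?lam)" using dis[OF F] by simp
  qed
qed

subsection \<open>Splitting a randomized kernel\<close>

text \<open>Subtracting the conditional probability centres the indicator of \<open>D\<close> under
  every \<open>\<sigma> x\<close>, and a factor that depends on the state alone keeps it
  centred.\<close>

lemma perturbation_centred:
  assumes \<sigma>: "\<sigma> \<in> stat" and D[measurable]: "D \<in> sets MA" and c[measurable]: "c \<in> borel_measurable MX"
    and c1: "\<And>x. x \<in> space MX \<Longrightarrow> \<bar>c x\<bar> \<le> (1::real)"
  shows "perturbation \<sigma> (\<lambda>w. c (fst w) * (indicator D (snd w) - measure (\<sigma> (fst w)) D))"
  unfolding perturbation_def
proof (intro conjI ballI)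
  have m[measurable]: "(\<lambda>x. measure (\<sigma> x) D) \<in> borel_measurable MX"
    by (rule measurable_compose[OF \<sigma>]) measurable
  show "(\<lambda>w. c (fst w) * (indicator D (snd w) - measure (\<sigma> (fst w)) D)) \<in> borel_measurable (MX \<Otimes>\<^sub>M MA)" by measurable
  have b: "\<bar>c x * (indicator D a - measure (\<sigma> x) D)\<bar> \<le> 1" if x: "x \<in> space MX" for x a
  proof -
    have "measure (\<sigma> x) D \<le> 1" using prob_kernel_space(1)[OF \<sigma> x] by (rule prob_space.prob_le_1)
    then have "\<bar>indicator D a - measure (\<sigma> x) D\<bar> \<le> 1" by (auto simp: indicator_def)
    then show ?thesis using c1[OF x] by (simp add: abs_mult mult_le_one)
  qed
  show "\<bar>c (fst w) * (indicator D (snd w) - measure (\<sigma> (fst w)) D)\<bar> \<le> 1" if "w \<in> space (MX \<Otimes>\<^sub>M MA)" for w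
    using that by (intro b) (auto simp: space_pair_measure)
  fix x assume x: "x \<in> space MX"
  note s = prob_kernel_space[OF \<sigma> x]
  interpret s: prob_space "\<sigma> x" by (rule s)
  note [measurable_cong] = s(2)
  have iD: "integrable (\<sigma> x) (indicator D :: _ \<Rightarrow> real)"
    by (rule s.integrable_const_bound[where B=1]) auto
  then have i: "integrable (\<sigma> x) (\<lambda>a. 1 + c x * (indicator D a - measure (\<sigma> x) D))" by simp
  have "(\<integral>\<^sup>+a. ennreal (1 + c x * (indicator D a - measure (\<sigma> x) D)) \<partial>\<sigma> x)
     = ennreal (\<integral>a. 1 + c x * (indicator D a - measure (\<sigma> x) D) \<partial>\<sigma> x)"
  proof (rule nn_integral_eq_integral[OF i AE_I2])
    fix a
    show "0 \<le> 1 + c x * (indicator D a - measure (\<sigma> x) D)" using b[OF x, of a] by linarith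
  qed
  also have "(\<integral>a. 1 + c x * (indicator D a - measure (\<sigma> x) D) \<partial>\<sigma> x) = 1"
    using iD s.prob_space by (simp add: s)
  finally show "(\<integral>\<^sup>+a. ennreal (1 + c (fst (x, a)) * (indicator D (snd (x, a)) - measure (\<sigma> (fst (x, a))) D)) \<partial>\<sigma> x) = 1"
    by simp
qed

lemma emeasure_so_rectangle:
  assumes k: "kernels \<pi>" and B[measurable]: "B \<in> sets MX"
  shows "emeasure (so \<pi> t) (B \<times> space MA) = emeasure (st \<pi> t) B"
proof -
  have "emeasure (so \<pi> t) (B \<times> space MA) = (\<integral>\<^sup>+w. indicator (B \<times> space MA) w \<partial>so \<pi> t)"
    by (rule nn_integral_indicator[symmetric]) simp
  also have "\<dots> = (\<integral>\<^sup>+w. indicator B (fst w) \<partial>so \<pi> t)"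
    by (intro nn_integral_cong) (auto simp: space_pair_measure split: split_indicator)
  also have "\<dots> = emeasure (st \<pi> t) B" by (subst nn_integral_so_fst[OF k]) auto
  finally show ?thesis .
qed

text \<open>The finitely many constraints are killed by taking a linear combination of more than \<open>p\<close>
  perturbations with disjoint supports.\<close>
lemma exists_constrained_perturbation:
  fixes v :: "nat \<Rightarrow> 'x \<times> 'a \<Rightarrow> real"
  assumes \<sigma>: "\<sigma> \<in> stat" and D[measurable]: "D \<in> sets MA"
    and atomless: "atomless_on (sets MX) (emeasure (st (stationary \<sigma>) t))"
    and pos: "emeasure (st (stationary \<sigma>) t) {x \<in> space MX. measure (\<sigma> x) D \<notin> {0, 1}} > 0"
    and v: "\<And>i. i < p \<Longrightarrow> integrable (so (stationary \<sigma>) t) (v i)"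
  obtains h where "perturbation \<sigma> h" "perturbation \<sigma> (\<lambda>w. - h w)"
    "\<forall>i<p. (\<integral>w. h w * v i w \<partial>so (stationary \<sigma>) t) = 0" "\<not> (AE w in so (stationary \<sigma>) t. h w = 0)"
proof -
  let ?N = "so (stationary \<sigma>) t" and ?st = "st (stationary \<sigma>) t"
  note ks = kernels_stationary[OF \<sigma>]
  have m[measurable]: "(\<lambda>x. measure (\<sigma> x) D) \<in> borel_measurable MX"
    by (rule measurable_compose[OF \<sigma>]) measurable
  have S: "{x \<in> space MX. measure (\<sigma> x) D \<notin> {0, 1}} \<in> sets ?st" by simp
  \<comment> \<open>Indices 0 to \<open>p\<close> give \<open>p\<close> + 1 sets, one more than the
    number of constraints.\<close>
  obtain C :: "nat \<Rightarrow> _" where C: "\<And>j. j \<le> p \<Longrightarrow> C j \<in> sets MX"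
    "\<And>j. j \<le> p \<Longrightarrow> C j \<subseteq> {x \<in> space MX. measure (\<sigma> x) D \<notin> {0, 1}}"
    "\<And>j. j \<le> p \<Longrightarrow> emeasure ?st (C j) > 0"
    and disj: "disjoint_family_on C {..p}"
    using atomless_disjoint_subsets[OF finite_measure_st[OF ks] _ S pos, of p] atomless by auto
  define u where "u w = indicator D (snd w) - measure (\<sigma> (fst w)) D" for w :: "'x \<times> 'a"
  have [measurable]: "u \<in> borel_measurable (MX \<Otimes>\<^sub>M MA)" unfolding u_def[abs_def] by measurable
  define e where "e j w = indicator (C j) (fst w) * u w" for j and w :: "'x \<times> 'a"
  have e_pert: "perturbation \<sigma> (e j)" if "j \<le> p" for j
    unfolding e_def[abs_def] u_def
    by (rule perturbation_centred[OF \<sigma> D]) (use C(1)[OF that] in \<open>auto split: split_indicator\<close>)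
  obtain c where c: "\<exists>j\<in>{..p}. c j \<noteq> 0" "\<forall>j\<in>{..p}. \<bar>c j\<bar> \<le> 1"
    "\<forall>i<p. (\<Sum>j\<in>{..p}. c j * (\<integral>w. e j w * v i w \<partial>?N)) = 0"
    using exists_bounded_kernel_vector[of "{..p}" p "\<lambda>i j. \<integral>w. e j w * v i w \<partial>?N"] by auto
  define cc where "cc x = (\<Sum>j\<le>p. c j * indicator (C j) x)" for x
  have [measurable]: "cc \<in> borel_measurable MX"
    unfolding cc_def[abs_def] using C(1) by (intro borel_measurable_sum borel_measurable_times) auto
  have cc_on: "cc x = c j" if "x \<in> C j" "j \<le> p" for x j
  proof -
    have uniq: "i = j" if "x \<in> C i" "i \<le> p" for i
    proof (rule ccontr)
      assume "i \<noteq> j"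
      then have "C i \<inter> C j = {}" using disjoint_family_onD[OF disj, of i j] that \<open>j \<le> p\<close> by simp
      then show False using that \<open>x \<in> C j\<close> by blast
    qed
    have "c i * indicator (C i) x = (if i = j then c j else 0)" if "i \<le> p" for i
    proof (cases "i = j")
      case True
      then show ?thesis using \<open>x \<in> C j\<close> by simp
    next
      case False
      then have "x \<notin> C i" using uniq that by blast
      then show ?thesis using False by simp
    qed
    then have "cc x = (\<Sum>i\<le>p. if i = j then c j else 0)" unfolding cc_def by (intro sum.cong) auto
    then show ?thesis using \<open>j \<le> p\<close> by simp
  qed
  \<comment> \<open>Disjointness reduces the sum to a single coefficient, so the bound on the
    coefficients carries over.\<close>
  have cc_le: "\<bar>cc x\<bar> \<le> 1" for x
  proof (cases "\<exists>j\<le>p. x \<in> C j")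
    case True
    then obtain j where j: "j \<le> p" "x \<in> C j" by blast
    then have "\<bar>c j\<bar> \<le> 1" using c(2) by simp
    then show ?thesis using cc_on[OF j(2,1)] by simp
  next
    case False
    then have "cc x = 0" unfolding cc_def by (intro sum.neutral) (auto split: split_indicator)
    then show ?thesis by simp
  qed
  define h where "h w = cc (fst w) * u w" for w
  have h_sum: "h w = (\<Sum>j\<le>p. c j * e j w)" for w
    by (simp only: h_def cc_def e_def sum_distrib_right mult.assoc)
  show ?thesis
  proof (rule that[of h])
    show "perturbation \<sigma> h" unfolding h_def[abs_def] u_def
      by (rule perturbation_centred[OF \<sigma> D]) (auto simp: cc_le)
    have "perturbation \<sigma> (\<lambda>w. (- cc (fst w)) * (indicator D (snd w) - measure (\<sigma> (fst w)) D))"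
      by (rule perturbation_centred[OF \<sigma> D, of "\<lambda>x. - cc x"]) (auto simp: cc_le)
    then show "perturbation \<sigma> (\<lambda>w. - h w)" unfolding h_def[abs_def] u_def by simp
    show "\<forall>i<p. (\<integral>w. h w * v i w \<partial>?N) = 0"
    proof (intro allI impI)
      fix i assume i: "i < p"
      have "integrable ?N (\<lambda>w. c j * (e j w * v i w))" if "j \<le> p" for j
        using integrable_perturbed[OF e_pert[OF that] v[OF i]] by simp
      then have "(\<integral>w. (\<Sum>j\<le>p. c j * (e j w * v i w)) \<partial>?N) = (\<Sum>j\<le>p. \<integral>w. c j * (e j w * v i w) \<partial>?N)"
        by (intro Bochner_Integration.integral_sum) auto
      also have "\<dots> = 0" using c(3) i by simp
      finally show "(\<integral>w. h w * v i w \<partial>?N) = 0" by (simp only: h_sum sum_distrib_right mult.assoc)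
    qed
    show "\<not> (AE w in ?N. h w = 0)"
    proof
      assume ae: "AE w in ?N. h w = 0"
      obtain j where j: "j \<le> p" "c j \<noteq> 0" using c(1) by auto
      \<comment> \<open>On \<open>C j\<close> the probability of \<open>D\<close> is neither 0 nor
        1, so \<open>u\<close> vanishes for no action: \<open>h\<close> is nonzero on a whole
        rectangle of positive measure.\<close>
      have "h w \<noteq> 0" if "w \<in> C j \<times> space MA" for w
      proof -
        have "measure (\<sigma> (fst w)) D \<notin> {0, 1}" using C(2)[OF j(1)] that by auto
        then have "u w \<noteq> 0" by (auto simp: u_def indicator_def)
        then show ?thesis using that j by (auto simp: h_def cc_on[of _ j])
      qed
      with ae have "AE w in ?N. w \<notin> C j \<times> space MA" by (auto elim!: eventually_mono)
      then have "emeasure ?N (C j \<times> space MA) = 0"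
        using C(1)[OF j(1)] by (subst (asm) AE_iff_measurable[of "C j \<times> space MA"])
          (use sets.sets_into_space[OF C(1)[OF j(1)]] in \<open>auto simp: space_pair_measure\<close>)
      then show False using C(3)[OF j(1)] emeasure_so_rectangle[OF ks C(1)[OF j(1)], of t] by simp
    qed
  qed
qed

text \<open>\<open>no_split\<close> is extremality in the form used: two opposite perturbations that
  respect the constraints give the same occupation measure. If \<open>D\<close> had a nontrivial
  probability on a set charged at some time \<open>t\<close>, a nonzero constrained perturbation
  would contradict it.\<close>

lemma zero_one_of_no_split:
  fixes g :: "nat \<Rightarrow> 'x \<times> 'a \<Rightarrow> real"
  assumes \<sigma>: "\<sigma> \<in> stat" and fin: "emeasure (occm (stationary \<sigma>)) (space (MX \<Otimes>\<^sub>M MA)) < \<infinity>"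
    and atomless: "atomless_model MX MA Q \<eta> \<Delta>" and D[measurable]: "D \<in> sets MA"
    and g: "\<And>i. i < p \<Longrightarrow> g i \<in> borel_measurable (MX \<Otimes>\<^sub>M MA)" "\<And>i. i < p \<Longrightarrow> bounded (g i ` space (MX \<Otimes>\<^sub>M MA))"
    and no_split: "\<And>h t. perturbation \<sigma> h \<Longrightarrow> perturbation \<sigma> (\<lambda>w. - h w) \<Longrightarrow>
      (\<And>i. i < p \<Longrightarrow> integral\<^sup>L (occm (pol \<sigma> t h)) (g i) = integral\<^sup>L (occm (stationary \<sigma>)) (g i)) \<Longrightarrow>
      (\<And>i. i < p \<Longrightarrow> integral\<^sup>L (occm (pol \<sigma> t (\<lambda>w. - h w))) (g i) = integral\<^sup>L (occm (stationary \<sigma>)) (g i)) \<Longrightarrow>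
      occm (pol \<sigma> t h) = occm (pol \<sigma> t (\<lambda>w. - h w))"
  shows "AE x in distr (occm (stationary \<sigma>)) MX fst. measure (\<sigma> x) D \<in> {0, 1}"
proof -
  note ks = kernels_stationary[OF \<sigma>]
  let ?S = "{x \<in> space MX. measure (\<sigma> x) D \<notin> {0, 1}}"
  have m[measurable]: "(\<lambda>x. measure (\<sigma> x) D) \<in> borel_measurable MX"
    by (rule measurable_compose[OF \<sigma>]) measurable
  have "emeasure (st (stationary \<sigma>) t) ?S = 0" for t
  proof (rule ccontr)
    assume "emeasure (st (stationary \<sigma>) t) ?S \<noteq> 0"
    then have pos: "emeasure (st (stationary \<sigma>) t) ?S > 0" by (simp add: zero_less_iff_neq_zero)
    have "\<forall>i\<in>{..<p}. \<exists>v. integrable (so (stationary \<sigma>) t) v \<and> (\<forall>h. perturbation \<sigma> h \<longrightarrow>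
        integral\<^sup>L (occm (pol \<sigma> t h)) (g i) = integral\<^sup>L (occm (stationary \<sigma>)) (g i) + (\<integral>w. h w * v w \<partial>so (stationary \<sigma>) t))"
    proof
      fix i assume "i \<in> {..<p}"
      then have "i < p" by simp
      obtain R v where v: "integrable (so (stationary \<sigma>) t) v"
        and Rv: "\<And>h. perturbation \<sigma> h \<Longrightarrow> integral\<^sup>L (occm (pol \<sigma> t h)) (g i) = R + (\<integral>w. h w * v w \<partial>so (stationary \<sigma>) t)"
        using integral_occ_pol_affine[OF \<sigma> fin g[OF \<open>i < p\<close>], where t=t] by blast
      have "integral\<^sup>L (occm (stationary \<sigma>)) (g i) = R"
        using Rv[OF perturbation_0[OF \<sigma>]] by (simp add: pol_0)
      then show "\<exists>v. integrable (so (stationary \<sigma>) t) v \<and> (\<forall>h. perturbation \<sigma> h \<longrightarrow>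
        integral\<^sup>L (occm (pol \<sigma> t h)) (g i) = integral\<^sup>L (occm (stationary \<sigma>)) (g i) + (\<integral>w. h w * v w \<partial>so (stationary \<sigma>) t))"
        using v Rv by blast
    qed
    from bchoice[OF this] obtain v where v: "\<And>i. i < p \<Longrightarrow> integrable (so (stationary \<sigma>) t) (v i)"
      and gv: "\<And>i h. i < p \<Longrightarrow> perturbation \<sigma> h \<Longrightarrow>
        integral\<^sup>L (occm (pol \<sigma> t h)) (g i) = integral\<^sup>L (occm (stationary \<sigma>)) (g i) + (\<integral>w. h w * v i w \<partial>so (stationary \<sigma>) t)"
      by (auto simp only: lessThan_iff)
    obtain h where h: "perturbation \<sigma> h" "perturbation \<sigma> (\<lambda>w. - h w)"
      and z: "\<forall>i<p. (\<integral>w. h w * v i w \<partial>so (stationary \<sigma>) t) = 0"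
      and nz: "\<not> (AE w in so (stationary \<sigma>) t. h w = 0)"
      by (rule exists_constrained_perturbation[OF \<sigma> D st_atomless[OF ks atomless] pos v])
    have "occm (pol \<sigma> t h) = occm (pol \<sigma> t (\<lambda>w. - h w))"
      by (rule no_split[OF h]) (simp_all add: gv h z)
    then show False using occ_pol_eq_imp_perturbation_0[OF \<sigma> fin h] nz by blast
  qed
  \<comment> \<open>The time \<open>t\<close> was arbitrary, and the marginal is the sum of the
    state laws over all times.\<close>
  then have "emeasure (distr (occm (stationary \<sigma>)) MX fst) ?S = 0"
    using nn_integral_marginal[OF ks, of "indicator ?S"] by simp
  then show ?thesis by (intro AE_I[of _ _ ?S]) auto
qed

text \<open>The sets {f \<le> q} with rational \<open>q\<close> are countably many, so one null set
  of states serves them all; outside it \<open>f\<close>, and hence the action, is almost surely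
  constant under \<open>\<sigma> x\<close>.\<close>

lemma deterministic_of_zero_one:
  fixes f :: "'a \<Rightarrow> real"
  assumes A: "\<And>x. x \<in> space MX \<Longrightarrow> Aset x \<in> sets MA" and K[measurable]: "Kset MX MA Aset \<in> sets (MX \<Otimes>\<^sub>M MA)"
    and \<theta>[measurable]: "\<theta> \<in> MX \<rightarrow>\<^sub>M MA" and \<theta>A: "\<And>x. x \<in> space MX \<Longrightarrow> \<theta> x \<in> Aset x"
    and f[measurable]: "f \<in> borel_measurable MA" and g[measurable]: "g \<in> borel \<rightarrow>\<^sub>M MA"
    and fg: "\<And>a. a \<in> space MA \<Longrightarrow> 0 \<le> f a \<and> f a \<le> 1 \<and> g (f a) = a"
    and \<sigma>: "\<sigma> \<in> stat" and adm: "\<And>x. x \<in> space MX \<Longrightarrow> emeasure (\<sigma> x) (Aset x) = 1"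
    and disint: "\<And>F. F \<in> borel_measurable (MX \<Otimes>\<^sub>M MA) \<Longrightarrow>
       (\<integral>\<^sup>+w. F w \<partial>occm \<pi>) = (\<integral>\<^sup>+x. Kint \<sigma> F x \<partial>distr (occm \<pi>) MX fst)"
    and zo: "\<And>D. D \<in> sets MA \<Longrightarrow> AE x in distr (occm \<pi>) MX fst. measure (\<sigma> x) D \<in> {0, 1}"
  obtains \<phi> where "\<phi> \<in> det_policies MX MA Aset" "AE w in occm \<pi>. snd w = \<phi> (fst w)"
proof -
  let ?lam = "distr (occm \<pi>) MX fst"
  \<comment> \<open>An almost surely constant \<open>f\<close> equals its mean; decoding the mean
    recovers the action, measurably in \<open>x\<close>.\<close>
  define \<phi>0 where "\<phi>0 x = g (\<integral>a. f a \<partial>\<sigma> x)" for x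
  have [measurable]: "(\<lambda>x. \<integral>a. f a \<partial>\<sigma> x) \<in> borel_measurable MX"
    by (rule measurable_compose[OF measurable_prob_algebraD[OF \<sigma>] integral_measurable_subprob_algebra[OF f]])
  have \<phi>0[measurable]: "\<phi>0 \<in> MX \<rightarrow>\<^sub>M MA" unfolding \<phi>0_def[abs_def] by measurable
  \<comment> \<open>The candidate can fail to be admissible on the exceptional null set, where
    \<open>\<theta>\<close> is used.\<close>
  define G where "G = {x \<in> space MX. (x, \<phi>0 x) \<in> Kset MX MA Aset}"
  have [measurable]: "G \<in> sets MX" unfolding G_def by measurable
  define \<phi> where "\<phi> x = (if x \<in> G then \<phi>0 x else \<theta> x)" for x
  have \<phi>[measurable]: "\<phi> \<in> MX \<rightarrow>\<^sub>M MA" unfolding \<phi>_def[abs_def] by measurable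
  have "AE x in ?lam. \<forall>q::rat. measure (\<sigma> x) {a \<in> space MA. f a \<le> of_rat q} \<in> {0, 1}"
    unfolding AE_all_countable by (intro allI zo) measurable
  then have "AE x in ?lam. x \<in> space MX \<and> (\<forall>q::rat. measure (\<sigma> x) {a \<in> space MA. f a \<le> of_rat q} \<in> {0, 1})" by auto
  then have ae: "AE x in ?lam. AE a in \<sigma> x. a = \<phi> x"
  proof eventually_elim
    case (elim x)
    then have x: "x \<in> space MX" by simp
    note s = prob_kernel_space[OF \<sigma> x]
    interpret s: prob_space "\<sigma> x" by (rule s)
    note [measurable_cong] = s(2)
    have "AE a in \<sigma> x. f a = (\<integral>a. f a \<partial>\<sigma> x)"
      by (rule zero_one_kernel_is_dirac[OF s(1)]) (use fg elim in \<open>auto simp: s\<close>)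
    moreover have "AE a in \<sigma> x. a \<in> space MA" using s(3) by auto
    ultimately have 1: "AE a in \<sigma> x. a = \<phi>0 x"
    proof eventually_elim
      case (elim a)
      have "g (f a) = a" using fg elim(2) by blast
      then show ?case using elim(1) by (simp add: \<phi>0_def)
    qed
    have "AE a in \<sigma> x. a \<in> Aset x"
      using adm[OF x] A[OF x] by (subst s.AE_in_set_eq_1) (auto simp: s measure_def)
    with 1 have "AE a in \<sigma> x. \<phi>0 x \<in> Aset x" by eventually_elim simp
    then have "\<phi>0 x \<in> Aset x" by simp
    then have "x \<in> G" using x measurable_space[OF \<phi>0 x] by (simp add: G_def Kset_def)
    then show ?case using 1 by (simp add: \<phi>_def)
  qed
  \<comment> \<open>Equality of actions is equality of real codes, which makes the off-graph set
    measurable.\<close>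
  have gf: "snd w = \<phi> (fst w) \<longleftrightarrow> f (snd w) = f (\<phi> (fst w))" if "w \<in> space (MX \<Otimes>\<^sub>M MA)" for w
    using that fg measurable_space[OF \<phi>, of "fst w"] by (metis mem_Times_iff space_pair_measure)
  let ?N = "{w \<in> space (MX \<Otimes>\<^sub>M MA). f (snd w) \<noteq> f (\<phi> (fst w))}"
  have N: "?N \<in> sets (MX \<Otimes>\<^sub>M MA)" by measurable
  have "(\<integral>\<^sup>+w. indicator ?N w \<partial>occm \<pi>) = (\<integral>\<^sup>+x. Kint \<sigma> (indicator ?N) x \<partial>?lam)"
    using N by (intro disint) simp
  also have "\<dots> = (\<integral>\<^sup>+x. 0 \<partial>?lam)"
  proof (rule nn_integral_cong_AE)
    from ae show "AE x in ?lam. Kint \<sigma> (indicator ?N) x = 0"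
    proof eventually_elim
      case (elim x)
      have "Kint \<sigma> (indicator ?N) x = (\<integral>\<^sup>+a. 0 \<partial>\<sigma> x)" unfolding Kint_def
        by (rule nn_integral_cong_AE) (use elim in \<open>eventually_elim, simp\<close>)
      then show ?case by simp
    qed
  qed
  finally have "emeasure (occm \<pi>) ?N = 0" using N by simp
  then have "AE w in occm \<pi>. snd w = \<phi> (fst w)"
    using N gf by (intro AE_I[of _ _ ?N]) auto
  moreover have "\<phi> \<in> det_policies MX MA Aset"
    using \<theta>A by (auto simp: det_policies_def \<phi>_def G_def Kset_def)
  ultimately show ?thesis by (rule that[rotated])
qed

end

section \<open>Extreme points\<close>

theorem mainTheorem7:
  fixes MX :: "'x measure" and MA :: "'a measure" and Aset :: "'x \<Rightarrow> 'a set"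
    and Q :: "'x \<times> 'a \<Rightarrow> 'x measure" and \<eta> :: "'x measure"
    and d :: nat and r :: "nat \<Rightarrow> 'x \<times> 'a \<Rightarrow> real" and \<Delta> :: "'x set"
    and B :: "'p::polish_space set"
    and p :: nat and g :: "nat \<Rightarrow> 'x \<times> 'a \<Rightarrow> real" and \<alpha> :: "nat \<Rightarrow> real"
  assumes "borel_iso MA B"
    and "model MX MA Aset Q \<eta> d r"
    and "absorbing MX MA Aset Q \<eta> d r \<Delta>"
    and "atomless_model MX MA Q \<eta> \<Delta>"
    and "p \<ge> 1"
    and "\<forall>i<p. g i \<in> borel_measurable (MX \<Otimes>\<^sub>M MA) \<and> bounded (g i ` space (MX \<Otimes>\<^sub>M MA))"
    and "\<forall>i<p. \<forall>x\<in>\<Delta>. \<forall>a\<in>space MA. g i (x, a) = 0"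
  shows "extreme_pts (MX \<Otimes>\<^sub>M MA) (Ocon MX MA Aset Q \<eta> \<Delta> p g \<alpha>)
         = ODcon MX MA Aset Q \<eta> \<Delta> p g \<alpha>"
proof -
  note model = assms(2)[unfolded model_def]
  interpret controlled_process MX MA Q \<eta> \<Delta>
  proof (rule controlled_process.intro)
    show "Q \<in> MX \<Otimes>\<^sub>M MA \<rightarrow>\<^sub>M prob_algebra MX" "prob_space \<eta>" "sets \<eta> = sets MX" using model by blast+
    show "\<Delta> \<in> sets MX" using assms(3) unfolding absorbing_def by blast
  qed
  have A: "Aset x \<in> sets MA" if "x \<in> space MX" for x using model that by blast
  have K[measurable]: "Kset MX MA Aset \<in> sets (MX \<Otimes>\<^sub>M MA)" using model by blast
  obtain \<theta> where \<theta>[measurable]: "\<theta> \<in> MX \<rightarrow>\<^sub>M MA" and \<theta>A: "\<And>x. x \<in> space MX \<Longrightarrow> \<theta> x \<in> Aset x"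
    using model by blast
  \<comment> \<open>A probability measure lives on a nonempty space; this supplies a state and,
    through \<open>\<theta>\<close>, the default action needed by the decoder.\<close>
  have "space \<eta> \<noteq> {}" using prob_\<eta> by (rule prob_space.not_empty)
  then obtain x0 where "x0 \<in> space MX" using sets_eq_imp_space_eq[OF sets_\<eta>] by auto
  then have "\<theta> x0 \<in> space MA" by (rule measurable_space[OF \<theta>])
  from borel_iso_real_retract[OF assms(1) this]
  obtain f :: "'a \<Rightarrow> real" and f' where f[measurable]: "f \<in> borel_measurable MA" and f'[measurable]: "f' \<in> borel \<rightarrow>\<^sub>M MA"
    and ff': "\<And>a. a \<in> space MA \<Longrightarrow> 0 \<le> f a \<and> f a \<le> 1 \<and> f' (f a) = a" by blast
  have fin_st: "(\<Sum>t. emeasure (st \<pi> t) (space MX)) < \<infinity>" if "policy Aset \<pi>" for \<pi>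
  proof -
    have "expT MX MA Q \<eta> \<Delta> \<pi> < \<infinity>" using assms(3) that unfolding absorbing_def by blast
    then show ?thesis by (simp only: expT_eq[OF policy_kernels[OF that]])
  qed
  then have fin: "emeasure (occm \<pi>) (space (MX \<Otimes>\<^sub>M MA)) < \<infinity>" if "policy Aset \<pi>" for \<pi>
    using that by (simp add: emeasure_occ_space policy_kernels)
  have det: "policy Aset (det_policy MA \<phi>)" if "\<phi> \<in> det_policies MX MA Aset" for \<phi>
    unfolding det_policy_def
    by (rule policy_markov[of "\<lambda>_ x. return MA (\<phi> x)"]) (use that A in \<open>auto simp: det_policies_def intro: return_stat\<close>)
  show ?thesis
  proof (intro subset_antisym subsetI)
    fix \<mu> assume "\<mu> \<in> ODcon MX MA Aset Q \<eta> \<Delta> p g \<alpha>"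
    then obtain \<phi> where \<phi>: "\<phi> \<in> det_policies MX MA Aset" and \<mu>: "\<mu> = occm (det_policy MA \<phi>)"
      and con: "constr p g \<alpha> \<mu>" by (auto simp: ODcon_def)
    have \<phi>m[measurable]: "\<phi> \<in> MX \<rightarrow>\<^sub>M MA" using \<phi> by (simp add: det_policies_def)
    have "snd w = \<phi> (fst w) \<longleftrightarrow> f (snd w) = f (\<phi> (fst w))" if "w \<in> space (MX \<Otimes>\<^sub>M MA)" for w
      using that ff' measurable_space[OF \<phi>m, of "fst w"] by (metis mem_Times_iff space_pair_measure)
    then have "{w \<in> space (MX \<Otimes>\<^sub>M MA). snd w \<noteq> \<phi> (fst w)} = {w \<in> space (MX \<Otimes>\<^sub>M MA). f (snd w) \<noteq> f (\<phi> (fst w))}" by auto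
    also have "\<dots> \<in> sets (MX \<Otimes>\<^sub>M MA)" by measurable
    finally have N: "{w \<in> space (MX \<Otimes>\<^sub>M MA). snd w \<noteq> \<phi> (fst w)} \<in> sets (MX \<Otimes>\<^sub>M MA)" .
    show "\<mu> \<in> extreme_pts (MX \<Otimes>\<^sub>M MA) (Ocon MX MA Aset Q \<eta> \<Delta> p g \<alpha>)"
      unfolding extreme_pts_def
    proof (intro CollectI conjI ballI allI impI)
      show "\<mu> \<in> Ocon MX MA Aset Q \<eta> \<Delta> p g \<alpha>" using \<mu> con det[OF \<phi>] by (auto simp: Ocon_def)
      fix \<nu>1 \<nu>2 and l :: real
      assume \<nu>: "\<nu>1 \<in> Ocon MX MA Aset Q \<eta> \<Delta> p g \<alpha>" "\<nu>2 \<in> Ocon MX MA Aset Q \<eta> \<Delta> p g \<alpha>"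
        and l: "0 < l \<and> l < 1 \<and> (\<forall>\<Gamma>\<in>sets (MX \<Otimes>\<^sub>M MA). emeasure \<mu> \<Gamma> = ennreal l * emeasure \<nu>1 \<Gamma> + ennreal (1 - l) * emeasure \<nu>2 \<Gamma>)"
      have "\<nu>1 = \<mu>" "\<nu>2 = \<mu>"
      proof -
        obtain \<pi>1 where \<pi>1: "policy Aset \<pi>1" "\<nu>1 = occm \<pi>1" using \<nu>(1) by (auto simp: Ocon_def)
        show "\<nu>1 = \<mu>" unfolding \<pi>1(2) \<mu>
          by (rule occ_component_of_det[OF \<phi>m N policy_kernels[OF \<pi>1(1)], of l]) (use l \<mu> \<pi>1 in auto)
        obtain \<pi>2 where \<pi>2: "policy Aset \<pi>2" "\<nu>2 = occm \<pi>2" using \<nu>(2) by (auto simp: Ocon_def)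
        show "\<nu>2 = \<mu>" unfolding \<pi>2(2) \<mu>
          by (rule occ_component_of_det[OF \<phi>m N policy_kernels[OF \<pi>2(1)], of "1 - l"]) (use l \<mu> \<pi>2 in auto)
      qed
      then show "\<nu>1 = \<nu>2" by simp
    qed
  next
    fix \<mu> assume ext: "\<mu> \<in> extreme_pts (MX \<Otimes>\<^sub>M MA) (Ocon MX MA Aset Q \<eta> \<Delta> p g \<alpha>)"
    then have "\<mu> \<in> Ocon MX MA Aset Q \<eta> \<Delta> p g \<alpha>" by (simp add: extreme_pts_def)
    then obtain \<pi> where \<pi>: "policy Aset \<pi>" and \<mu>: "\<mu> = occm \<pi>" and con: "constr p g \<alpha> \<mu>"
      by (auto simp: Ocon_def)
    note k = policy_kernels[OF \<pi>]
    obtain \<sigma> where \<sigma>: "\<sigma> \<in> stat" and adm: "\<And>x. x \<in> space MX \<Longrightarrow> emeasure (\<sigma> x) (Aset x) = 1"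
      and disint: "\<And>F. F \<in> borel_measurable (MX \<Otimes>\<^sub>M MA) \<Longrightarrow>
       (\<integral>\<^sup>+w. F w \<partial>occm \<pi>) = (\<integral>\<^sup>+x. Kint \<sigma> F x \<partial>distr (occm \<pi>) MX fst)"
      using admissible_disintegration[OF A K \<theta> \<theta>A \<pi> fin[OF \<pi>] f f' ff'] by blast
    have pol_\<sigma>: "policy Aset (stationary \<sigma>)" by (rule policy_markov[of "\<lambda>_. \<sigma>"]) (use \<sigma> adm in auto)
    \<comment> \<open>Switched policies are admissible, so each has a finite expected absorption
      time by the absorbing hypothesis; the vanishing of the remainder rests on this.\<close>
    have occ_\<sigma>: "occm (stationary \<sigma>) = occm \<pi>"
      by (rule occ_stationary_eq[OF k \<sigma> fin_st[OF \<pi>] fin_st[OF policy_switch[OF \<pi> pol_\<sigma>]] disint])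
    have zo: "AE x in distr (occm \<pi>) MX fst. measure (\<sigma> x) D \<in> {0, 1}" if D: "D \<in> sets MA" for D
      unfolding occ_\<sigma>[symmetric]
    proof (rule zero_one_of_no_split[OF \<sigma> fin[OF pol_\<sigma>] assms(4) D, of p g])
      fix h t
      assume h: "perturbation \<sigma> h" "perturbation \<sigma> (\<lambda>w. - h w)"
        and i: "\<And>i. i < p \<Longrightarrow> integral\<^sup>L (occm (pol \<sigma> t h)) (g i) = integral\<^sup>L (occm (stationary \<sigma>)) (g i)"
          "\<And>i. i < p \<Longrightarrow> integral\<^sup>L (occm (pol \<sigma> t (\<lambda>w. - h w))) (g i) = integral\<^sup>L (occm (stationary \<sigma>)) (g i)"
      \<comment> \<open>A perturbed policy is admissible, so its occupation measure lies in the
        constraint set as soon as its integrals of \<open>g\<close> agree with those of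
        \<open>\<mu>\<close>.\<close>
      have "occm (pol \<sigma> t h') \<in> Ocon MX MA Aset Q \<eta> \<Delta> p g \<alpha>"
        if "perturbation \<sigma> h'" "\<And>i. i < p \<Longrightarrow> integral\<^sup>L (occm (pol \<sigma> t h')) (g i) = integral\<^sup>L (occm (stationary \<sigma>)) (g i)" for h'
        using policy_pol[OF \<sigma> A adm that(1), of t] con that(2) unfolding Ocon_def constr_def \<mu> occ_\<sigma> by auto
      then have "occm (pol \<sigma> t h) \<in> Ocon MX MA Aset Q \<eta> \<Delta> p g \<alpha>" "occm (pol \<sigma> t (\<lambda>w. - h w)) \<in> Ocon MX MA Aset Q \<eta> \<Delta> p g \<alpha>"
        using h i by blast+
      moreover have "0 < (1/2::real) \<and> (1/2::real) < 1 \<and> (\<forall>\<Gamma>\<in>sets (MX \<Otimes>\<^sub>M MA). emeasure \<mu> \<Gamma> =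
          ennreal (1/2) * emeasure (occm (pol \<sigma> t h)) \<Gamma> + ennreal (1 - 1/2) * emeasure (occm (pol \<sigma> t (\<lambda>w. - h w))) \<Gamma>)"
        using occ_pol_midpoint[OF \<sigma> h, of _ t] unfolding \<mu> occ_\<sigma> by simp
      ultimately show "occm (pol \<sigma> t h) = occm (pol \<sigma> t (\<lambda>w. - h w))"
        using ext unfolding extreme_pts_def by blast
    qed (use assms(6) in auto)
    obtain \<phi> where \<phi>: "\<phi> \<in> det_policies MX MA Aset" and ae: "AE w in occm \<pi>. snd w = \<phi> (fst w)"
      by (rule deterministic_of_zero_one[OF A K \<theta> \<theta>A f f' ff' \<sigma> adm disint zo])
    have "\<mu> = occm (det_policy MA \<phi>)"
      unfolding \<mu> using \<phi> by (intro occ_graph_eq_det[OF k _ ae]) (simp add: det_policies_def)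
    then show "\<mu> \<in> ODcon MX MA Aset Q \<eta> \<Delta> p g \<alpha>" using \<phi> con by (auto simp: ODcon_def)
  qed
qed

end
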